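(* Let $\Omega\subset\mathbb{R}^2$ be a bounded convex region whose boundary $\partial\Omega$ is a closed $C^2$ curve. Let $u$ be of class $C^2$ and $v$ of class $C^1$ on the boundary layer $\Omega_\gamma^+\cup\partial\Omega\cup\Omega_\gamma^-$, and let $\mathcal{N}_\Omega$ be any one of the three nonlocal Neumann operators $\mathcal{N}_\Omega^-$, $\mathcal{N}_\Omega^+$, $\mathcal{N}_\Omega^*$; assume $u\in S_N(\Omega)$ for this operator. Then, as $\delta\to 0$, $$(\mathcal{N}_\Omega u,v)_{G}=\langle\sigma\,\partial_{\mathbf n}u,v\rangle_{\partial\Omega}+\mathcal{O}(\delta),$$ where $G=\Omega_\gamma^-$ if $\mathcal{N}_\Omega=\mathcal{N}_\Omega^-$ and $G=\Omega_\gamma^+$ if $\mathcal{N}_\Omega\in\{\mathcal{N}_\Omega^+,\mathcal{N}_\Omega^*\}$.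
   Context: Kernel: for each horizon $\delta>0$, $\gamma_\delta(\mathbf x,\mathbf y)=\widetilde\gamma_\delta(|\mathbf x-\mathbf y|)$ for $\mathbf x,\mathbf y\in\mathbb{R}^2$, with $\widetilde\gamma_\delta\ge0$, $\widetilde\gamma_\delta\in L^1(0,\delta)$, $\gamma_\delta(\mathbf x,\mathbf y)=0$ if $|\mathbf x-\mathbf y|>\delta$, and $\sigma:=\frac{\pi}{2}\int_0^\delta r^3\widetilde\gamma_\delta(r)\,dr$ finite and independent of $\delta$ (equivalently $\frac12\int_{\mathbb{R}^2}\mathbf x\otimes\mathbf x\,\widetilde\gamma_\delta(|\mathbf x|)d\mathbf x=\sigma I$). Sets: $B_\delta(\mathbf x)$ is the disc of radius $\delta$ centered at $\mathbf x$; $\Omega$ is open; $\Omega^-=\{\mathbf x\in\Omega:B_\delta(\mathbf x)\subset\Omega\}$, $\Omega_\gamma^-=\Omega\setminus\overline{\Omega^-}$, $\Omega^+=\mathbb{R}^2\setminus\overline{\{\mathbf x:B_\delta(\mathbf x)\cap\Omega=\emptyset\}}$, $\Omega_\gamma^+=\Omega^+\setminus\overline\Omega$. Operators: $\mathcal{N}_\Omega^-u(\mathbf x)=-\int_{\Omega_\gamma^+}[u(\mathbf x)-u(\mathbf y)]\gamma_\delta(\mathbf x,\mathbf y)d\mathbf y$ for $\mathbf x\in\Omega_\gamma^-$; $\mathcal{N}_\Omega^+u(\mathbf x)=\int_{\Omega_\gamma^-}[u(\mathbf x)-u(\mathbf y)]\gamma_\delta(\mathbf x,\mathbf y)d\mathbf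 y$ for $\mathbf x\in\Omega_\gamma^+$; $\mathcal{N}_\Omega^*u(\mathbf x)=\int_{\Omega^+}[u(\mathbf x)-u(\mathbf y)]\gamma_\delta(\mathbf x,\mathbf y)d\mathbf y$ for $\mathbf x\in\Omega_\gamma^+$. $S_N(\Omega)$ is the set of $u$ for which $|\mathcal{N}_\Omega u|$ is bounded on the layer where $\mathcal{N}_\Omega u$ is defined. Notation: $(w,v)_G=\int_G wv\,d\mathbf x$; $\langle w,v\rangle_{\partial\Omega}=\int_{\partial\Omega}wv$ with respect to arc length; $\partial_{\mathbf n}$ is the outward normal derivative. The functions $u,v$ are fixed, i.e. given on the boundary layer $\{\mathrm{dist}(\mathbf x,\partial\Omega)<\delta_0\}$ for some fixed $\delta_0>0$ and independent of $\delta$; $\mathcal{O}(\delta)$ denotes a quantity bounded by $C\delta$ for all sufficiently small $\delta$, with $C$ independent of $\delta$. *)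

theory Defs
  imports "HOL-Analysis.Analysis" "HOL-Library.Landau_Symbols"
begin

type_synonym plane = "real ^ 2"

text \<open>The family of kernels is given by radial profiles: \<open>g \<delta> r\<close> is
  the profile with horizon \<open>\<delta>\<close> at distance \<open>r \<ge> 0\<close>. Since
  \<open>g \<delta>\<close> is in \<open>L\<^sup>1(0,\<delta>)\<close>, the moment defining \<open>\<sigma>\<close>
  is automatically finite; it is required to be the same for all horizons.\<close>

definition nonlocal_kernel :: "(real \<Rightarrow> real \<Rightarrow> real) \<Rightarrow> real \<Rightarrow> bool" where
  "nonlocal_kernel g \<sigma> \<longleftrightarrow>
     (\<forall>\<delta>>0. (\<forall>r\<ge>0. g \<delta> r \<ge> 0) \<and>
            (\<forall>r>\<delta>. g \<delta> r = 0) \<and>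
            set_integrable lebesgue {0<..<\<delta>} (g \<delta>) \<and>
            \<sigma> = pi / 2 * (LINT r:{0<..<\<delta>}|lebesgue. r ^ 3 * g \<delta> r))"

definition kernel :: "(real \<Rightarrow> real \<Rightarrow> real) \<Rightarrow> real \<Rightarrow> plane \<Rightarrow> plane \<Rightarrow> real" where
  "kernel g \<delta> x y = g \<delta> (norm (x - y))"

definition inner_region :: "plane set \<Rightarrow> real \<Rightarrow> plane set" where
  "inner_region \<Omega> \<delta> = {x \<in> \<Omega>. ball x \<delta> \<subseteq> \<Omega>}"

definition inner_layer :: "plane set \<Rightarrow> real \<Rightarrow> plane set" where
  "inner_layer \<Omega> \<delta> = \<Omega> - closure (inner_region \<Omega> \<delta>)"

definition outer_region :: "plane set \<Rightarrow> real \<Rightarrow> plane set" where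
  "outer_region \<Omega> \<delta> = UNIV - closure {x. ball x \<delta> \<inter> \<Omega> = {}}"

definition outer_layer :: "plane set \<Rightarrow> real \<Rightarrow> plane set" where
  "outer_layer \<Omega> \<delta> = outer_region \<Omega> \<delta> - closure \<Omega>"

datatype neumann_type = N_minus | N_plus | N_star

fun neumann ::
  "neumann_type \<Rightarrow> (real \<Rightarrow> real \<Rightarrow> real) \<Rightarrow> plane set \<Rightarrow> real \<Rightarrow> (plane \<Rightarrow> real) \<Rightarrow> plane \<Rightarrow> real"
where
  "neumann N_minus g \<Omega> \<delta> u x =
     - (LINT y:outer_layer \<Omega> \<delta>|lebesgue. (u x - u y) * kernel g \<delta> x y)"
| "neumann N_plus g \<Omega> \<delta> u x =
     (LINT y:inner_layer \<Omega> \<delta>|lebesgue. (u x - u y) * kernel g \<delta> x y)"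
| "neumann N_star g \<Omega> \<delta> u x =
     (LINT y:outer_region \<Omega> \<delta>|lebesgue. (u x - u y) * kernel g \<delta> x y)"

fun neumann_layer :: "neumann_type \<Rightarrow> plane set \<Rightarrow> real \<Rightarrow> plane set" where
  "neumann_layer N_minus \<Omega> \<delta> = inner_layer \<Omega> \<delta>"
| "neumann_layer N_plus \<Omega> \<delta> = outer_layer \<Omega> \<delta>"
| "neumann_layer N_star \<Omega> \<delta> = outer_layer \<Omega> \<delta>"

text \<open>The bound is for fixed \<open>\<delta>\<close>; it is not required to be uniform in \<open>\<delta>\<close>.\<close>

definition S_N ::
  "neumann_type \<Rightarrow> (real \<Rightarrow> real \<Rightarrow> real) \<Rightarrow> plane set \<Rightarrow> real \<Rightarrow> (plane \<Rightarrow> real) set" where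
  "S_N N g \<Omega> \<delta> = {u. bounded (neumann N g \<Omega> \<delta> u ` neumann_layer N \<Omega> \<delta>)}"

text \<open>Both regularity notions are meant for open \<open>S\<close> (full derivatives at each point).\<close>

definition C1_on :: "'a::real_normed_vector set \<Rightarrow> ('a \<Rightarrow> 'b::real_normed_vector) \<Rightarrow> bool" where
  "C1_on S f \<longleftrightarrow>
     (\<exists>f' :: 'a \<Rightarrow> 'a \<Rightarrow>\<^sub>L 'b.
        (\<forall>x\<in>S. (f has_derivative blinfun_apply (f' x)) (at x)) \<and> continuous_on S f')"

definition C2_on :: "'a::real_normed_vector set \<Rightarrow> ('a \<Rightarrow> 'b::real_normed_vector) \<Rightarrow> bool" where
  "C2_on S f \<longleftrightarrow>
     (\<exists>f' :: 'a \<Rightarrow> 'a \<Rightarrow>\<^sub>L 'b.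
        (\<forall>x\<in>S. (f has_derivative blinfun_apply (f' x)) (at x)) \<and> C1_on S f')"

text \<open>A regular simple closed curve whose periodic extension is \<open>C\<^sup>2\<close>, so the derivatives
  (one-sided at the endpoints of the unit interval) agree at \<open>0\<close> and \<open>1\<close>.\<close>

definition closed_C2_curve :: "(real \<Rightarrow> plane) \<Rightarrow> bool" where
  "closed_C2_curve c \<longleftrightarrow>
     simple_path c \<and> pathfinish c = pathstart c \<and>
     (\<exists>c' c''.
        (\<forall>t\<in>{0..1}. (c has_vector_derivative c' t) (at t within {0..1}) \<and>
                    (c' has_vector_derivative c'' t) (at t within {0..1}) \<and>
                    c' t \<noteq> 0) \<and>
        continuous_on {0..1} c'' \<and> c' 0 = c' 1 \<and> c'' 0 = c'' 1)"

definition arc_length_integral :: "(real \<Rightarrow> plane) \<Rightarrow> (plane \<Rightarrow> real) \<Rightarrow> real" where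
  "arc_length_integral c f =
     integral {0..1} (\<lambda>t. f (c t) * norm (vector_derivative c (at t within {0..1})))"

text \<open>The unit vector normal to the curve \<open>c\<close> parametrizing the boundary of \<open>\<Omega>\<close>
  at the boundary point \<open>p\<close> that points out of \<open>\<Omega>\<close>. The orientation of \<open>c\<close> is irrelevant.\<close>

definition outward_normal :: "plane set \<Rightarrow> (real \<Rightarrow> plane) \<Rightarrow> plane \<Rightarrow> plane" where
  "outward_normal \<Omega> c p =
     (THE n. norm n = 1 \<and>
        (\<forall>t\<in>{0..1}. c t = p \<longrightarrow> n \<bullet> vector_derivative c (at t within {0..1}) = 0) \<and>
        (\<forall>\<^sub>F s in at_right 0. p + s *\<^sub>R n \<notin> \<Omega> \<and> p - s *\<^sub>R n \<in> \<Omega>))"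

definition normal_derivative ::
  "plane set \<Rightarrow> (real \<Rightarrow> plane) \<Rightarrow> (plane \<Rightarrow> real) \<Rightarrow> plane \<Rightarrow> real" where
  "normal_derivative \<Omega> c u p = frechet_derivative u (at p) (outward_normal \<Omega> c p)"

definition inner_on :: "plane set \<Rightarrow> (plane \<Rightarrow> real) \<Rightarrow> (plane \<Rightarrow> real) \<Rightarrow> real" where
  "inner_on G w v = (LINT x:G|lebesgue. w x * v x)"

definition boundary_pairing ::
  "(real \<Rightarrow> plane) \<Rightarrow> (plane \<Rightarrow> real) \<Rightarrow> (plane \<Rightarrow> real) \<Rightarrow> real" where
  "boundary_pairing c w v = arc_length_integral c (\<lambda>p. w p * v p)"

end

theory Submission
  imports Defs
begin

text \<open>
  Every one of the three pairings is a double integral over pairs of points \<open>x\<close>, \<open>y = x + z\<close> with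
  \<open>norm z < \<delta>\<close>, weighted by the kernel. Such pairs are found only near the boundary, and those that count are
  the pairs that straddle it; the third operator also has pairs of two outer points. Let \<open>\<mu>\<close> be the
  measure on the plane with density \<open>k (norm z)\<close>. Its total mass may blow up as \<open>\<delta>\<close> shrinks, but the integral of
  \<open>(norm z)\<^sup>2\<close> is always \<open>4 \<sigma>\<close>. Hence any contribution of the form ``second order in \<open>z\<close>, times area of
  the layer'' is \<open>O(\<delta>)\<close>, since the layer of width \<open>\<delta>\<close> has area \<open>O(\<delta>)\<close> (\<open>measure_tube\<close>).

  The double integral is symmetrized under exchange of the two points (\<open>integral_pair_reflect\<close>). Up to such
  second order errors, a Taylor expansion of \<open>u\<close> makes all three symmetrized integrands equal to
  \<open>(indicator \<Omega> x - indicator \<Omega> (x + z)) * (F x \<bullet> z)\<close> with \<open>F = v \<nabla>u\<close>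
  (\<open>layer_integrand_symmetrized\<close>). In particular, pairs of outer points cancel to second order.

  The field \<open>F\<close> is extended into \<open>\<Omega>\<close> by a \<open>C\<^sup>1\<close> cutoff. For fixed \<open>z\<close>, a translation shows that the integral of
  the last expression over \<open>x\<close> is the integral of \<open>(F x - F (x - z)) \<bullet> z\<close> over \<open>\<Omega>\<close>. This is
  \<open>z \<bullet> A z\<close> up to an error of third order, where \<open>A\<close> is the integral of the Jacobian matrix of \<open>F\<close> over \<open>\<Omega>\<close>
  (\<open>translation_estimate\<close>). By rotational symmetry the integral of \<open>z \<bullet> A z\<close> against \<open>\<mu>\<close> is \<open>2 \<sigma>\<close> times the trace of \<open>A\<close>.
  The factor \<open>1 / 2\<close> from the symmetrization leaves \<open>\<sigma>\<close> times the integral of the divergence of \<open>F\<close>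
  (\<open>double_integral_estimate\<close>), and by the divergence theorem this is \<open>\<sigma>\<close> times the flux of \<open>v \<nabla>u\<close> through the
  boundary. The volume integral is only a detour: it spares any analysis in boundary coordinates.

  For a convex region the divergence theorem (\<open>gauss_green\<close>) follows from the fundamental theorem
  of calculus in polar coordinates around an interior point, where convexity makes the Jacobian nonzero.
\<close>

section \<open>Convex regions bounded by a regular curve\<close>

text \<open>Rotation by a right angle, clockwise: if \<open>w\<close> is tangent to a curve, \<open>rot w\<close> is normal to it. The
  inner product \<open>a \<bullet> rot b\<close> is the determinant with columns \<open>a\<close>, \<open>b\<close>.\<close>

definition rot :: "plane \<Rightarrow> plane" where "rot w = vector [w $ 2, - (w $ 1)]"

lemma rot_simps [simp]: "rot w $ 1 = w $ 2" "rot w $ 2 = - (w $ 1)"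
  by (auto simp: rot_def)

lemma inner_plane: "(x::plane) \<bullet> y = x $ 1 * y $ 1 + x $ 2 * y $ 2"
  by (simp add: inner_vec_def UNIV_2)

lemma norm_plane_sq: "(norm (x::plane))\<^sup>2 = (x $ 1)\<^sup>2 + (x $ 2)\<^sup>2"
  unfolding power2_norm_eq_inner inner_plane by (simp add: power2_eq_square)

lemma plane_eq_iff: "(x::plane) = y \<longleftrightarrow> x $ 1 = y $ 1 \<and> x $ 2 = y $ 2"
  by (simp add: vec_eq_iff forall_2)

lemma norm_rot [simp]: "norm (rot w) = norm w"
proof -
  have "(norm (rot w))\<^sup>2 = (norm w)\<^sup>2" by (simp add: norm_plane_sq)
  then show ?thesis by simp
qed

lemma bounded_linear_rot: "bounded_linear rot"
  by (auto intro!: linearI simp: linear_conv_bounded_linear[symmetric] plane_eq_iff)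

lemma perpendicular_multiple_rot:
  assumes "n \<bullet> w = 0" "w \<noteq> 0"
  shows "n = ((n \<bullet> rot w) / (norm w)\<^sup>2) *\<^sub>R rot w"
proof -
  have nz: "(w $ 1)\<^sup>2 + (w $ 2)\<^sup>2 \<noteq> 0"
    using assms(2) by (simp add: plane_eq_iff sum_power2_eq_zero_iff)
  have p: "n $ 1 * w $ 1 = - (n $ 2 * w $ 2)"
    using assms(1) by (simp add: inner_plane)
  have "((n \<bullet> rot w)) *\<^sub>R rot w = ((norm w)\<^sup>2) *\<^sub>R n"
    unfolding plane_eq_iff norm_plane_sq inner_plane using p
    by (simp add: algebra_simps power2_eq_square) algebra
  then show ?thesis using nz unfolding norm_plane_sq[symmetric]
    by (metis (no_types, lifting) divide_inverse_commute scaleR_scaleR scaleR_one left_inverse)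
qed

lemma vector_derivative_within_unit_interval:
  fixes c :: "real \<Rightarrow> 'a::real_normed_vector"
  assumes "(c has_vector_derivative d) (at t within {0..1})" "t \<in> {0..1}"
  shows "vector_derivative c (at t within {0..1}) = d"
  using assms by (metis atLeastAtMost_iff vector_derivative_within_cbox cbox_interval zero_less_one box_real(2))

text \<open>The derivatives match at the two ends of the parameter interval, which gives the base point of the
  closed curve a tangent like any other boundary point. The point \<open>x0\<close> is an arbitrary
  interior point. It serves as the centre of polar coordinates and tells the inner side of the boundary
  from the outer side.\<close>

locale convex_C1_region =
  fixes \<Omega> :: "plane set" and c c' :: "real \<Rightarrow> plane" and x0 :: plane
  assumes open_region: "open \<Omega>" and bounded_region: "bounded \<Omega>" and convex_region: "convex \<Omega>"
    and x0: "x0 \<in> \<Omega>"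
    and simple_boundary: "simple_path c" and closed_boundary: "c 1 = c 0"
    and boundary: "c ` {0..1} = frontier \<Omega>"
    and boundary_deriv: "t \<in> {0..1} \<Longrightarrow> (c has_vector_derivative c' t) (at t within {0..1})"
    and boundary_cont: "continuous_on {0..1} c'"
    and boundary_regular: "t \<in> {0..1} \<Longrightarrow> c' t \<noteq> 0"
    and boundary_closed_deriv: "c' 0 = c' 1"
begin

text \<open>A functional that attains its maximum over the region at a boundary point is maximal there along the
  boundary curve, so its derivative along the curve vanishes. At the base point the two one-sided
  derivatives have opposite signs, and they agree because the curve closes up smoothly.\<close>

lemma supporting_tangent:
  assumes t: "t \<in> {0..1}" and a: "\<And>x. x \<in> \<Omega> \<Longrightarrow> a \<bullet> x \<le> a \<bullet> c t"
  shows "a \<bullet> c' t = 0"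
proof -
  have le: "a \<bullet> c s \<le> a \<bullet> c t" if "s \<in> {0..1}" for s
  proof -
    have "c s \<in> closure \<Omega>" using boundary that by (auto simp: frontier_def)
    moreover have "closure \<Omega> \<subseteq> {x. a \<bullet> x \<le> a \<bullet> c t}"
      by (rule closure_minimal) (auto simp: a closed_halfspace_le)
    ultimately show ?thesis by blast
  qed
  have d: "((\<lambda>s. a \<bullet> c s) has_real_derivative a \<bullet> c' s) (at s within {0..1})" if "s \<in> {0..1}" for s
    using boundary_deriv[OF that] unfolding has_vector_derivative_def has_field_derivative_def
    by (auto intro!: derivative_eq_intros)
  have up: "a \<bullet> c' s \<le> 0" if s: "s \<in> {0..1}" "s < 1" "a \<bullet> c s = a \<bullet> c t" for s
  proof (rule ccontr)
    assume "\<not> ?thesis"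
    then obtain e where e: "e > 0" "\<And>h. h > 0 \<Longrightarrow> s + h \<in> {0..1} \<Longrightarrow> h < e \<Longrightarrow> a \<bullet> c s < a \<bullet> c (s + h)"
      using has_real_derivative_pos_inc_right[OF d[OF s(1)]] by auto
    define h where "h = min (e/2) (1 - s)"
    have "h > 0" "s + h \<in> {0..1}" "h < e" using e s by (auto simp: h_def)
    then show False using e(2)[of h] le[of "s + h"] s by auto
  qed
  have dn: "a \<bullet> c' s \<ge> 0" if s: "s \<in> {0..1}" "s > 0" "a \<bullet> c s = a \<bullet> c t" for s
  proof (rule ccontr)
    assume "\<not> ?thesis"
    then obtain e where e: "e > 0" "\<And>h. h > 0 \<Longrightarrow> s - h \<in> {0..1} \<Longrightarrow> h < e \<Longrightarrow> a \<bullet> c s < a \<bullet> c (s - h)"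
      using has_real_derivative_neg_dec_left[OF d[OF s(1)]] by auto
    define h where "h = min (e/2) s"
    have "h > 0" "s - h \<in> {0..1}" "h < e" using e s by (auto simp: h_def)
    then show False using e(2)[of h] le[of "s - h"] s by auto
  qed
  consider "0 < t" "t < 1" | "t = 0" | "t = 1" using t by force
  then show ?thesis
  proof cases
    case 1 then show ?thesis using up[of t] dn[of t] t by auto
  next
    case 2 then show ?thesis using up[of 0] dn[of 1] closed_boundary boundary_closed_deriv by auto
  next
    case 3 then show ?thesis using up[of 0] dn[of 1] closed_boundary boundary_closed_deriv by auto
  qed
qed

lemma boundary_notin: "t \<in> {0..1} \<Longrightarrow> c t \<notin> \<Omega>"
  using boundary open_region by (auto simp: frontier_def interior_open)

lemma boundary_closure: "t \<in> {0..1} \<Longrightarrow> c t \<in> closure \<Omega>"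
  using boundary by (auto simp: frontier_def)

lemma separating_functional_strict:
  assumes "a \<noteq> 0" "\<And>x. x \<in> \<Omega> \<Longrightarrow> a \<bullet> x \<le> b" "x \<in> \<Omega>"
  shows "a \<bullet> x < b"
proof -
  obtain e where e: "e > 0" "ball x e \<subseteq> \<Omega>" using open_region assms(3) openE by blast
  define y where "y = x + (e / (2 * norm a)) *\<^sub>R a"
  have "dist x y < e" using e assms(1) by (simp add: y_def dist_norm)
  then have "a \<bullet> y \<le> b" using e assms(2) by auto
  moreover have "a \<bullet> y = a \<bullet> x + (e / (2 * norm a)) * (a \<bullet> a)" by (simp add: y_def inner_add_right)
  moreover have "(e / (2 * norm a)) * (a \<bullet> a) > 0" using e assms(1) by simp
  ultimately show ?thesis by linarith
qed

lemma supporting_functional: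
  assumes t: "t \<in> {0..1}"
  obtains a where "a \<noteq> 0" "a \<bullet> c' t = 0" "\<And>x. x \<in> \<Omega> \<Longrightarrow> a \<bullet> x < a \<bullet> c t"
proof -
  obtain a b where ab: "a \<noteq> 0" "\<forall>x\<in>\<Omega>. a \<bullet> x \<le> b" "\<forall>x\<in>{c t}. a \<bullet> x \<ge> b"
    using separating_hyperplane_sets[OF convex_region convex_singleton[of "c t"]] x0 boundary_notin[OF t] by blast
  have s: "a \<bullet> x < a \<bullet> c t" if "x \<in> \<Omega>" for x
    using separating_functional_strict[OF ab(1) _ that, of b] ab by fastforce
  show thesis
  proof (rule that[OF ab(1) _ s])
    show "a \<bullet> c' t = 0" using supporting_tangent[OF t, of a] s by (simp add: less_imp_le)
  qed
qed

text \<open>A supporting functional vanishes on the tangent but not on the segment to an interior point, hence the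
  two directions differ. This makes polar coordinates around \<open>x0\<close> nonsingular up to the boundary.\<close>

lemma radial_transverse:
  assumes t: "t \<in> {0..1}"
  shows "(c t - x0) \<bullet> rot (c' t) \<noteq> 0"
proof
  assume z: "(c t - x0) \<bullet> rot (c' t) = 0"
  obtain a where a: "a \<noteq> 0" "a \<bullet> c' t = 0" "\<And>x. x \<in> \<Omega> \<Longrightarrow> a \<bullet> x < a \<bullet> c t"
    using supporting_functional[OF t] by blast
  have "a \<bullet> (c t - x0) > 0" using a(3)[OF x0] by (simp add: inner_diff_right)
  moreover have "a = ((a \<bullet> rot (c' t)) / (norm (c' t))\<^sup>2) *\<^sub>R rot (c' t)"
    by (rule perpendicular_multiple_rot[OF a(2) boundary_regular[OF t]])
  ultimately show False using z by (metis inner_commute inner_scaleR_left mult_zero_right less_irrefl)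
qed

text \<open>The sign is \<open>1\<close> if the curve runs anticlockwise around \<open>x0\<close> and \<open>-1\<close> otherwise.\<close>

definition orient :: real where "orient = sgn ((c 0 - x0) \<bullet> rot (c' 0))"

lemma curve_continuous: "continuous_on {0..1} c"
  using simple_boundary by (simp add: simple_path_def path_def)

lemma continuous_on_rot [continuous_intros]: "continuous_on S f \<Longrightarrow> continuous_on S (\<lambda>t. rot (f t))"
  by (rule bounded_linear.continuous_on[OF bounded_linear_rot])

lemma orient_radial:
  assumes t: "t \<in> {0..1}"
  shows "sgn ((c t - x0) \<bullet> rot (c' t)) = orient" "orient * ((c t - x0) \<bullet> rot (c' t)) > 0"
        "orient = 1 \<or> orient = -1"
proof -
  let ?D = "\<lambda>t. (c t - x0) \<bullet> rot (c' t)"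
  have cont: "continuous_on {0..1} ?D"
    by (intro continuous_intros curve_continuous boundary_cont)
  have con: "connected (?D ` {0..1})"
    by (intro connected_continuous_image cont) simp
  have nz: "0 \<notin> ?D ` {0..1}" using radial_transverse by force
  have *: "sgn (?D t) = sgn (?D 0)"
  proof (rule ccontr)
    assume "sgn (?D t) \<noteq> sgn (?D 0)"
    then have "(?D t < 0 \<and> ?D 0 > 0) \<or> (?D t > 0 \<and> ?D 0 < 0)"
      using radial_transverse[OF t] radial_transverse[of 0] by (auto simp: sgn_if split: if_splits)
    moreover have "?D t \<in> ?D ` {0..1}" "?D 0 \<in> ?D ` {0..1}" using t by (auto intro!: imageI)
    ultimately show False
      using connectedD_interval[OF con, of "?D t" "?D 0" 0] connectedD_interval[OF con, of "?D 0" "?D t" 0] nz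
      by (meson less_imp_le)
  qed
  then show "sgn (?D t) = orient" by (simp add: orient_def)
  then have o: "orient = sgn (?D t)" by simp
  have "orient * ?D t = \<bar>?D t\<bar>" unfolding o by (simp only: abs_sgn mult.commute)
  then show "orient * ?D t > 0" using radial_transverse[OF t] by linarith
  show "orient = 1 \<or> orient = -1"
    unfolding o using radial_transverse[OF t] by (auto simp: sgn_if)
qed

text \<open>The only unit vectors orthogonal to the tangent are plus and minus the rotated unit tangent. The one
  that has a positive product with \<open>c t - x0\<close> is a positive multiple of a supporting functional, so it leads
  out of the region. Its opposite leads into the region: otherwise a second supporting functional,
  separating the region from the inward ray, would point in the opposite direction.\<close>

lemma outward_normal_eq:
  assumes t: "t \<in> {0..1}"
  shows "outward_normal \<Omega> c (c t) = (orient / norm (c' t)) *\<^sub>R rot (c' t)"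
proof -
  define m where "m = (orient / norm (c' t)) *\<^sub>R rot (c' t)"
  obtain a where a: "a \<noteq> 0" "a \<bullet> c' t = 0" "\<And>x. x \<in> \<Omega> \<Longrightarrow> a \<bullet> x < a \<bullet> c t"
    using supporting_functional[OF t] by blast
  have nc: "norm (c' t) > 0" using boundary_regular[OF t] by simp
  have o2: "orient * orient = 1" using orient_radial(3)[OF t] by auto
  have multiple: "\<exists>k. b = k *\<^sub>R m" if "b \<bullet> c' t = 0" for b
  proof -
    have "b = ((b \<bullet> rot (c' t)) / (norm (c' t))\<^sup>2) *\<^sub>R rot (c' t)"
      by (rule perpendicular_multiple_rot[OF that boundary_regular[OF t]])
    also have "\<dots> = ((b \<bullet> rot (c' t)) / norm (c' t) * orient) *\<^sub>R m"
      using nc o2 by (simp add: m_def power2_eq_square field_simps)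
    finally show ?thesis by blast
  qed
  have m1: "norm m = 1" unfolding m_def using nc orient_radial(3)[OF t] by auto
  have mperp: "m \<bullet> c' t = 0" by (simp add: m_def inner_plane)
  have mx0: "m \<bullet> (c t - x0) > 0"
    using orient_radial(2)[OF t] nc by (simp add: m_def inner_commute zero_less_divide_iff)
  obtain k where k: "a = k *\<^sub>R m" using multiple[OF a(2)] by blast
  have "a \<bullet> (c t - x0) > 0" using a(3)[OF x0] by (simp add: inner_diff_right)
  then have "k * (m \<bullet> (c t - x0)) > 0" unfolding k by (simp only: inner_scaleR_left)
  then have k0: "k > 0" using mx0 by (meson less_imp_le not_less zero_less_mult_pos2)
  have mm: "m \<bullet> m = 1" using m1 by (simp only: dot_square_norm) simp
  have kk: "a \<bullet> m > 0" using k0 unfolding k by (simp only: inner_scaleR_left[of k] mm)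
  have out: "c t + s *\<^sub>R m \<notin> \<Omega>" if "s > 0" for s
  proof
    assume "c t + s *\<^sub>R m \<in> \<Omega>"
    then have "a \<bullet> (c t + s *\<^sub>R m) < a \<bullet> c t" by (rule a(3))
    then have "s * (a \<bullet> m) < 0" by (simp only: inner_add_right inner_scaleR_right[of _ s])
    then show False using mult_pos_pos[OF that kk] by linarith
  qed
  \<comment> \<open>One point on the inward ray suffices: by convexity the segment from it to the boundary point is inside.\<close>
  have "\<exists>s>0. c t - s *\<^sub>R m \<in> \<Omega>"
  proof (rule ccontr)
    assume no: "\<not> ?thesis"
    let ?R = "(\<lambda>s. c t - s *\<^sub>R m) ` {0<..}"
    have "convex ?R"
    proof -
      have "?R = (\<lambda>x. c t + x) ` ((\<lambda>s. s *\<^sub>R (- m)) ` {0<..})" by (auto simp: image_image)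
      moreover have "convex ((\<lambda>s. s *\<^sub>R (- m)) ` {0<..})"
        using convex_linear_image[OF bounded_linear.linear[OF bounded_linear_scaleR_left], of "{0<..}" "- m"] by simp
      ultimately show ?thesis by (simp only: convex_translation_eq)
    qed
    then obtain b \<beta> where b: "b \<noteq> 0" "\<forall>x\<in>\<Omega>. b \<bullet> x \<le> \<beta>" "\<forall>x\<in>?R. b \<bullet> x \<ge> \<beta>"
    proof -
      have "?R \<noteq> {}" "\<Omega> \<inter> ?R = {}" "\<Omega> \<noteq> {}" using no x0 by auto
      with \<open>convex ?R\<close> show ?thesis
        using separating_hyperplane_sets[OF convex_region \<open>convex ?R\<close>] that by blast
    qed
    have bR: "b \<bullet> c t - s * (b \<bullet> m) \<ge> \<beta>" if "s > 0" for s
      using b(3) that by (auto simp: inner_diff_right)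
    have "((\<lambda>s. b \<bullet> c t - s * (b \<bullet> m)) \<longlongrightarrow> b \<bullet> c t - 0 * (b \<bullet> m)) (at_right 0)"
      by (intro tendsto_intros)
    then have bp: "b \<bullet> c t \<ge> \<beta>"
      using tendsto_lowerbound[OF _ _ trivial_limit_at_right_real, of _ _ 0 \<beta>] eventually_mono[OF eventually_at_right_less bR]
      by fastforce
    have s: "b \<bullet> x < b \<bullet> c t" if "x \<in> \<Omega>" for x
      using separating_functional_strict[OF b(1) _ that, of \<beta>] b bp by fastforce
    have bm: "b \<bullet> m \<le> 0"
    proof (rule ccontr)
      assume "\<not> ?thesis"
      then have pos: "b \<bullet> m > 0" by simp
      define s where "s = (b \<bullet> c t - \<beta> + 1) / (b \<bullet> m)"
      have "s > 0" using pos bp by (simp add: s_def)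
      moreover have "s * (b \<bullet> m) = b \<bullet> c t - \<beta> + 1" using pos by (simp add: s_def)
      ultimately show False using bR[of s] by auto
    qed
    have "b \<bullet> c' t = 0" using supporting_tangent[OF t, of b] s by (simp add: less_imp_le)
    then obtain j where j: "b = j *\<^sub>R m" using multiple by blast
    have "b \<bullet> (c t - x0) > 0" using s[OF x0] by (simp add: inner_diff_right)
    then have "j * (m \<bullet> (c t - x0)) > 0" unfolding j by (simp only: inner_scaleR_left)
    then have "j > 0" using mx0 by (meson less_imp_le not_less zero_less_mult_pos2)
    then show False using bm unfolding j by (simp only: inner_scaleR_left[of j] mm)
  qed
  then obtain s0 where s0: "s0 > 0" "c t - s0 *\<^sub>R m \<in> \<Omega>" by blast
  have inn: "c t - s *\<^sub>R m \<in> \<Omega>" if s: "s > 0" "s \<le> s0" for s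
  proof -
    have "c t - (s / s0) *\<^sub>R (c t - (c t - s0 *\<^sub>R m)) \<in> interior \<Omega>"
      by (rule mem_interior_closure_convex_shrink)
         (use convex_region s0 s open_region boundary_closure[OF t] in \<open>auto simp: interior_open\<close>)
    then show ?thesis using s0 open_region by (simp add: interior_open)
  qed
  have tang: "vector_derivative c (at s within {0..1}) = c' s" if "s \<in> {0..1}" for s
    using vector_derivative_within_unit_interval[OF boundary_deriv[OF that] that] .
  have same: "c' s = c' t" if "s \<in> {0..1}" "c s = c t" for s
  proof -
    have "s = t \<or> (s = 0 \<and> t = 1) \<or> (s = 1 \<and> t = 0)"
      using simple_boundary that t by (auto simp: simple_path_def loop_free_def)
    then show ?thesis using boundary_closed_deriv by auto
  qed
  show ?thesis unfolding outward_normal_def m_def[symmetric]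
  proof (rule the_equality, intro conjI ballI impI)
    show "norm m = 1" by fact
    show "m \<bullet> vector_derivative c (at s within {0..1}) = 0" if "s \<in> {0..1}" "c s = c t" for s
      using tang[OF that(1)] same[OF that] mperp by simp
    show "\<forall>\<^sub>F s in at_right 0. c t + s *\<^sub>R m \<notin> \<Omega> \<and> c t - s *\<^sub>R m \<in> \<Omega>"
      unfolding eventually_at_right_field using s0 out inn by (intro exI[of _ s0]) auto
  next
    fix n assume n: "norm n = 1 \<and>
       (\<forall>s\<in>{0..1}. c s = c t \<longrightarrow> n \<bullet> vector_derivative c (at s within {0..1}) = 0) \<and>
       (\<forall>\<^sub>F s in at_right 0. c t + s *\<^sub>R n \<notin> \<Omega> \<and> c t - s *\<^sub>R n \<in> \<Omega>)"
    then have "n \<bullet> c' t = 0" using tang[OF t] t by auto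
    then obtain k where k: "n = k *\<^sub>R m" using multiple by blast
    have "\<bar>k\<bar> = 1" using n m1 unfolding k by simp
    moreover have "k \<noteq> -1"
    proof
      assume "k = -1"
      then have "\<forall>\<^sub>F s in at_right 0. c t + s *\<^sub>R m \<in> \<Omega>"
        using n unfolding k by (auto elim: eventually_mono)
      then obtain d where "d > 0" "\<forall>s>0. s < d \<longrightarrow> c t + s *\<^sub>R m \<in> \<Omega>"
        unfolding eventually_at_right_field by auto
      then show False using out[of "d/2"] by auto
    qed
    ultimately have "k = 1" by linarith
    then show "n = m" using k by simp
  qed
qed

end

section \<open>The divergence theorem in polar coordinates\<close>

text \<open>The change of variables theorem lives on \<open>real ^ 2\<close>, the theorem on iterated integrals on
  \<open>real \<times> real\<close>; the two are matched by a map that preserves the area of boxes.\<close>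

lemma has_integral_unit_square:
  fixes \<psi> :: "real \<Rightarrow> real \<Rightarrow> real"
  assumes "continuous_on (cbox (0,0) (1,1)) (\<lambda>(s,t). \<psi> s t)"
  shows "((\<lambda>p::plane. \<psi> (p $ 1) (p $ 2)) has_integral
           integral {0..1} (\<lambda>s. integral {0..1} (\<psi> s))) (cbox 0 1)"
proof -
  let ?f = "\<lambda>(s,t). \<psi> s t"
  let ?g = "\<lambda>p::plane. (p $ 1, p $ 2)" and ?h = "\<lambda>(s,t). (vector [s, t] :: plane)"
  have g: "?g ` cbox u v = cbox (u $ 1, u $ 2) (v $ 1, v $ 2)" for u v :: plane
  proof
    show "?g ` cbox u v \<subseteq> cbox (u $ 1, u $ 2) (v $ 1, v $ 2)"
      by (auto simp: mem_box_cart forall_2 cbox_Pair_eq)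
    show "cbox (u $ 1, u $ 2) (v $ 1, v $ 2) \<subseteq> ?g ` cbox u v"
    proof
      fix q assume q: "q \<in> cbox (u $ 1, u $ 2) (v $ 1, v $ 2)"
      have "q = ?g (?h q)" by (auto split: prod.split)
      moreover have "?h q \<in> cbox u v" using q by (auto simp: mem_box_cart forall_2 cbox_Pair_eq split: prod.split)
      ultimately show "q \<in> ?g ` cbox u v" by blast
    qed
  qed
  have h: "?h ` cbox u v = cbox (?h u) (?h v)" for u v :: "real \<times> real"
  proof
    show "?h ` cbox u v \<subseteq> cbox (?h u) (?h v)"
      by (cases u, cases v) (auto simp: mem_box_cart forall_2 cbox_Pair_eq)
    show "cbox (?h u) (?h v) \<subseteq> ?h ` cbox u v"
    proof
      fix q assume q: "q \<in> cbox (?h u) (?h v)"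
      have "q = ?h (?g q)" by (simp add: plane_eq_iff)
      moreover have "?g q \<in> cbox u v" using q
        by (cases u, cases v) (auto simp: mem_box_cart forall_2 cbox_Pair_eq)
      ultimately show "q \<in> ?h ` cbox u v" by blast
    qed
  qed
  have "?f integrable_on cbox (0,0) (1,1)"
    using integrable_continuous[OF assms] by simp
  then have i: "(?f has_integral integral (cbox (0,0) (1,1)) ?f) (cbox (0,0) (1,1))" by blast
  have "((\<lambda>p. ?f (?g p)) has_integral (1/1) *\<^sub>R integral (cbox (0,0) (1,1)) ?f) (?h ` cbox (0,0) (1,1))"
  proof (rule has_integral_twiddle[OF _ _ _ _ _ _ _ i])
    show "?h (?g x) = x" for x by (simp add: plane_eq_iff)
    show "?g (?h x) = x" for x by (auto split: prod.split)
    show "continuous (at x) ?g" for x by (intro continuous_intros)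
    show "\<exists>w z. ?g ` cbox u v = cbox w z" for u v using g by blast
    show "\<exists>w z. ?h ` cbox u v = cbox w z" for u v using h by blast
    show "measure lborel (?g ` cbox u v) = 1 * measure lborel (cbox u v)" for u v
    proof (cases "cbox u v = {}")
      case False
      then have "u $ 1 \<le> v $ 1" "u $ 2 \<le> v $ 2" by (auto simp: interval_ne_empty_cart)
      then show ?thesis
        unfolding g content_Pair content_cbox_cart[OF False] by (simp add: UNIV_2)
    qed simp
  qed simp
  moreover have "?h ` cbox (0,0) (1,1) = cbox 0 1"
    unfolding h by (intro arg_cong2[where f=cbox]) (auto simp: plane_eq_iff)
  moreover have "integral (cbox (0,0) (1,1)) ?f = integral {0..1} (\<lambda>s. integral {0..1} (\<psi> s))"
    using integral_prod_continuous[OF assms] by (simp add: cbox_interval)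
  ultimately show ?thesis by simp
qed

context convex_C1_region
begin

text \<open>The region is star-shaped around \<open>x0\<close>, so these generalised polar coordinates sweep it out once, with
  the boundary at \<open>s = 1\<close>.\<close>

definition polar :: "real \<Rightarrow> real \<Rightarrow> plane" where "polar s t = x0 + s *\<^sub>R (c t - x0)"

lemma polar_1 [simp]: "polar 1 t = c t"
  by (simp add: polar_def)

lemma polar_interior: "t \<in> {0..1} \<Longrightarrow> 0 \<le> s \<Longrightarrow> s < 1 \<Longrightarrow> polar s t \<in> \<Omega>"
  using mem_interior_closure_convex_shrink[OF convex_region, of x0 "c t" "1 - s"] open_region x0 boundary_closure[of t]
  by (auto simp: interior_open polar_def algebra_simps)

lemma polar_closure: "t \<in> {0..1} \<Longrightarrow> s \<in> {0..1} \<Longrightarrow> polar s t \<in> closure \<Omega>"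
  using polar_interior[of t s] boundary_closure[of t] closure_subset by (cases "s = 1") auto

lemma polar_inj:
  assumes "0 < s" "0 < s'" "t \<in> {0..<1}" "t' \<in> {0..<1}" "polar s t = polar s' t'"
  shows "s = s' \<and> t = t'"
proof -
  have eq: "s *\<^sub>R (c t - x0) = s' *\<^sub>R (c t' - x0)" using assms by (simp add: polar_def)
  have notless: "\<not> a < b" if "a *\<^sub>R (c i - x0) = b *\<^sub>R (c j - x0)" "0 < a" "0 < b" "i \<in> {0..<1}" "j \<in> {0..<1}" for a b i j
  proof
    assume "a < b"
    have "c j - x0 = (a / b) *\<^sub>R (c i - x0)"
      using that(3) by (simp add: divide_inverse_commute flip: scaleR_scaleR) (simp add: that(1))
    then have "polar (a/b) i = c j" by (simp add: polar_def algebra_simps)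
    then show False using polar_interior[of i "a/b"] boundary_notin[of j] that \<open>a < b\<close> by auto
  qed
  have s: "s = s'" using notless[OF eq] notless[OF eq[symmetric]] assms by force
  then have "c t = c t'" using eq assms by simp
  then have "t = t' \<or> (t = 0 \<and> t' = 1) \<or> (t = 1 \<and> t' = 0)"
    using simple_boundary assms(3,4) unfolding simple_path_def loop_free_def
    by (meson atLeastAtMost_iff atLeastLessThan_iff less_imp_le)
  then show ?thesis using assms(3,4) s by auto
qed

lemma polar_surj:
  assumes "x \<in> \<Omega>" "x \<noteq> x0"
  obtains s t where "0 < s" "s < 1" "t \<in> {0..<1}" "x = polar s t"
proof -
  obtain d where d: "0 < d" "x0 + d *\<^sub>R (x - x0) \<in> frontier \<Omega>"
    using ray_to_frontier[OF bounded_region, of x0 "x - x0"] assms x0 open_region by (auto simp: interior_open)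
  obtain t where t: "t \<in> {0..<1}" "c t = x0 + d *\<^sub>R (x - x0)"
  proof -
    obtain t where t: "t \<in> {0..1}" "c t = x0 + d *\<^sub>R (x - x0)" using d boundary by (metis imageE)
    show thesis
    proof (cases "t = 1")
      case True then show ?thesis using that[of 0] t closed_boundary by auto
    next
      case False then show ?thesis using that[of t] t by auto
    qed
  qed
  have d1: "d > 1"
  proof (rule ccontr)
    assume "\<not> d > 1"
    then have "(1 - d) *\<^sub>R x0 + d *\<^sub>R x \<in> \<Omega>"
      using convexD_alt[OF convex_region x0 assms(1), of d] d by auto
    then show False using boundary_notin[of t] t by (auto simp: algebra_simps)
  qed
  show thesis
    by (rule that[of "1/d" t]) (use d1 t in \<open>auto simp: polar_def\<close>)
qed

lemma continuous_on_polar: "continuous_on (cbox (0,0) (1,1)) (\<lambda>(s,t). polar s t)"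
  unfolding polar_def case_prod_unfold
  by (intro continuous_intros continuous_on_compose2[OF curve_continuous]) (auto simp: cbox_Pair_eq)

text \<open>The Jacobian determinant of the polar map is \<open>s\<close> times the determinant of \<open>c t - x0\<close> and \<open>c' t\<close>,
  whose sign is constant.\<close>

lemma integral_polar:
  fixes f :: "plane \<Rightarrow> real"
  assumes f: "continuous_on (closure \<Omega>) f"
  shows "integral \<Omega> f = orient *
    integral {0..1} (\<lambda>s. integral {0..1} (\<lambda>t. s * ((c t - x0) \<bullet> rot (c' t)) * f (polar s t)))"
proof -
  let ?D = "\<lambda>t. (c t - x0) \<bullet> rot (c' t)"
  let ?X = "\<lambda>p::plane. polar (p $ 1) (p $ 2)"
  let ?X' = "\<lambda>p h::plane. h $ 1 *\<^sub>R (c (p $ 2) - x0) + (p $ 1) *\<^sub>R (h $ 2 *\<^sub>R c' (p $ 2))"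
  let ?S = "{p::plane. 0 < p $ 1 \<and> p $ 1 < 1 \<and> 0 \<le> p $ 2 \<and> p $ 2 < 1}"
  let ?\<psi> = "\<lambda>s t. orient * (s * ?D t * f (polar s t))"
  have cont: "continuous_on (cbox (0,0) (1,1)) (\<lambda>(s,t). ?\<psi> s t)"
    unfolding case_prod_unfold
    by (intro continuous_intros continuous_on_compose2[OF curve_continuous]
          continuous_on_compose2[OF boundary_cont]
          continuous_on_compose2[OF f continuous_on_polar[unfolded case_prod_unfold]])
       (auto simp: cbox_Pair_eq intro!: polar_closure)
  have square: "(\<lambda>p::plane. ?\<psi> (p $ 1) (p $ 2)) absolutely_integrable_on cbox 0 1"
  proof (rule absolutely_integrable_continuous)
    show "continuous_on (cbox 0 1) (\<lambda>p::plane. ?\<psi> (p $ 1) (p $ 2))"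
    proof -
      have "continuous_on (cbox 0 1) (\<lambda>p::plane. (\<lambda>(s,t). ?\<psi> s t) (p $ 1, p $ 2))"
        by (rule continuous_on_compose2[OF cont]) (auto simp: mem_box_cart forall_2 cbox_Pair_eq intro!: continuous_intros)
      then show ?thesis by simp
    qed
  qed
  have Ssub: "?S \<subseteq> cbox 0 1" by (auto simp: mem_box_cart forall_2)
  have Smeas: "?S \<in> sets lebesgue"
  proof -
    have "?S \<in> sets borel" by measurable
    then show ?thesis by simp
  qed
  have Sint: "(\<lambda>p::plane. ?\<psi> (p $ 1) (p $ 2)) absolutely_integrable_on ?S"
    by (rule set_integrable_subset[OF square Smeas Ssub])
  have der: "(?X has_derivative ?X' p) (at p within ?S)" if p: "p \<in> ?S" for p
  proof -
    have "((\<lambda>q. c (q $ 2)) has_derivative (\<lambda>h. h $ 2 *\<^sub>R c' (p $ 2))) (at p within ?S)"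
    proof (rule has_derivative_in_compose[where g = c])
      show "((\<lambda>q. q $ 2) has_derivative (\<lambda>h. h $ 2)) (at p within ?S)"
        by (intro bounded_linear_imp_has_derivative bounded_linear_vec_nth)
      have "(c has_derivative (\<lambda>h. h *\<^sub>R c' (p $ 2))) (at (p $ 2) within {0..1})"
        using boundary_deriv[of "p $ 2"] p by (auto simp: has_vector_derivative_def)
      then show "(c has_derivative (\<lambda>h. h *\<^sub>R c' (p $ 2))) (at (p $ 2) within (\<lambda>q. q $ 2) ` ?S)"
        by (rule has_derivative_subset) auto
    qed
    then show ?thesis unfolding polar_def
      by (auto intro!: derivative_eq_intros bounded_linear_imp_has_derivative bounded_linear_vec_nth)
  qed
  have inj: "inj_on ?X ?S"
    by (rule inj_onI) (auto simp: plane_eq_iff dest: polar_inj)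
  have img: "?X ` ?S = \<Omega> - {x0}"
  proof
    show "?X ` ?S \<subseteq> \<Omega> - {x0}"
    proof
      fix y assume "y \<in> ?X ` ?S"
      then obtain p where p: "p \<in> ?S" "y = ?X p" by blast
      have "c (p $ 2) \<noteq> x0" using boundary_notin[of "p $ 2"] x0 p by auto
      then show "y \<in> \<Omega> - {x0}" using p polar_interior[of "p $ 2" "p $ 1"] by (auto simp: polar_def)
    qed
    show "\<Omega> - {x0} \<subseteq> ?X ` ?S"
    proof
      fix y assume "y \<in> \<Omega> - {x0}"
      then obtain s t where st: "0 < s" "s < 1" "t \<in> {0..<1}" "y = polar s t" using polar_surj by blast
      then show "y \<in> ?X ` ?S" by (intro image_eqI[of _ _ "vector [s,t]"]) auto
    qed
  qed
  have dt: "\<bar>det (matrix (?X' p))\<bar> = orient * (p $ 1 * ?D (p $ 2))" if "p \<in> ?S" for p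
  proof -
    have "det (matrix (?X' p)) = p $ 1 * ?D (p $ 2)"
      by (simp add: det_2 matrix_def axis_def inner_plane algebra_simps)
    moreover have "\<bar>?D (p $ 2)\<bar> = orient * ?D (p $ 2)"
      using orient_radial[of "p $ 2"] that by (auto simp: abs_if)
    ultimately show ?thesis using that by (simp add: abs_mult)
  qed
  let ?F = "\<lambda>x. vec (f x) :: real^1"
  have Fint: "(\<lambda>p. \<bar>det (matrix (?X' p))\<bar> *\<^sub>R ?F (?X p)) absolutely_integrable_on ?S"
    unfolding absolutely_integrable_on_1_iff
  proof (rule iffD1[OF set_integrable_cong Sint])
    show "?\<psi> (p $ 1) (p $ 2) = (\<bar>det (matrix (?X' p))\<bar> *\<^sub>R ?F (?X p)) $ 1" if "p \<in> ?S" for p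
      by (simp only: dt[OF that] vector_scaleR_component vec_component real_scaleR_def mult.assoc)
  qed simp_all
  have "integral (?X ` ?S) ?F = integral ?S (\<lambda>p. \<bar>det (matrix (?X' p))\<bar> *\<^sub>R ?F (?X p))"
    by (rule integral_change_of_variables[OF Smeas der inj]) (use Fint in auto)
  then have "integral (\<Omega> - {x0}) f = integral ?S (\<lambda>p. \<bar>det (matrix (?X' p))\<bar> * f (?X p))"
    unfolding img integral_on_1_eq by simp
  also have "\<dots> = integral ?S (\<lambda>p. ?\<psi> (p $ 1) (p $ 2))"
    by (rule Henstock_Kurzweil_Integration.integral_cong) (simp only: dt mult.assoc)
  also have "\<dots> = integral (cbox 0 1) (\<lambda>p::plane. ?\<psi> (p $ 1) (p $ 2))"
  proof (rule integral_subset_negligible[OF Ssub])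
    have "negligible ({p::plane. p $ 1 = 0} \<union> {p. p $ 1 = 1} \<union> {p. p $ 2 = 1})"
      using negligible_standard_hyperplane[of "axis 1 1 :: plane"] negligible_standard_hyperplane[of "axis 2 1 :: plane"]
      by (intro negligible_Un) (auto simp: inner_axis)
    then show "negligible (cbox 0 1 - ?S)"
      by (rule negligible_subset) (auto simp: mem_box_cart forall_2)
  qed
  also have "\<dots> = integral {0..1} (\<lambda>s. integral {0..1} (?\<psi> s))"
    using has_integral_unit_square[OF cont] by (rule integral_unique)
  also have "integral (\<Omega> - {x0}) f = integral \<Omega> f"
    by (rule integral_subset_negligible) (auto intro: negligible_subset[OF negligible_sing[of x0]])
  finally show ?thesis by simp
qed

text \<open>In polar coordinates the integrand times the Jacobian splits into
  \<open>\<partial>\<^sub>s (s * f * (e \<bullet> rot c')) + \<partial>\<^sub>t (((c - x0) \<bullet> rot e) * f)\<close>. This is Cramer's rule for \<open>e\<close> in the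
  basis \<open>c - x0\<close>, \<open>c'\<close>. The \<open>t\<close>-derivative integrates to zero because the curve is closed, and the
  \<open>s\<close>-derivative leaves the boundary values at \<open>s = 1\<close>.\<close>

theorem gauss_green:
  fixes f :: "plane \<Rightarrow> real" and G :: "plane \<Rightarrow> plane"
  assumes f: "\<And>x. (f has_derivative (\<lambda>h. G x \<bullet> h)) (at x)" and G: "continuous_on UNIV G"
  shows "integral \<Omega> (\<lambda>x. G x \<bullet> e) = orient * integral {0..1} (\<lambda>t. f (c t) * (e \<bullet> rot (c' t)))"
proof -
  let ?A = "\<lambda>s t. (e \<bullet> rot (c' t)) * (f (polar s t) + s * (G (polar s t) \<bullet> (c t - x0)))"
  let ?B = "\<lambda>s t. (c' t \<bullet> rot e) * f (polar s t) + ((c t - x0) \<bullet> rot e) * (s * (G (polar s t) \<bullet> c' t))"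
  have fc: "continuous_on UNIV f"
    using f by (meson continuous_at_imp_continuous_on has_derivative_continuous)
  note cts = continuous_intros continuous_on_compose2[OF curve_continuous]
          continuous_on_compose2[OF boundary_cont]
          continuous_on_compose2[OF fc continuous_on_polar[unfolded case_prod_unfold]]
          continuous_on_compose2[OF G continuous_on_polar[unfolded case_prod_unfold]]
  have cA: "continuous_on (cbox (0,0) (1,1)) (\<lambda>(s,t). ?A s t)"
    unfolding case_prod_unfold by (intro cts) (auto simp: cbox_Pair_eq)
  have cB: "continuous_on (cbox (0,0) (1,1)) (\<lambda>(s,t). ?B s t)"
    unfolding case_prod_unfold by (intro cts) (auto simp: cbox_Pair_eq)
  have cut: "continuous_on {0..1} (\<lambda>t. \<phi> s t)"
    if "continuous_on (cbox (0,0) (1,1)) (\<lambda>(s,t). \<phi> s t :: real)" "s \<in> {0..1}" for \<phi> :: "real \<Rightarrow> real \<Rightarrow> real" and s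
  proof -
    have "continuous_on {0..1} (\<lambda>t. (\<lambda>(s,t). \<phi> s t) (s, t))"
      by (rule continuous_on_compose2[OF that(1)]) (use that(2) in \<open>auto simp: cbox_Pair_eq mem_box intro!: continuous_intros\<close>)
    then show ?thesis by simp
  qed
  have outer: "(\<lambda>s. integral {0..1} (\<phi> s)) integrable_on {0..1}"
    if "continuous_on (cbox (0,0) (1,1)) (\<lambda>(s,t). \<phi> s t)" for \<phi> :: "real \<Rightarrow> real \<Rightarrow> real"
    using integral_integrable_2dim[OF that] by (simp add: cbox_interval)
  have "integral \<Omega> (\<lambda>x. G x \<bullet> e) = orient *
    integral {0..1} (\<lambda>s. integral {0..1} (\<lambda>t. s * ((c t - x0) \<bullet> rot (c' t)) * (G (polar s t) \<bullet> e)))"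
    by (rule integral_polar) (intro continuous_intros continuous_on_subset[OF G] subset_UNIV)
  also have "(\<lambda>s t. s * ((c t - x0) \<bullet> rot (c' t)) * (G (polar s t) \<bullet> e)) = (\<lambda>s t. ?A s t + ?B s t)"
    by (intro ext) (simp add: inner_plane algebra_simps)
  also have "integral {0..1} (\<lambda>s. integral {0..1} (\<lambda>t. ?A s t + ?B s t))
      = integral {0..1} (\<lambda>s. integral {0..1} (?A s) + integral {0..1} (?B s))"
    by (intro Henstock_Kurzweil_Integration.integral_cong Henstock_Kurzweil_Integration.integral_add
          integrable_continuous_interval cut[OF cA] cut[OF cB])
  also have "\<dots> = integral {0..1} (\<lambda>s. integral {0..1} (?A s)) + integral {0..1} (\<lambda>s. integral {0..1} (?B s))"
    by (intro Henstock_Kurzweil_Integration.integral_add outer cA cB)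
  also have "integral {0..1} (\<lambda>s. integral {0..1} (?B s)) = 0"
  proof -
    have "integral {0..1} (?B s) = 0" if s: "s \<in> {0..1}" for s
    proof -
      have "((\<lambda>t. ((c t - x0) \<bullet> rot e) * f (polar s t)) has_vector_derivative ?B s t) (at t within {0..1})"
        if t: "t \<in> {0..1}" for t
      proof -
        have c1: "(c has_derivative (\<lambda>h. h *\<^sub>R c' t)) (at t within {0..1})"
          using boundary_deriv[OF t] by (simp add: has_vector_derivative_def)
        then have p: "(polar s has_derivative (\<lambda>h. s *\<^sub>R (h *\<^sub>R c' t))) (at t within {0..1})"
          unfolding polar_def by (auto intro!: derivative_eq_intros)
        have "((\<lambda>t. f (polar s t)) has_derivative (\<lambda>h. G (polar s t) \<bullet> (s *\<^sub>R (h *\<^sub>R c' t)))) (at t within {0..1})"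
          by (rule has_derivative_compose[OF p f])
        with c1 show ?thesis unfolding has_vector_derivative_def
          by (auto intro!: derivative_eq_intros simp: algebra_simps)
      qed
      then have "(?B s has_integral ((c 1 - x0) \<bullet> rot e) * f (polar s 1) - ((c 0 - x0) \<bullet> rot e) * f (polar s 0)) {0..1}"
        by (intro fundamental_theorem_of_calculus) auto
      then show ?thesis by (auto simp: closed_boundary polar_def dest: integral_unique)
    qed
    then show ?thesis
      using Henstock_Kurzweil_Integration.integral_cong[of "{0..1}" "\<lambda>s. integral {0..1} (?B s)" "\<lambda>_. 0"] by simp
  qed
  also have "integral {0..1} (\<lambda>s. integral {0..1} (?A s)) = integral {0..1} (\<lambda>t. integral {0..1} (\<lambda>s. ?A s t))"
    using integral_swap_continuous[OF cA] by (simp add: cbox_interval)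
  also have "\<dots> = integral {0..1} (\<lambda>t. f (c t) * (e \<bullet> rot (c' t)))"
  proof (rule Henstock_Kurzweil_Integration.integral_cong)
    fix t :: real assume "t \<in> {0..1}"
    have "((\<lambda>s. (e \<bullet> rot (c' t)) * (s * f (polar s t))) has_vector_derivative ?A s t) (at s within {0..1})" for s
    proof -
      have p: "((\<lambda>s. polar s t) has_derivative (\<lambda>h. h *\<^sub>R (c t - x0))) (at s within {0..1})"
        unfolding polar_def by (auto intro!: derivative_eq_intros)
      have "((\<lambda>s. f (polar s t)) has_derivative (\<lambda>h. G (polar s t) \<bullet> (h *\<^sub>R (c t - x0)))) (at s within {0..1})"
        by (rule has_derivative_compose[OF p f])
      then show ?thesis unfolding has_vector_derivative_def
        by (auto intro!: derivative_eq_intros simp: algebra_simps)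
    qed
    then have "((\<lambda>s. ?A s t) has_integral (e \<bullet> rot (c' t)) * (1 * f (polar 1 t)) - (e \<bullet> rot (c' t)) * (0 * f (polar 0 t))) {0..1}"
      by (intro fundamental_theorem_of_calculus) auto
    then show "integral {0..1} (\<lambda>s. ?A s t) = f (c t) * (e \<bullet> rot (c' t))"
      by (auto dest: integral_unique)
  qed
  finally show ?thesis by simp
qed

end

section \<open>Area of tubes around the boundary\<close>

context convex_C1_region
begin

text \<open>All layers of width \<open>r\<close> on either side of the boundary lie in this set.\<close>

definition tube :: "real \<Rightarrow> plane set" where "tube r = {x. infdist x (frontier \<Omega>) \<le> r}"

lemma frontier_nonempty: "frontier \<Omega> \<noteq> {}"
proof -
  have "c 0 \<in> frontier \<Omega>" unfolding boundary[symmetric] by simp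
  then show ?thesis by blast
qed

lemma compact_frontier_region: "compact (frontier \<Omega>)"
  by (rule compact_frontier_bounded[OF bounded_region])

lemma closed_tube: "closed (tube r)"
proof -
  have "tube r = (\<lambda>x. infdist x (frontier \<Omega>)) -` {..r}" by (auto simp: tube_def)
  then show ?thesis
    by (simp only:) (intro closed_vimage closed_atMost continuous_on_infdist continuous_on_id)
qed

lemma tube_borel [measurable]: "tube r \<in> sets borel"
  using closed_tube by (rule borel_closed)

lemma tube_near:
  assumes "x \<in> tube r" obtains p where "p \<in> frontier \<Omega>" "dist x p \<le> r"
proof -
  obtain p where "p \<in> frontier \<Omega>" "infdist x (frontier \<Omega>) = dist x p"
    using infdist_attains_inf[OF frontier_closed frontier_nonempty] .
  then show thesis using that[of p] assms by (simp add: tube_def)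
qed

lemma bounded_tube: "bounded (tube r)"
proof -
  obtain B where B: "\<And>p. p \<in> frontier \<Omega> \<Longrightarrow> norm p \<le> B"
    using compact_imp_bounded[OF compact_frontier_region] by (auto simp: bounded_iff)
  have "norm x \<le> B + r" if x: "x \<in> tube r" for x
  proof -
    obtain p where p: "p \<in> frontier \<Omega>" "dist x p \<le> r" using x by (rule tube_near)
    then show ?thesis using B[OF p(1)] norm_triangle_sub[of x p] by (simp add: dist_norm)
  qed
  then show ?thesis by (auto simp: bounded_iff)
qed

lemma compact_tube: "compact (tube r)"
  using closed_tube bounded_tube by (simp add: compact_eq_bounded_closed)

lemma curve_lipschitz:
  obtains M where "M \<ge> 0" "\<And>s t. s \<in> {0..1} \<Longrightarrow> t \<in> {0..1} \<Longrightarrow> norm (c s - c t) \<le> M * \<bar>s - t\<bar>"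
proof -
  obtain M where M: "\<And>t. t \<in> {0..1} \<Longrightarrow> norm (c' t) \<le> M"
    using compact_imp_bounded[OF compact_continuous_image[OF boundary_cont compact_Icc]]
    unfolding bounded_iff by blast
  show thesis
  proof (rule that[of M])
    show "M \<ge> 0" using M[of 0] norm_ge_zero[of "c' 0"] by (simp del: norm_ge_zero)
    fix s t :: real assume st: "s \<in> {0..1}" "t \<in> {0..1}"
    have "norm (c s - c t) \<le> M * norm (s - t)"
    proof (rule differentiable_bound[OF convex_real_interval(5)[of 0 1]])
      show "(c has_derivative (\<lambda>h. h *\<^sub>R c' x)) (at x within {0..1})" if "x \<in> {0..1}" for x
        using boundary_deriv[OF that] by (simp add: has_vector_derivative_def)
      show "onorm (\<lambda>h. h *\<^sub>R c' x) \<le> M" if "x \<in> {0..1}" for x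
        by (rule onorm_le) (use M[OF that] in \<open>simp add: mult.commute[of M] mult_left_mono\<close>)
    qed (use st in auto)
    then show "norm (c s - c t) \<le> M * \<bar>s - t\<bar>" by simp
  qed
qed

text \<open>Since the curve is Lipschitz, about \<open>1 / r\<close> discs of radius proportional to \<open>r\<close> centred on the curve
  cover the tube.\<close>

lemma measure_tube:
  obtains C where "C \<ge> 0" "\<And>r. 0 < r \<Longrightarrow> r \<le> 1 \<Longrightarrow> measure lborel (tube r) \<le> C * r"
proof -
  obtain M where M: "M \<ge> 0" "\<And>s t. s \<in> {0..1} \<Longrightarrow> t \<in> {0..1} \<Longrightarrow> norm (c s - c t) \<le> M * \<bar>s - t\<bar>"
    using curve_lipschitz by blast
  have "measure lborel (tube r) \<le> (3 * pi * (1 + M)\<^sup>2) * r" if r: "0 < r" "r \<le> 1" for r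
  proof -
    define n where "n = nat \<lceil>1 / r\<rceil>"
    have "real n = of_int \<lceil>1 / r\<rceil>" using r by (simp add: n_def)
    then have n: "1 / r \<le> real n" "real n \<le> 1 / r + 1" by linarith+
    have n0: "real n > 0" using n(1) r by (smt (verit) divide_pos_pos)
    have rn: "1 / real n \<le> r" using n(1) n0 r by (simp add: field_simps)
    let ?B = "\<lambda>k. cball (c (real k / real n)) ((1 + M) * r)"
    have sub: "tube r \<subseteq> (\<Union>k\<in>{..n}. ?B k)"
    proof
      fix x assume "x \<in> tube r"
      then obtain p where p: "p \<in> frontier \<Omega>" "dist x p \<le> r" by (rule tube_near)
      obtain t where t: "t \<in> {0..1}" "p = c t" using p(1) boundary by (metis imageE)
      define k where "k = nat \<lfloor>real n * t\<rfloor>"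
      have "real k = of_int \<lfloor>real n * t\<rfloor>" using t by (simp add: k_def)
      then have k: "real k \<le> real n * t" "real n * t < real k + 1" by linarith+
      have "real n * t \<le> real n" using t by (simp add: mult_left_le)
      then have kn: "k \<le> n" using k(1) by linarith
      have "t - real k / real n = (real n * t - real k) / real n" using n0 by (simp add: field_simps)
      moreover have "\<dots> \<le> 1 / real n" using k by (intro divide_right_mono) auto
      moreover have "(real n * t - real k) / real n \<ge> 0" using k by simp
      ultimately have d: "\<bar>t - real k / real n\<bar> \<le> r" using rn by linarith
      have "real k / real n \<in> {0..1}" using kn n0 by simp
      from M(2)[OF t(1) this] have "norm (c t - c (real k / real n)) \<le> M * r"
        using mult_left_mono[OF d M(1)] by linarith
      then have "dist (c (real k / real n)) x \<le> (1 + M) * r"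
        using p(2) t(2) dist_triangle[of x "c (real k / real n)" "c t"]
        by (simp add: dist_norm norm_minus_commute algebra_simps)
      then show "x \<in> (\<Union>k\<in>{..n}. ?B k)" using kn by auto
    qed
    have "measure lborel (tube r) \<le> measure lborel (\<Union>k\<in>{..n}. ?B k)"
    proof (rule measure_mono_fmeasurable[OF sub])
      have "compact (\<Union>k\<in>{..n}. ?B k)" by (rule compact_UN) simp_all
      then show "(\<Union>k\<in>{..n}. ?B k) \<in> fmeasurable lborel" by (rule fmeasurable_compact)
    qed simp
    also have "\<dots> \<le> (\<Sum>k\<in>{..n}. measure lborel (?B k))"
      by (rule measure_UNION_le) simp_all
    also have "\<dots> = (\<Sum>k\<in>{..n}. pi * ((1 + M) * r)\<^sup>2)"
      using M r by (simp add: content_cball unit_ball_vol_2)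
    also have "\<dots> = (real n + 1) * (pi * ((1 + M) * r)\<^sup>2)" by simp
    also have "\<dots> \<le> (3 / r) * (pi * ((1 + M) * r)\<^sup>2)"
    proof (rule mult_right_mono)
      have "1 \<le> 1 / r" using r by simp
      then show "real n + 1 \<le> 3 / r" using n(2) by simp
    qed simp
    also have "\<dots> = (3 * pi * (1 + M)\<^sup>2) * r" using r by (simp add: power2_eq_square)
    finally show ?thesis .
  qed
  then show thesis using that[of "3 * pi * (1 + M)\<^sup>2"] by simp
qed

text \<open>The segment between an inner and an outer point meets the boundary.\<close>

lemma crossing_near_frontier:
  assumes "x \<in> \<Omega>" "y \<notin> \<Omega>"
  shows "infdist x (frontier \<Omega>) \<le> dist x y" "infdist y (frontier \<Omega>) \<le> dist x y"
proof -
  have "closed_segment x y \<inter> frontier \<Omega> \<noteq> {}"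
    by (rule connected_Int_frontier) (use assms in auto)
  then obtain p where p: "p \<in> closed_segment x y" "p \<in> frontier \<Omega>" by blast
  then show "infdist x (frontier \<Omega>) \<le> dist x y" "infdist y (frontier \<Omega>) \<le> dist x y"
    using infdist_le2[OF p(2), of x] infdist_le2[OF p(2), of y] segment_bound[OF p(1)]
    by (auto simp: dist_norm norm_minus_commute)
qed

end

section \<open>The kernel as an isotropic measure\<close>

text \<open>Polar coordinates for radial functions: both measures give \<open>\<pi> a\<^sup>2\<close> to the half-line below \<open>a\<close> if \<open>a\<close> is
  nonnegative, and otherwise zero.\<close>

lemma distr_norm_lborel:
  "distr lborel borel (norm :: plane \<Rightarrow> real) = density lborel (\<lambda>r. ennreal (2 * pi * r) * indicator {0..} r)"
    (is "?M = ?N")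
proof (rule measure_eqI_generator_eq[where \<Omega> = UNIV and E = "range atMost" and A = "\<lambda>i. {..real i}"])
  show "Int_stable (range (atMost :: real \<Rightarrow> _))" by (auto simp: Int_stable_def)
  show "sets ?M = sigma_sets UNIV (range atMost)" "sets ?N = sigma_sets UNIV (range atMost)"
    by (simp_all add: borel_eq_atMost)
  have M: "emeasure ?M {..a} = ennreal (if a \<ge> 0 then pi * a\<^sup>2 else 0)" for a :: real
  proof -
    have "emeasure ?M {..a} = emeasure lborel (cball (0::plane) a)"
      by (subst emeasure_distr) (auto intro!: arg_cong[where f = "emeasure lborel"])
    also have "\<dots> = ennreal (if a \<ge> 0 then pi * a\<^sup>2 else 0)"
      by (auto simp: emeasure_cball unit_ball_vol_2)
    finally show ?thesis .
  qed
  have N: "emeasure ?N {..a} = ennreal (if a \<ge> 0 then pi * a\<^sup>2 else 0)" for a :: real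
  proof (cases "a \<ge> 0")
    case True
    have "emeasure ?N {..a} = (\<integral>\<^sup>+r. ennreal (2 * pi * r) * indicator {0..a} r \<partial>lborel)"
      by (subst emeasure_density) (auto intro!: nn_integral_cong split: split_indicator)
    also have "\<dots> = ennreal (pi * a\<^sup>2 - pi * 0\<^sup>2)"
      by (rule nn_integral_FTC_Icc) (use True in \<open>auto intro!: derivative_eq_intros\<close>)
    finally show ?thesis using True by simp
  next
    case False
    have "emeasure ?N {..a} = (\<integral>\<^sup>+r. 0 \<partial>(lborel::real measure))"
      using False by (subst emeasure_density)
        (auto simp del: nn_integral_const intro!: nn_integral_cong split: split_indicator)
    then show ?thesis using False by simp
  qed
  show "emeasure ?M X = emeasure ?N X" if "X \<in> range atMost" for X
    using that M N by auto
  show "emeasure ?M {..real i} \<noteq> \<infinity>" for i unfolding M by simp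
  show "(\<Union>i. {..real i}) = UNIV"
    using real_arch_simple by auto
qed auto

lemma nn_integral_radial:
  assumes [measurable]: "h \<in> borel_measurable borel"
  shows "(\<integral>\<^sup>+z. h (norm (z::plane)) \<partial>lborel) = (\<integral>\<^sup>+r. ennreal (2 * pi * r) * indicator {0..} r * h r \<partial>lborel)"
proof -
  have "(\<integral>\<^sup>+z. h (norm (z::plane)) \<partial>lborel) = (\<integral>\<^sup>+r. h r \<partial>distr lborel borel (norm :: plane \<Rightarrow> real))"
    by (subst nn_integral_distr) auto
  also have "\<dots> = (\<integral>\<^sup>+r. ennreal (2 * pi * r) * indicator {0..} r * h r \<partial>lborel)"
    unfolding distr_norm_lborel by (subst nn_integral_density) auto
  finally show ?thesis .
qed

lemma AE_radial:
  assumes "AE r in lborel. P r"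
  shows "AE z::plane in lborel. P (norm z)"
proof -
  obtain N where N: "{r. \<not> P r} \<subseteq> N" "N \<in> null_sets lborel"
    using assms by (auto simp: eventually_ae_filter)
  have [measurable]: "N \<in> sets borel" using N(2) by (auto simp: null_sets_def)
  have "(\<integral>\<^sup>+z. indicator N (norm (z::plane)) \<partial>lborel) = (\<integral>\<^sup>+r. ennreal (2 * pi * r) * indicator {0..} r * indicator N r \<partial>lborel)"
    by (rule nn_integral_radial) simp
  also have "\<dots> = (\<integral>\<^sup>+r. 0 \<partial>(lborel::real measure))"
    by (rule nn_integral_cong_AE, rule AE_mp[OF AE_not_in[OF N(2)]]) (auto split: split_indicator)
  also have "\<dots> = 0" by simp
  finally have "AE z::plane in lborel. indicator N (norm z) = (0::ennreal)"
    by (subst (asm) nn_integral_0_iff_AE) auto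
  then show ?thesis by eventually_elim (use N(1) in \<open>auto split: split_indicator_asm\<close>)
qed

lemma rot_borel [measurable]: "rot \<in> borel_measurable borel"
  using bounded_linear.continuous_on[OF bounded_linear_rot continuous_on_id, of UNIV]
  by (intro borel_measurable_continuous_onI) simp

lemma distr_rot_lborel: "distr lborel borel rot = lborel"
proof (rule lborel_eqI[symmetric])
  show "sets (distr lborel borel rot) = sets borel" by simp
  fix l u :: plane assume le: "\<And>b. b \<in> Basis \<Longrightarrow> l \<bullet> b \<le> u \<bullet> b"
  have le: "l $ 1 \<le> u $ 1" "l $ 2 \<le> u $ 2"
    using le[of "axis 1 1"] le[of "axis 2 1"] by (auto simp: inner_axis axis_in_Basis_iff)
  let ?l = "vector [- u $ 2, l $ 1] :: plane" and ?u = "vector [- l $ 2, u $ 1] :: plane"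
  have B: "(Basis :: plane set) = {axis 1 1, axis 2 1}"
    by (auto simp: Basis_vec_def UNIV_2)
  have ne: "axis 1 1 \<noteq> (axis 2 1 :: plane)" by (simp add: axis_eq_axis)
  have "rot -` box l u = box ?l ?u" by (auto simp: mem_box_cart forall_2)
  then have "emeasure (distr lborel borel rot) (box l u) = emeasure lborel (box ?l ?u)"
    by (subst emeasure_distr) auto
  also have "\<dots> = (\<Prod>b\<in>Basis. (?u - ?l) \<bullet> b)"
    by (rule emeasure_lborel_box) (use le in \<open>auto simp: B inner_axis\<close>)
  also have "(\<Prod>b\<in>Basis. (?u - ?l) \<bullet> b) = (\<Prod>b\<in>Basis. (u - l) \<bullet> b)"
    unfolding B using ne by (simp add: inner_axis mult.commute)
  finally show "emeasure (distr lborel borel rot) (box l u) = (\<Prod>b\<in>Basis. (u - l) \<bullet> b)" .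
qed

lemma AE_lebesgue_translate:
  fixes P :: "'a::euclidean_space \<Rightarrow> bool"
  assumes "AE z in lborel. P z"
  shows "AE y in lebesgue. P (y - x)"
proof -
  obtain N where N: "{z. \<not> P z} \<subseteq> N" "N \<in> null_sets lborel"
    using assms by (auto simp: eventually_ae_filter)
  then have "negligible N"
    using null_sets_completionI negligible_iff_null_sets by blast
  then have "negligible ((+) x ` N)" by (rule negligible_translation)
  then have "(+) x ` N \<in> null_sets lebesgue" by (simp add: negligible_iff_null_sets)
  then show ?thesis
  proof (rule AE_I')
    show "{y \<in> space lebesgue. \<not> P (y - x)} \<subseteq> (+) x ` N"
    proof
      fix y assume "y \<in> {y \<in> space lebesgue. \<not> P (y - x)}"
      then have "y - x \<in> N" using N(1) by auto
      then show "y \<in> (+) x ` N" by (rule image_eqI[rotated]) simp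
    qed
  qed
qed

text \<open>This is the measure with density \<open>k (norm z)\<close> for a kernel \<open>k\<close> of horizon \<open>\<delta>\<close>. Its radial
  symmetry is recorded as invariance under a quarter turn: applied twice, this is the reflection at the origin, and
  it forces the matrix of second moments to be a multiple of the identity.\<close>

locale isotropic_measure = finite_measure \<mu> for \<mu> :: "plane measure" +
  fixes \<delta> \<sigma> :: real
  assumes sets_eq [measurable_cong]: "sets \<mu> = sets borel"
    and support: "AE z in \<mu>. norm z < \<delta>"
    and rotation_invariant: "distr \<mu> borel rot = \<mu>"
    and second_moment: "(\<integral>z. (norm z)\<^sup>2 \<partial>\<mu>) = 4 * \<sigma>"
begin

lemma integral_rot:
  fixes f :: "plane \<Rightarrow> real"
  assumes [measurable]: "f \<in> borel_measurable borel"
  shows "(\<integral>z. f (rot z) \<partial>\<mu>) = (\<integral>z. f z \<partial>\<mu>)"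
proof -
  have "(\<integral>z. f z \<partial>\<mu>) = (\<integral>z. f z \<partial>distr \<mu> borel rot)" unfolding rotation_invariant ..
  also have "\<dots> = (\<integral>z. f (rot z) \<partial>\<mu>)" by (rule integral_distr) auto
  finally show ?thesis ..
qed

lemma rot_rot [simp]: "rot (rot z) = - z" by (simp add: plane_eq_iff)

lemma integral_reflect:
  fixes f :: "plane \<Rightarrow> real"
  assumes [measurable]: "f \<in> borel_measurable borel"
  shows "(\<integral>z. f (- z) \<partial>\<mu>) = (\<integral>z. f z \<partial>\<mu>)"
  using integral_rot[of f] integral_rot[of "\<lambda>z. f (rot z)"] by simp

lemma integrable_small:
  fixes f :: "plane \<Rightarrow> real"
  assumes [measurable]: "f \<in> borel_measurable borel" and "\<And>z. norm z < \<delta> \<Longrightarrow> \<bar>f z\<bar> \<le> B"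
  shows "integrable \<mu> f"
proof (rule integrable_const_bound[where B = B])
  show "AE z in \<mu>. norm (f z) \<le> B" using support by eventually_elim (use assms(2) in auto)
qed simp

lemma integrable_monomial: "integrable \<mu> (\<lambda>z. z $ i * z $ j)"
proof (rule integrable_small[where B = "\<delta> * \<delta>"])
  show "\<bar>z $ i * z $ j\<bar> \<le> \<delta> * \<delta>" if "norm z < \<delta>" for z :: plane
    unfolding abs_mult using component_le_norm_cart[of z i] component_le_norm_cart[of z j] that
    by (intro mult_mono) (auto intro: order_trans[OF _ less_imp_le] order_trans[OF norm_ge_zero])
qed simp

lemma moments: "(\<integral>z. z $ 1 * z $ 1 \<partial>\<mu>) = 2 * \<sigma>" "(\<integral>z. z $ 2 * z $ 2 \<partial>\<mu>) = 2 * \<sigma>"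
   "(\<integral>z. z $ 1 * z $ 2 \<partial>\<mu>) = 0"
proof -
  have s: "(\<integral>z. z $ 2 * z $ 2 \<partial>\<mu>) = (\<integral>z. z $ 1 * z $ 1 \<partial>\<mu>)"
    using integral_rot[of "\<lambda>z. z $ 1 * z $ 1"] by simp
  have "(\<integral>z. (norm z)\<^sup>2 \<partial>\<mu>) = (\<integral>z. z $ 1 * z $ 1 + z $ 2 * z $ 2 \<partial>\<mu>)"
    unfolding norm_plane_sq by (simp add: power2_eq_square)
  also have "\<dots> = (\<integral>z. z $ 1 * z $ 1 \<partial>\<mu>) + (\<integral>z. z $ 2 * z $ 2 \<partial>\<mu>)"
    by (intro Bochner_Integration.integral_add integrable_monomial)
  finally show "(\<integral>z. z $ 1 * z $ 1 \<partial>\<mu>) = 2 * \<sigma>" "(\<integral>z. z $ 2 * z $ 2 \<partial>\<mu>) = 2 * \<sigma>"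
    using s second_moment by auto
  show "(\<integral>z. z $ 1 * z $ 2 \<partial>\<mu>) = 0"
    using integral_rot[of "\<lambda>z. z $ 1 * z $ 2"] by (simp add: mult.commute)
qed

end

text \<open>The profile of the kernel is only Lebesgue measurable, and its values at distances \<open>0\<close> and \<open>\<delta>\<close> are
  arbitrary. It is replaced by a Borel function \<open>k\<close> that vanishes there and agrees with it almost
  everywhere; null sets of radii correspond to null sets in the plane.\<close>

lemma kernel_measure:
  assumes kern: "nonlocal_kernel g \<sigma>" and \<delta>: "\<delta> > 0"
  obtains k :: "real \<Rightarrow> real" where "k \<in> borel_measurable borel" "\<And>r. k r \<ge> 0" "\<And>r. r \<ge> \<delta> \<Longrightarrow> k r = 0"
    "\<And>x. AE y in lebesgue. kernel g \<delta> x y = k (norm (y - x))"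
    "isotropic_measure (density lborel (\<lambda>z. ennreal (k (norm z)))) \<delta> \<sigma>"
proof -
  from kern \<delta> have g0: "\<And>r. r \<ge> 0 \<Longrightarrow> g \<delta> r \<ge> 0" and g1: "\<And>r. r > \<delta> \<Longrightarrow> g \<delta> r = 0"
    and gi: "set_integrable lebesgue {0<..<\<delta>} (g \<delta>)"
    and gs: "\<sigma> = pi / 2 * (LINT r:{0<..<\<delta>}|lebesgue. r ^ 3 * g \<delta> r)"
    unfolding nonlocal_kernel_def by auto
  let ?f = "\<lambda>r. indicator {0<..<\<delta>} r * g \<delta> r"
  have fi: "integrable lebesgue ?f" using gi by (simp add: set_integrable_def)
  obtain h where h: "h \<in> borel_measurable lborel" "AE r in lborel. ?f r = h r"
    using completion_ex_borel_measurable_real[OF borel_measurable_integrable[OF fi]] by auto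
  define k where "k r = (if 0 < r \<and> r < \<delta> then max 0 (h r) else 0)" for r
  have [measurable]: "h \<in> borel_measurable borel" using h(1) by simp
  have km [measurable]: "k \<in> borel_measurable borel" unfolding k_def[abs_def] by measurable
  have k0: "k r \<ge> 0" for r by (simp add: k_def)
  have k\<delta>: "k r = 0" if "r \<ge> \<delta>" for r using that by (simp add: k_def)
  have kneg: "k r = 0" if "r \<le> 0" for r using that by (simp add: k_def)
  have fk: "AE r in lborel. ?f r = k r"
    using h(2)
  proof eventually_elim
    case (elim r)
    show ?case
    proof (cases "0 < r \<and> r < \<delta>")
      case True
      then show ?thesis using elim g0[of r] by (simp add: k_def max_def)
    qed (auto simp: k_def)
  qed
  have "AE r in lborel. r \<notin> {0, \<delta>}" by (rule AE_not_in) (simp add: finite_imp_null_set_lborel)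
  with fk have "AE r in lborel. r \<ge> 0 \<longrightarrow> g \<delta> r = k r"
  proof eventually_elim
    case (elim r)
    then show ?case using g1[of r] k\<delta>[of r] by (cases "r > \<delta>") auto
  qed
  then have "AE z::plane in lborel. g \<delta> (norm z) = k (norm z)" using AE_radial by fastforce
  from AE_lebesgue_translate[OF this]
  have AEk: "AE y in lebesgue. kernel g \<delta> x y = k (norm (y - x))" for x
    by (simp add: kernel_def norm_minus_commute[of x])
  have ki: "integrable lborel k"
  proof -
    have "integrable lebesgue k"
      by (rule integrable_cong_AE_imp[OF fi _ AE_completion[OF fk]]) (rule measurable_completion, simp)
    then show ?thesis by (subst (asm) integrable_completion) simp_all
  qed
  let ?\<mu> = "density lborel (\<lambda>z::plane. ennreal (k (norm z)))"
  have "isotropic_measure ?\<mu> \<delta> \<sigma>"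
  proof (intro isotropic_measure.intro isotropic_measure_axioms.intro finite_measureI)
    have "emeasure ?\<mu> (space ?\<mu>) = (\<integral>\<^sup>+z. ennreal (k (norm (z::plane))) \<partial>lborel)"
      by (subst emeasure_density) auto
    also have "\<dots> = (\<integral>\<^sup>+r. ennreal (2 * pi * r) * indicator {0..} r * ennreal (k r) \<partial>lborel)"
      by (rule nn_integral_radial) simp
    also have "\<dots> \<le> (\<integral>\<^sup>+r. ennreal (2 * pi * \<delta> * k r) \<partial>lborel)"
    proof (rule nn_integral_mono)
      fix r :: real
      show "ennreal (2 * pi * r) * indicator {0..} r * ennreal (k r) \<le> ennreal (2 * pi * \<delta> * k r)"
      proof (cases "0 \<le> r \<and> r \<le> \<delta>")
        case True
        then have "2 * pi * r * k r \<le> 2 * pi * \<delta> * k r" using k0 by (intro mult_right_mono) auto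
        then show ?thesis using True k0 by (simp add: ennreal_mult[symmetric] ennreal_leI)
      next
        case False
        then have "k r = 0" using k\<delta>[of r] kneg[of r] by force
        then show ?thesis by simp
      qed
    qed
    also have "\<dots> < \<infinity>"
    proof -
      have "integrable lborel (\<lambda>r. 2 * pi * \<delta> * k r)" using ki by simp
      then show ?thesis using k0 \<delta> nn_integral_eq_integral[of lborel "\<lambda>r. 2 * pi * \<delta> * k r"] by simp
    qed
    finally show "emeasure ?\<mu> (space ?\<mu>) \<noteq> \<infinity>" by simp
    show "sets ?\<mu> = sets borel" by simp
    show "AE z in ?\<mu>. norm z < \<delta>"
      by (subst AE_density) (auto intro!: AE_I2 simp: k\<delta> not_less[symmetric] intro: ccontr)
    show "distr ?\<mu> borel rot = ?\<mu>"
    proof (rule measure_eqI)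
      fix A assume "A \<in> sets (distr ?\<mu> borel rot)"
      then have A [measurable]: "A \<in> sets borel" by simp
      have [measurable]: "rot -` A \<in> sets borel" using measurable_sets[OF rot_borel A] by simp
      have "emeasure (distr ?\<mu> borel rot) A = (\<integral>\<^sup>+z. ennreal (k (norm z)) * indicator (rot -` A) z \<partial>lborel)"
        by (simp add: emeasure_distr emeasure_density)
      also have "\<dots> = (\<integral>\<^sup>+z. ennreal (k (norm (rot z))) * indicator A (rot z) \<partial>lborel)"
        by (intro nn_integral_cong) (auto split: split_indicator)
      also have "\<dots> = (\<integral>\<^sup>+z. ennreal (k (norm z)) * indicator A z \<partial>distr lborel borel rot)"
        by (subst nn_integral_distr) auto
      also have "\<dots> = emeasure ?\<mu> A" unfolding distr_rot_lborel by (subst emeasure_density) auto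
      finally show "emeasure (distr ?\<mu> borel rot) A = emeasure ?\<mu> A" .
    qed simp
    have "(\<integral>z. (norm z)\<^sup>2 \<partial>?\<mu>) = (\<integral>z. k (norm z) * (norm (z::plane))\<^sup>2 \<partial>lborel)"
      by (subst integral_density) (auto simp: k0)
    also have "\<dots> = enn2real (\<integral>\<^sup>+z. ennreal (k (norm z) * (norm (z::plane))\<^sup>2) \<partial>lborel)"
      by (rule integral_eq_nn_integral) (auto simp: k0)
    also have "(\<integral>\<^sup>+z. ennreal (k (norm z) * (norm (z::plane))\<^sup>2) \<partial>lborel)
        = (\<integral>\<^sup>+r. ennreal (2 * pi * r) * indicator {0..} r * ennreal (k r * r\<^sup>2) \<partial>lborel)"
      by (rule nn_integral_radial) simp
    also have "\<dots> = (\<integral>\<^sup>+r. ennreal (2 * pi * (r ^ 3 * k r)) \<partial>lborel)"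
    proof (rule nn_integral_cong)
      fix r :: real
      show "ennreal (2 * pi * r) * indicator {0..} r * ennreal (k r * r\<^sup>2) = ennreal (2 * pi * (r ^ 3 * k r))"
        using k0[of r] kneg[of r]
        by (cases "r \<ge> 0") (auto simp: ennreal_mult[symmetric] power2_eq_square power3_eq_cube algebra_simps)
    qed
    also have "enn2real \<dots> = (\<integral>r. 2 * pi * (r ^ 3 * k r) \<partial>lborel)"
    proof (rule integral_eq_nn_integral[symmetric])
      show "AE r in lborel. 0 \<le> 2 * pi * (r ^ 3 * k r)"
        by (intro AE_I2) (use k0 kneg in \<open>metis le_cases mult_nonneg_nonneg mult_zero_right order_refl pi_ge_zero zero_le_numeral zero_le_power\<close>)
    qed simp
    also have "\<dots> = 2 * pi * (\<integral>r. r ^ 3 * k r \<partial>lborel)" by simp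
    also have "(\<integral>r. r ^ 3 * k r \<partial>lborel) = (\<integral>r. r ^ 3 * k r \<partial>lebesgue)"
      by (rule integral_completion[symmetric]) simp
    also have "\<dots> = (\<integral>r. indicator {0<..<\<delta>} r *\<^sub>R (r ^ 3 * g \<delta> r) \<partial>lebesgue)"
    proof (rule integral_cong_AE)
      show "AE r in lebesgue. r ^ 3 * k r = indicator {0<..<\<delta>} r *\<^sub>R (r ^ 3 * g \<delta> r)"
        using AE_completion[OF fk] by eventually_elim (auto split: split_indicator_asm)
      show "(\<lambda>r. r ^ 3 * k r) \<in> borel_measurable lebesgue" by (rule measurable_completion) simp
      have "(\<lambda>r. r ^ 3 * ?f r) \<in> borel_measurable lebesgue"
        by (intro borel_measurable_times borel_measurable_integrable[OF fi] measurable_completion) simp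
      then show "(\<lambda>r. indicator {0<..<\<delta>} r *\<^sub>R (r ^ 3 * g \<delta> r)) \<in> borel_measurable lebesgue"
        by (simp add: mult.left_commute)
    qed
    also have "\<dots> = (LINT r:{0<..<\<delta>}|lebesgue. r ^ 3 * g \<delta> r)" by (simp add: set_lebesgue_integral_def)
    finally show "(\<integral>z. (norm z)\<^sup>2 \<partial>?\<mu>) = 4 * \<sigma>" using gs by simp
  qed
  then show thesis using that[of k] km k0 k\<delta> AEk by blast
qed

section \<open>Continuously differentiable functions near a compact set\<close>

text \<open>Gradients instead of derivatives as linear maps: partial derivatives then are components of a vector
  field, which can be multiplied by cutoffs and integrated componentwise.\<close>

definition has_C1_gradient :: "plane set \<Rightarrow> (plane \<Rightarrow> real) \<Rightarrow> (plane \<Rightarrow> plane) \<Rightarrow> bool" where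
  "has_C1_gradient S f G \<longleftrightarrow>
     (\<forall>x\<in>S. (f has_derivative (\<lambda>h. G x \<bullet> h)) (at x)) \<and> continuous_on S G"

lemma blinfun_gradient:
  fixes A :: "plane \<Rightarrow>\<^sub>L real"
  shows "blinfun_apply A h = vector [A (axis 1 1), A (axis 2 1)] \<bullet> h"
proof -
  have "h = h $ 1 *\<^sub>R axis 1 1 + h $ 2 *\<^sub>R axis 2 1" by (simp add: plane_eq_iff axis_def)
  then have "A h = A (h $ 1 *\<^sub>R axis 1 1 + h $ 2 *\<^sub>R axis 2 1)" by (rule arg_cong)
  also have "\<dots> = h $ 1 *\<^sub>R A (axis 1 1) + h $ 2 *\<^sub>R A (axis 2 1)"
    by (simp only: blinfun.add_right blinfun.scaleR_right)
  finally show ?thesis by (simp add: inner_plane mult.commute)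
qed

lemma continuous_on_vector2 [continuous_intros]:
  fixes a b :: "'a::topological_space \<Rightarrow> real"
  assumes "continuous_on S a" "continuous_on S b"
  shows "continuous_on S (\<lambda>x. vector [a x, b x] :: plane)"
proof -
  have "(vector [a x, b x] :: plane) = a x *\<^sub>R axis 1 1 + b x *\<^sub>R axis 2 1" for x
    by (simp add: plane_eq_iff axis_def)
  then show ?thesis using assms by (simp only:) (intro continuous_intros)
qed

lemma C1_on_gradient:
  assumes "C1_on S f"
  obtains G where "has_C1_gradient S f G"
proof -
  obtain f' where f': "\<forall>x\<in>S. (f has_derivative blinfun_apply (f' x)) (at x)" "continuous_on S f'"
    using assms unfolding C1_on_def by blast
  show thesis
  proof (rule that[of "\<lambda>x. vector [f' x (axis 1 1), f' x (axis 2 1)]"])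
    show "has_C1_gradient S f (\<lambda>x. vector [f' x (axis 1 1), f' x (axis 2 1)])"
      unfolding has_C1_gradient_def blinfun_gradient[symmetric]
      using f' by (auto intro!: continuous_intros)
  qed
qed

lemma C2_on_gradient:
  fixes u :: "plane \<Rightarrow> real"
  assumes "C2_on S u"
  obtains p H where "has_C1_gradient S u p" "\<And>i. has_C1_gradient S (\<lambda>x. p x $ i) (H i)"
proof -
  obtain f' where f': "\<forall>x\<in>S. (u has_derivative blinfun_apply (f' x)) (at x)" "C1_on S f'"
    using assms unfolding C2_on_def by blast
  obtain f'' where f'': "\<forall>x\<in>S. (f' has_derivative blinfun_apply (f'' x)) (at x)" "continuous_on S f''"
    using f'(2) unfolding C1_on_def by blast
  let ?p = "\<lambda>x. vector [f' x (axis 1 1), f' x (axis 2 1)] :: plane"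
  let ?H = "\<lambda>i x. vector [f'' x (axis 1 1) (axis i 1), f'' x (axis 2 1) (axis i 1)] :: plane"
  have c: "continuous_on S f'" 
    by (rule has_derivative_continuous_on[where f' = "\<lambda>x. blinfun_apply (f'' x)"])
       (use f''(1) in \<open>auto intro: has_derivative_at_withinI\<close>)
  have pi: "?p x $ i = f' x (axis i 1)" for x i
    using exhaust_2[of i] by auto
  show thesis
  proof (rule that[of ?p ?H])
    show "has_C1_gradient S u ?p"
      unfolding has_C1_gradient_def blinfun_gradient[symmetric]
      using f' c by (auto intro!: continuous_intros)
    fix i :: 2
    have "((\<lambda>x. f' x (axis i 1)) has_derivative (\<lambda>h. ?H i x \<bullet> h)) (at x)" if "x \<in> S" for x
    proof -
      have e: "?H i x \<bullet> h = f'' x h (axis i 1)" for h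
      proof -
        have "h = h $ 1 *\<^sub>R axis 1 1 + h $ 2 *\<^sub>R axis 2 1" by (simp add: plane_eq_iff axis_def)
        then have "f'' x h = f'' x (h $ 1 *\<^sub>R axis 1 1 + h $ 2 *\<^sub>R axis 2 1)" by (rule arg_cong)
        also have "\<dots> = h $ 1 *\<^sub>R f'' x (axis 1 1) + h $ 2 *\<^sub>R f'' x (axis 2 1)"
          by (simp only: blinfun.add_right blinfun.scaleR_right)
        finally show ?thesis by (simp add: inner_plane blinfun.add_left blinfun.scaleR_left mult.commute)
      qed
      have "(f' has_derivative blinfun_apply (f'' x)) (at x)" using f''(1) that by blast
      then show ?thesis unfolding e
        by (auto intro!: derivative_eq_intros)
    qed
    then show "has_C1_gradient S (\<lambda>x. ?p x $ i) (?H i)"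
      unfolding pi has_C1_gradient_def using f''(2) by (auto intro!: continuous_intros)
  qed
qed

lemma has_C1_gradient_continuous: "has_C1_gradient S f G \<Longrightarrow> continuous_on S f"
  unfolding has_C1_gradient_def
  by (rule has_derivative_continuous_on[where f' = "\<lambda>x h. G x \<bullet> h"]) (auto intro: has_derivative_at_withinI)

lemma has_C1_gradient_mult:
  assumes "has_C1_gradient S f F" "has_C1_gradient S g G"
  shows "has_C1_gradient S (\<lambda>x. f x * g x) (\<lambda>x. f x *\<^sub>R G x + g x *\<^sub>R F x)"
proof -
  have "continuous_on S f" "continuous_on S g" using assms by (auto intro: has_C1_gradient_continuous)
  then show ?thesis using assms unfolding has_C1_gradient_def
    by (auto intro!: derivative_eq_intros continuous_intros simp: algebra_simps inner_add_left)
qed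

lemma has_C1_gradient_extend_by_0:
  assumes f: "has_C1_gradient U f G" and U: "open U" and C: "closed C" "C \<subseteq> U" and 0: "\<And>x. x \<in> U - C \<Longrightarrow> f x = 0"
  obtains G' where "has_C1_gradient UNIV (\<lambda>x. if x \<in> U then f x else 0) G'"
proof -
  let ?f = "\<lambda>x. if x \<in> U then f x else 0" and ?G = "\<lambda>x. if x \<in> U then G x else 0"
  have in_U: "(?f has_derivative (\<lambda>h. ?G x \<bullet> h)) (at x)" if "x \<in> U" for x
    using f that U unfolding has_C1_gradient_def
    by (auto intro: has_derivative_transform_within_open[of f _ x UNIV U])
  have off_C: "(?f has_derivative (\<lambda>h. 0)) (at x)" if "x \<notin> C" for x
    by (rule has_derivative_transform_within_open[of "\<lambda>x. 0" _ x UNIV "- C"])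
       (use that C 0 in auto)
  have G0: "?G x = 0" if "x \<notin> C" for x
  proof (cases "x \<in> U")
    case True
    have "(\<lambda>h. ?G x \<bullet> h) = (\<lambda>h. 0)"
      by (rule has_derivative_unique[OF in_U[OF True] off_C[OF that]])
    then have "?G x \<bullet> ?G x = 0" by meson
    then show ?thesis by simp
  qed simp
  have "(?f has_derivative (\<lambda>h. ?G x \<bullet> h)) (at x)" for x
    using in_U[of x] off_C[of x] G0[of x] C(2) by (cases "x \<in> U") auto
  moreover have "continuous_on (U \<union> - C) ?G"
  proof (rule continuous_on_open_Un)
    show "open U" "open (- C)" using U C by auto
    show "continuous_on U ?G"
      by (rule continuous_on_eq[of U G]) (use f in \<open>auto simp: has_C1_gradient_def\<close>)
    show "continuous_on (- C) ?G"
      by (rule continuous_on_eq[of _ "\<lambda>x. 0"]) (use G0 in auto)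
  qed
  moreover have "U \<union> - C = UNIV" using C by auto
  ultimately show thesis using that[of ?G] by (simp add: has_C1_gradient_def)
qed

text \<open>The simplest \<open>C\<^sup>1\<close> function that vanishes on a half-line.\<close>

lemma pos_part_squared_deriv:
  "((\<lambda>t::real. (max 0 t)\<^sup>2) has_real_derivative 2 * max 0 t) (at t)"
proof -
  consider "t > 0" | "t < 0" | "t = 0" by linarith
  then show ?thesis
  proof cases
    case 1
    have "((\<lambda>t::real. t\<^sup>2) has_real_derivative 2 * max 0 t) (at t)"
      using 1 by (auto intro!: derivative_eq_intros)
    then show ?thesis
      by (rule has_field_derivative_transform_within_open[of _ _ _ "{0<..}"]) (use 1 in auto)
  next
    case 2
    have "((\<lambda>t::real. 0) has_real_derivative 2 * max 0 t) (at t)"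
      using 2 by (auto intro!: derivative_eq_intros)
    then show ?thesis
      by (rule has_field_derivative_transform_within_open[of _ _ _ "{..<0}"]) (use 2 in auto)
  next
    case 3
    have "((\<lambda>h. ((max 0 (0 + h))\<^sup>2 - (max 0 0)\<^sup>2) / h) \<longlongrightarrow> (0::real)) (at 0)"
    proof (rule Lim_null_comparison)
      show "\<forall>\<^sub>F h in at 0. norm (((max 0 (0 + h))\<^sup>2 - (max 0 0)\<^sup>2) / h) \<le> \<bar>h::real\<bar>"
        by (rule always_eventually) (auto simp: max_def power2_eq_square)
      show "((\<lambda>h::real. \<bar>h\<bar>) \<longlongrightarrow> 0) (at 0)" by (rule tendsto_rabs_zero) (rule tendsto_ident_at)
    qed
    then show ?thesis using 3 by (simp add: DERIV_def)
  qed
qed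

lemma has_C1_gradient_pos_part_squared:
  assumes "has_C1_gradient S f G"
  shows "has_C1_gradient S (\<lambda>x. (max 0 (f x))\<^sup>2) (\<lambda>x. (2 * max 0 (f x)) *\<^sub>R G x)"
proof -
  have "((\<lambda>x. (max 0 (f x))\<^sup>2) has_derivative (\<lambda>h. ((2 * max 0 (f x)) *\<^sub>R G x) \<bullet> h)) (at x)" if "x \<in> S" for x
  proof -
    have "(f has_derivative (\<lambda>h. G x \<bullet> h)) (at x)" using assms that by (auto simp: has_C1_gradient_def)
    from has_derivative_compose[OF this pos_part_squared_deriv[of "f x", unfolded has_field_derivative_def]]
    show ?thesis by simp
  qed
  moreover have "continuous_on S (\<lambda>x. (2 * max 0 (f x)) *\<^sub>R G x)"
    using assms has_C1_gradient_continuous[OF assms]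
    unfolding has_C1_gradient_def by (auto intro!: continuous_intros)
  ultimately show ?thesis unfolding has_C1_gradient_def by blast
qed

lemma has_C1_gradient_sum:
  assumes "\<And>i. i \<in> I \<Longrightarrow> has_C1_gradient S (f i) (G i)"
  shows "has_C1_gradient S (\<lambda>x. \<Sum>i\<in>I. f i x) (\<lambda>x. \<Sum>i\<in>I. G i x)"
  using assms unfolding has_C1_gradient_def inner_sum_left
  by (auto intro!: has_derivative_sum continuous_intros)

lemma has_C1_gradient_affine:
  assumes "has_C1_gradient S f G"
  shows "has_C1_gradient S (\<lambda>x. a + b * f x) (\<lambda>x. b *\<^sub>R G x)"
  using assms unfolding has_C1_gradient_def
  by (auto intro!: derivative_eq_intros continuous_intros)

text \<open>A sum of finitely many bumps \<open>(max 0 (4 r\<^sup>2 - |x - p|\<^sup>2))\<^sup>2\<close> is at least \<open>r\<^sup>4\<close> near \<open>K\<close> and zero far from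
  it; composing it with \<open>m \<mapsto> 1 - (max 0 (1 - m / r\<^sup>4))\<^sup>2\<close> makes it constantly one near \<open>K\<close>.\<close>

lemma C1_cutoff:
  fixes K :: "plane set"
  assumes K: "compact K" and r: "r > 0"
  obtains \<phi> X where "has_C1_gradient UNIV \<phi> X"
    "\<And>x p. p \<in> K \<Longrightarrow> dist x p \<le> r / 2 \<Longrightarrow> \<phi> x = 1"
    "\<And>x. \<forall>p\<in>K. dist x p \<ge> 2 * r \<Longrightarrow> \<phi> x = 0"
proof -
  obtain A where A: "finite A" "A \<subseteq> K" "K \<subseteq> (\<Union>p\<in>A. ball p r)"
    using compactE_image[OF K, of K "\<lambda>p. ball p r"] r by (metis UN_I centre_in_ball open_ball subsetI)
  let ?b = "\<lambda>p x. 4 * r\<^sup>2 - (norm (x - p))\<^sup>2 :: real"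
  have b: "has_C1_gradient UNIV (?b p) (\<lambda>x. - 2 *\<^sub>R (x - p))" for p :: plane
    unfolding has_C1_gradient_def power2_norm_eq_inner
    by (auto intro!: derivative_eq_intros continuous_intros simp: algebra_simps inner_commute inner_diff_left inner_diff_right)
  let ?S = "\<lambda>x. \<Sum>p\<in>A. (max 0 (?b p x))\<^sup>2"
  let ?GS = "\<lambda>x. \<Sum>p\<in>A. (2 * max 0 (?b p x)) *\<^sub>R (- 2 *\<^sub>R (x - p))"
  have S: "has_C1_gradient UNIV ?S ?GS"
    by (rule has_C1_gradient_sum) (rule has_C1_gradient_pos_part_squared[OF b])
  let ?m = "\<lambda>x. 1 + (- 1 / r ^ 4) * ?S x"
  let ?\<phi> = "\<lambda>x. 1 + (- 1) * (max 0 (?m x))\<^sup>2"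
  note \<phi> = has_C1_gradient_affine[OF has_C1_gradient_pos_part_squared[OF has_C1_gradient_affine[OF S]], of 1 "-1" 1 "- 1 / r ^ 4"]
  show thesis
  proof (rule that[OF \<phi>])
    fix x p assume p: "p \<in> K" "dist x p \<le> r / 2"
    then obtain q where q: "q \<in> A" "dist q p < r" using A by auto
    have "dist x q \<le> 3 / 2 * r" using dist_triangle[of x q p] p q by (simp add: dist_commute)
    then have "(norm (x - q))\<^sup>2 \<le> (3 / 2 * r)\<^sup>2" by (intro power_mono) (auto simp: dist_norm)
    then have "4 * (norm (x - q))\<^sup>2 \<le> 9 * r\<^sup>2" by (simp add: power_mult_distrib field_simps)
    then have "?b q x \<ge> r\<^sup>2" using zero_le_power2[of r] by linarith
    then have "(r\<^sup>2)\<^sup>2 \<le> (max 0 (?b q x))\<^sup>2" by (intro power_mono) auto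
    also have "\<dots> \<le> ?S x" by (rule member_le_sum[OF q(1)]) (auto simp: A)
    finally have "r ^ 4 \<le> ?S x" by (simp flip: power_mult)
    then have "?m x \<le> 0" using r by (simp add: field_simps)
    then show "?\<phi> x = 1" by simp
  next
    fix x assume far: "\<forall>p\<in>K. dist x p \<ge> 2 * r"
    have "max 0 (?b p x) = 0" if "p \<in> A" for p
    proof -
      have "(2 * r)\<^sup>2 \<le> (norm (x - p))\<^sup>2"
        using bspec[OF far, of p] that A(2) r by (intro power_mono) (auto simp: dist_norm)
      then show ?thesis by (intro max_absorb1) (simp add: power_mult_distrib)
    qed
    then have "?S x = 0" by simp
    then show "?\<phi> x = 0" by simp
  qed
qed

lemma infdist_add_le: "infdist (x + w) K \<le> infdist x K + norm (w :: 'a::real_normed_vector)"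
  using infdist_triangle[of "x + w" K x] by (simp add: dist_norm)

text \<open>The gradient is bounded on the compact neighbourhood of radius \<open>2 \<eta>\<close>, which contains the disc of radius
  \<open>\<eta>\<close> around every point of the neighbourhood of radius \<open>\<eta>\<close>.\<close>

lemma C1_lipschitz_near:
  assumes K: "compact K" "K \<noteq> {}" and \<eta>: "\<eta> > 0"
    and f: "has_C1_gradient {x. infdist x K < 4 * \<eta>} f G"
  obtains L where "L \<ge> 0" "\<And>x. infdist x K \<le> 2 * \<eta> \<Longrightarrow> \<bar>f x\<bar> \<le> L"
    "\<And>x w. infdist x K \<le> \<eta> \<Longrightarrow> norm w \<le> \<eta> \<Longrightarrow> \<bar>f (x + w) - f x\<bar> \<le> L * norm w"
proof -
  let ?K = "{x. infdist x K \<le> 2 * \<eta>}"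
  have c: "compact ?K" by (rule compact_infdist_le[OF K(2,1)]) (use \<eta> in simp)
  have sub: "?K \<subseteq> {x. infdist x K < 4 * \<eta>}" using \<eta> by auto
  have cf: "continuous_on ?K f" and cG: "continuous_on ?K G"
    using f has_C1_gradient_continuous[OF f] sub
    by (auto simp: has_C1_gradient_def intro: continuous_on_subset)
  obtain L1 where L1: "\<And>x. x \<in> ?K \<Longrightarrow> \<bar>f x\<bar> \<le> L1"
    using compact_imp_bounded[OF compact_continuous_image[OF cf c]] by (auto simp: bounded_iff)
  obtain L2 where L2: "\<And>x. x \<in> ?K \<Longrightarrow> norm (G x) \<le> L2"
    using compact_imp_bounded[OF compact_continuous_image[OF cG c]] by (auto simp: bounded_iff)
  let ?L = "max 0 (max L1 L2)"
  show thesis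
  proof (rule that[of ?L])
    show "\<bar>f x\<bar> \<le> ?L" if "infdist x K \<le> 2 * \<eta>" for x using L1[of x] that by auto
    show "\<bar>f (x + w) - f x\<bar> \<le> ?L * norm w" if x: "infdist x K \<le> \<eta>" and w: "norm w \<le> \<eta>" for x w
    proof -
      have near: "y \<in> ?K" if "y \<in> cball x \<eta>" for y
        using infdist_add_le[of x "y - x" K] x that by (simp add: dist_norm norm_minus_commute)
      have "norm (f (x + w) - f x) \<le> ?L * norm (x + w - x)"
      proof (rule differentiable_bound[OF convex_cball[of x \<eta>]])
        fix y assume y: "y \<in> cball x \<eta>"
        have "y \<in> {x. infdist x K < 4 * \<eta>}" using near[OF y] sub by blast
        then show "(f has_derivative (\<lambda>h. G y \<bullet> h)) (at y within cball x \<eta>)"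
          using f by (auto simp: has_C1_gradient_def intro: has_derivative_at_withinI)
        show "onorm (\<lambda>h. G y \<bullet> h) \<le> ?L"
        proof (rule onorm_le)
          fix h
          have "\<bar>G y \<bullet> h\<bar> \<le> norm (G y) * norm h" by (rule Cauchy_Schwarz_ineq2)
          also have "\<dots> \<le> ?L * norm h" using L2[OF near[OF y]] by (intro mult_right_mono) auto
          finally show "norm (G y \<bullet> h) \<le> ?L * norm h" by simp
        qed
      qed (use w \<eta> in \<open>auto simp: dist_norm\<close>)
      then show ?thesis by simp
    qed
  qed simp
qed

text \<open>The function \<open>y \<mapsto> u y - p x \<bullet> y\<close> has the gradient \<open>p y - p x\<close>, which is of order \<open>norm w\<close> on the disc
  of that radius.\<close>

lemma C2_taylor_near:
  assumes K: "compact K" "K \<noteq> {}" and \<eta>: "\<eta> > 0"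
    and u: "has_C1_gradient {x. infdist x K < 4 * \<eta>} u p"
    and p: "\<And>i. has_C1_gradient {x. infdist x K < 4 * \<eta>} (\<lambda>x. p x $ i) (H i)"
  obtains L where "L \<ge> 0"
    "\<And>x w. infdist x K \<le> \<eta> \<Longrightarrow> norm w \<le> \<eta> \<Longrightarrow> \<bar>u (x + w) - u x - p x \<bullet> w\<bar> \<le> L * (norm w)\<^sup>2"
proof -
  obtain L1 where L1: "L1 \<ge> 0" "\<And>x. infdist x K \<le> 2 * \<eta> \<Longrightarrow> \<bar>p x $ 1\<bar> \<le> L1" "\<And>x w. infdist x K \<le> \<eta> \<Longrightarrow> norm w \<le> \<eta> \<Longrightarrow> \<bar>p (x + w) $ 1 - p x $ 1\<bar> \<le> L1 * norm w"
    by (rule C1_lipschitz_near[OF K \<eta> p[of 1]]) (rule that)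
  obtain L2 where L2: "L2 \<ge> 0" "\<And>x. infdist x K \<le> 2 * \<eta> \<Longrightarrow> \<bar>p x $ 2\<bar> \<le> L2" "\<And>x w. infdist x K \<le> \<eta> \<Longrightarrow> norm w \<le> \<eta> \<Longrightarrow> \<bar>p (x + w) $ 2 - p x $ 2\<bar> \<le> L2 * norm w"
    by (rule C1_lipschitz_near[OF K \<eta> p[of 2]]) (rule that)
  show thesis
  proof (rule that[of "L1 + L2"])
    show "\<bar>u (x + w) - u x - p x \<bullet> w\<bar> \<le> (L1 + L2) * (norm w)\<^sup>2" if x: "infdist x K \<le> \<eta>" and w: "norm w \<le> \<eta>" for x w
    proof -
      have "norm ((u (x + w) - p x \<bullet> (x + w)) - (u x - p x \<bullet> x)) \<le> ((L1 + L2) * norm w) * norm (x + w - x)"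
      proof (rule differentiable_bound[OF convex_cball[of x "norm w"]])
        fix y assume y: "y \<in> cball x (norm w)"
        then have yx: "norm (y - x) \<le> norm w" by (simp add: dist_norm norm_minus_commute)
        have "y \<in> {x. infdist x K < 4 * \<eta>}"
          using infdist_add_le[of x "y - x" K] x w yx \<eta> by simp
        then have "(u has_derivative (\<lambda>h. p y \<bullet> h)) (at y within cball x (norm w))"
          using u by (auto simp: has_C1_gradient_def intro: has_derivative_at_withinI)
        then show "((\<lambda>y. u y - p x \<bullet> y) has_derivative (\<lambda>h. (p y - p x) \<bullet> h)) (at y within cball x (norm w))"
          by (auto intro!: derivative_eq_intros simp: inner_diff_left)
        have "norm (p y - p x) \<le> \<bar>(p y - p x) $ 1\<bar> + \<bar>(p y - p x) $ 2\<bar>"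
          using norm_le_l1_cart[of "p y - p x"] by (simp add: UNIV_2)
        also have "\<dots> \<le> (L1 + L2) * norm (y - x)"
          using L1(3)[OF x, of "y - x"] L2(3)[OF x, of "y - x"] yx w by (simp add: algebra_simps)
        also have "\<dots> \<le> (L1 + L2) * norm w" using yx L1(1) L2(1) by (intro mult_left_mono) auto
        finally have n: "norm (p y - p x) \<le> (L1 + L2) * norm w" .
        show "onorm (\<lambda>h. (p y - p x) \<bullet> h) \<le> (L1 + L2) * norm w"
        proof (rule onorm_le)
          fix h
          have "\<bar>(p y - p x) \<bullet> h\<bar> \<le> norm (p y - p x) * norm h" by (rule Cauchy_Schwarz_ineq2)
          also have "\<dots> \<le> ((L1 + L2) * norm w) * norm h" using n by (intro mult_right_mono) auto
          finally show "norm ((p y - p x) \<bullet> h) \<le> ((L1 + L2) * norm w) * norm h" by simp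
        qed
      qed (auto simp: dist_norm)
      then show ?thesis by (simp add: inner_add_right power2_eq_square algebra_simps)
    qed
  qed (use L1(1) L2(1) in simp)
qed

section \<open>Translating a convex region\<close>

lemma integrable_bounded_support:
  fixes f :: "'a \<Rightarrow> real"
  assumes "f \<in> borel_measurable M" "A \<in> sets M" "emeasure M A < \<infinity>"
    and "\<And>x. x \<in> space M \<Longrightarrow> \<bar>f x\<bar> \<le> B" "\<And>x. x \<in> space M \<Longrightarrow> x \<notin> A \<Longrightarrow> f x = 0"
  shows "integrable M f"
  by (rule integrableI_bounded_set[of A M f B]) (use assms in auto)

lemma integral_lborel_translate:
  fixes f :: "plane \<Rightarrow> real"
  assumes "f \<in> borel_measurable borel"
  shows "(\<integral>x. f (x + a) \<partial>lborel) = (\<integral>x. f x \<partial>lborel)"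
proof -
  have "(\<integral>x. f x \<partial>lborel) = (\<integral>x. f x \<partial>distr lborel borel ((+) a))" by (simp add: lborel_distr_plus)
  also have "\<dots> = (\<integral>x. f (a + x) \<partial>lborel)" by (rule integral_distr) (use assms in auto)
  finally show ?thesis by (simp add: add.commute)
qed

context convex_C1_region
begin

lemma region_borel [measurable]: "\<Omega> \<in> sets borel" using open_region by (rule borel_open)

lemma shift_in_tube:
  assumes "indicator \<Omega> (x + w) \<noteq> (indicator \<Omega> x :: real)"
  shows "x \<in> tube (norm w)"
proof -
  have "dist x (x + w) = norm w" by (simp add: dist_norm)
  then show ?thesis
    using assms crossing_near_frontier[of x "x + w"] crossing_near_frontier[of "x + w" x]
    by (cases "x \<in> \<Omega>"; cases "x + w \<in> \<Omega>") (auto simp: tube_def dist_commute)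
qed

lemma emeasure_tube: "emeasure lborel (tube r) < \<infinity>"
  using compact_tube by (rule emeasure_compact_finite)

text \<open>The integrand on the left is the integral of \<open>G (x - s z) \<bullet> z\<close> over \<open>s\<close> in the unit interval. After
  interchanging the integrals and translating by \<open>s z\<close>, the difference is an integral of \<open>G x \<bullet> z\<close> over the
  symmetric difference of \<open>\<Omega>\<close> and a translate of it, which lies in the tube of radius \<open>norm z\<close>. Both
  the integrand and the area are thus of order \<open>norm z\<close>. A pointwise Taylor estimate would give less, since
  \<open>G\<close> is merely continuous.\<close>

lemma translation_estimate:
  assumes f: "has_C1_gradient UNIV f G"
    and M: "\<And>x. infdist x \<Omega> \<le> 1 \<Longrightarrow> norm (G x) \<le> M"
    and C: "\<And>r. 0 < r \<Longrightarrow> r \<le> 1 \<Longrightarrow> measure lborel (tube r) \<le> C * r"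
    and z: "norm z \<le> 1"
  shows "\<bar>(\<integral>x. indicator \<Omega> x * (f x - f (x - z)) \<partial>lborel) - (\<integral>x. indicator \<Omega> x * (G x \<bullet> z) \<partial>lborel)\<bar>
           \<le> M * C * (norm z)\<^sup>2"
proof (cases "z = 0")
  case True
  then show ?thesis by simp
next
  case False
  then have z0: "norm z > 0" by simp
  have G: "continuous_on UNIV G" and df: "\<And>x. (f has_derivative (\<lambda>h. G x \<bullet> h)) (at x)"
    using f by (auto simp: has_C1_gradient_def)
  have [measurable]: "G \<in> borel_measurable borel" using G by (rule borel_measurable_continuous_onI)
  have fc: "continuous_on UNIV f" using f by (rule has_C1_gradient_continuous)
  have [measurable]: "f \<in> borel_measurable borel" using fc by (rule borel_measurable_continuous_onI)
  have M0: "M \<ge> 0" using M[of x0] x0 norm_ge_zero[of "G x0"] by (simp del: norm_ge_zero)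
  have Mz: "\<bar>G y \<bullet> z\<bar> \<le> M * norm z" if "infdist y \<Omega> \<le> 1" for y
  proof -
    have "\<bar>G y \<bullet> z\<bar> \<le> norm (G y) * norm z" by (rule Cauchy_Schwarz_ineq2)
    also have "\<dots> \<le> M * norm z" using M[OF that] by (intro mult_right_mono) auto
    finally show ?thesis .
  qed
  have near: "infdist (x - s *\<^sub>R z) \<Omega> \<le> 1" if "x \<in> \<Omega>" "s \<in> {0..1}" for x s
  proof -
    have "\<bar>s\<bar> * norm z \<le> 1 * 1" using that z by (intro mult_mono) auto
    then show ?thesis using infdist_le[OF that(1), of "x - s *\<^sub>R z"] by (simp add: dist_norm)
  qed
  have bdd: "emeasure lborel \<Omega> < \<infinity>"
    using bounded_region by (rule emeasure_bounded_finite)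
  let ?g = "\<lambda>x s. indicator \<Omega> x * (indicator {0..1} s * (G (x - s *\<^sub>R z) \<bullet> z))"
  have gint: "integrable (lborel \<Otimes>\<^sub>M lborel) (\<lambda>(x, s). ?g x s)"
  proof (rule integrable_bounded_support[where A = "\<Omega> \<times> {0..1}" and B = "M * norm z"])
    show "emeasure (lborel \<Otimes>\<^sub>M lborel) (\<Omega> \<times> {0..1::real}) < \<infinity>"
      using bdd by (subst lborel.emeasure_pair_measure_Times) (auto simp: ennreal_mult_less_top)
    show "\<bar>case p of (x, s) \<Rightarrow> ?g x s\<bar> \<le> M * norm z" for p :: "plane \<times> real"
      using Mz[OF near, of "fst p" "snd p"] M0 z0 by (auto split: prod.split split_indicator)
  qed (auto simp: indicator_def)
  have pt: "(\<integral>s. ?g x s \<partial>lborel) = indicator \<Omega> x * (f x - f (x - z))" for x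
  proof -
    have d: "((\<lambda>s. - f (x - s *\<^sub>R z)) has_vector_derivative G (x - s *\<^sub>R z) \<bullet> z) (at s within {0..1})" for s
    proof -
      have "((\<lambda>s. x - s *\<^sub>R z) has_derivative (\<lambda>h. - (h *\<^sub>R z))) (at s within {0..1})"
        by (auto intro!: derivative_eq_intros)
      from has_derivative_compose[OF this df] show ?thesis
        unfolding has_vector_derivative_def by (auto intro!: derivative_eq_intros)
    qed
    have "continuous_on {0..1} (\<lambda>s. G (x - s *\<^sub>R z) \<bullet> z)"
      by (intro continuous_intros continuous_on_compose2[OF G]) auto
    then have "(\<integral>s. indicator {0..1} s *\<^sub>R (G (x - s *\<^sub>R z) \<bullet> z) \<partial>lborel) = - f (x - 1 *\<^sub>R z) - - f (x - 0 *\<^sub>R z)"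
      by (intro integral_FTC_Icc d) auto
    then show ?thesis by simp
  qed
  let ?I = "\<integral>x. indicator \<Omega> x * (G x \<bullet> z) \<partial>lborel"
  have Iint: "integrable lborel (\<lambda>x. indicator \<Omega> x * (G x \<bullet> z))"
    by (rule integrable_bounded_support[where A = \<Omega> and B = "M * norm z"])
       (use bdd Mz M0 in \<open>auto split: split_indicator\<close>)
  let ?h = "\<lambda>s. \<integral>x. indicator \<Omega> x * (G (x - s *\<^sub>R z) \<bullet> z) \<partial>lborel"
  have h: "\<bar>?h s - ?I\<bar> \<le> M * C * (norm z)\<^sup>2" if s: "s \<in> {0..1}" for s
  proof -
    let ?d = "\<lambda>x. (indicator \<Omega> (x + s *\<^sub>R z) - indicator \<Omega> x) * (G x \<bullet> z)"
    have sz: "norm (s *\<^sub>R z) \<le> norm z" using s by (simp add: mult_left_le_one_le)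
    have tub: "x \<in> tube (norm z)" if "indicator \<Omega> (x + s *\<^sub>R z) \<noteq> (indicator \<Omega> x :: real)" for x
      using shift_in_tube[OF that] sz by (auto simp: tube_def)
    have dle: "\<bar>?d x\<bar> \<le> indicator (tube (norm z)) x * (M * norm z)" for x
    proof (cases "indicator \<Omega> (x + s *\<^sub>R z) = (indicator \<Omega> x :: real)")
      case False
      have "infdist x \<Omega> \<le> 1"
      proof (cases "x \<in> \<Omega>")
        case True then show ?thesis by simp
      next
        assume "x \<notin> \<Omega>"
        then have "x + s *\<^sub>R z \<in> \<Omega>" using False by (auto split: split_indicator_asm)
        from near[OF this s] show ?thesis by simp
      qed
      from Mz[OF this] show ?thesis using tub[OF False] by (auto split: split_indicator)
    qed (use M0 in \<open>simp split: split_indicator\<close>)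
    have dint: "integrable lborel ?d"
    proof (rule integrable_bounded_support[where A = "tube (norm z)" and B = "M * norm z"])
      show "\<bar>?d x\<bar> \<le> M * norm z" for x
        using dle[of x] M0 by (auto split: split_indicator_asm intro: order_trans)
      show "?d x = 0" if "x \<notin> tube (norm z)" for x using dle[of x] that by simp
    qed (use emeasure_tube in auto)
    have "?h s = (\<integral>x. indicator \<Omega> (x + s *\<^sub>R z) * (G x \<bullet> z) \<partial>lborel)"
      using integral_lborel_translate[of "\<lambda>x. indicator \<Omega> x * (G (x - s *\<^sub>R z) \<bullet> z)" "s *\<^sub>R z"] by simp
    also have "(\<lambda>x. indicator \<Omega> (x + s *\<^sub>R z) * (G x \<bullet> z)) = (\<lambda>x. ?d x + indicator \<Omega> x * (G x \<bullet> z))"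
      by (intro ext) (simp add: algebra_simps)
    also have "(\<integral>x. ?d x + indicator \<Omega> x * (G x \<bullet> z) \<partial>lborel) = (\<integral>x. ?d x \<partial>lborel) + ?I"
      by (rule Bochner_Integration.integral_add[OF dint Iint])
    finally have "\<bar>?h s - ?I\<bar> = \<bar>\<integral>x. ?d x \<partial>lborel\<bar>" by simp
    also have "\<dots> \<le> (\<integral>x. \<bar>?d x\<bar> \<partial>lborel)" by (rule integral_abs_bound)
    also have "\<dots> \<le> (\<integral>x. indicator (tube (norm z)) x * (M * norm z) \<partial>lborel)"
      using emeasure_tube[of "norm z"] by (intro integral_mono integrable_abs dint dle) auto
    also have "\<dots> = measure lborel (tube (norm z)) * (M * norm z)"
      using emeasure_tube[of "norm z"] by simp
    also have "\<dots> \<le> (C * norm z) * (M * norm z)"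
      using C[OF z0 z] M0 by (intro mult_right_mono) auto
    finally show ?thesis by (simp add: power2_eq_square algebra_simps)
  qed
  have "(\<integral>x. indicator \<Omega> x * (f x - f (x - z)) \<partial>lborel) = (\<integral>x. (\<integral>s. ?g x s \<partial>lborel) \<partial>lborel)"
    by (simp only: pt)
  also have "\<dots> = (\<integral>s. (\<integral>x. ?g x s \<partial>lborel) \<partial>lborel)"
    by (rule lborel_pair.Fubini_integral[symmetric]) (rule gint)
  also have "(\<lambda>s. \<integral>x. ?g x s \<partial>lborel) = (\<lambda>s. indicator {0..1} s * ?h s)"
    by (intro ext) (simp only: mult.left_commute[of "indicator \<Omega> _"] integral_mult_right_zero)
  finally have e: "(\<integral>x. indicator \<Omega> x * (f x - f (x - z)) \<partial>lborel) = (\<integral>s. indicator {0..1} s * ?h s \<partial>lborel)" .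
  have hm: "?h \<in> borel_measurable borel" by measurable
  have hint: "integrable lborel (\<lambda>s. indicator {0..1} s * ?h s)"
  proof (rule integrable_bounded_support[where A = "{0..1}" and B = "\<bar>?I\<bar> + M * C * (norm z)\<^sup>2"])
    show "\<bar>indicator {0..1} s * ?h s\<bar> \<le> \<bar>?I\<bar> + M * C * (norm z)\<^sup>2" for s
    proof (cases "s \<in> {0..1}")
      case True then show ?thesis using h[OF True] by simp
    next
      case False
      have "0 \<le> M * C * (norm z)\<^sup>2" using h[of 0] by (smt (verit) abs_ge_zero atLeastAtMost_iff)
      then show ?thesis using False by simp
    qed
  qed (use hm in auto)
  have cint: "integrable lborel (\<lambda>s::real. indicator {0..1} s * a)" for a :: real by simp
  have "(\<integral>s. indicator {0..1} s * ?h s \<partial>lborel) - ?I = (\<integral>s. indicator {0..1} s * ?h s \<partial>lborel) - (\<integral>s. indicator {0..1::real} s * ?I \<partial>lborel)"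
    by simp
  also have "\<dots> = (\<integral>s. indicator {0..1} s * ?h s - indicator {0..1} s * ?I \<partial>lborel)"
    by (rule Bochner_Integration.integral_diff[OF hint cint, symmetric])
  finally have "\<bar>(\<integral>s. indicator {0..1} s * ?h s \<partial>lborel) - ?I\<bar> = \<bar>\<integral>s. indicator {0..1} s * ?h s - indicator {0..1} s * ?I \<partial>lborel\<bar>" by simp
  also have "\<dots> \<le> (\<integral>s. \<bar>indicator {0..1} s * ?h s - indicator {0..1} s * ?I\<bar> \<partial>lborel)" by (rule integral_abs_bound)
  also have "\<dots> \<le> (\<integral>s. indicator {0..1::real} s * (M * C * (norm z)\<^sup>2) \<partial>lborel)"
    by (intro integral_mono integrable_abs Bochner_Integration.integrable_diff hint cint)
       (use h in \<open>auto split: split_indicator\<close>)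
  also have "\<dots> = M * C * (norm z)\<^sup>2" by simp
  finally show ?thesis unfolding e .
qed

end

section \<open>Double integrals over pairs of nearby points\<close>

text \<open>Declared here so that the truncations by \<open>ball 0 \<delta>\<close> below are recognised as measurable.\<close>

lemma ball_borel [measurable]: "ball (a :: 'a::real_normed_vector) r \<in> sets borel"
  by (rule borel_open) simp

locale layer_problem = convex_C1_region \<Omega> c c' x0 + isotropic_measure \<mu> \<delta> \<sigma>
  for \<Omega> c c' x0 \<mu> \<delta> \<sigma>
begin

sublocale pair: pair_sigma_finite lborel \<mu>
  by (intro pair_sigma_finite.intro sigma_finite_lborel sigma_finite_measure_axioms)

lemma integrable_pair:
  fixes \<Phi> :: "plane \<Rightarrow> plane \<Rightarrow> real"
  assumes [measurable]: "(\<lambda>(x, z). \<Phi> x z) \<in> borel_measurable (borel \<Otimes>\<^sub>M borel)"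
    and B: "\<And>x z. \<bar>\<Phi> x z\<bar> \<le> B" and R: "\<And>x z. \<Phi> x z \<noteq> 0 \<Longrightarrow> norm x \<le> R"
  shows "integrable (lborel \<Otimes>\<^sub>M \<mu>) (\<lambda>(x, z). \<Phi> x z)"
proof (rule integrable_bounded_support[where A = "cball 0 R \<times> UNIV" and B = B])
  have "UNIV \<in> sets \<mu>" by (simp add: sets_eq)
  then show "cball 0 R \<times> UNIV \<in> sets (lborel \<Otimes>\<^sub>M \<mu>)" by (intro pair_measureI) auto
  show "emeasure (lborel \<Otimes>\<^sub>M \<mu>) (cball (0::plane) R \<times> UNIV) < \<infinity>"
  proof -
    have "emeasure lborel (cball (0::plane) R) < \<infinity>" by (rule emeasure_compact_finite) simp
    moreover have "emeasure \<mu> UNIV < \<infinity>" by (simp add: emeasure_eq_measure)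
    ultimately show ?thesis
      using \<open>UNIV \<in> sets \<mu>\<close> by (subst emeasure_pair_measure_Times) (auto simp: ennreal_mult_less_top)
  qed
  show "(\<lambda>(x, z). \<Phi> x z) \<in> borel_measurable (lborel \<Otimes>\<^sub>M \<mu>)"
    using assms(1) by (simp cong: measurable_cong_sets sets_pair_measure_cong add: sets_eq)
qed (use B R in \<open>auto split: prod.splits\<close>)

text \<open>Exchanging the two points \<open>x\<close> and \<open>x + z\<close> of a pair turns the difference \<open>z\<close> into \<open>- z\<close>. The product
  measure is invariant under this exchange because Lebesgue measure is invariant under translations and
  \<open>\<mu>\<close> under reflection.\<close>

lemma integral_pair_reflect:
  fixes \<Phi> :: "plane \<Rightarrow> plane \<Rightarrow> real"
  assumes m [measurable]: "(\<lambda>(x, z). \<Phi> x z) \<in> borel_measurable (borel \<Otimes>\<^sub>M borel)"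
    and i: "integrable (lborel \<Otimes>\<^sub>M \<mu>) (\<lambda>(x, z). \<Phi> x z)"
    and i': "integrable (lborel \<Otimes>\<^sub>M \<mu>) (\<lambda>(x, z). \<Phi> (x + z) (- z))"
  shows "integral\<^sup>L (lborel \<Otimes>\<^sub>M \<mu>) (\<lambda>(x, z). \<Phi> (x + z) (- z)) = integral\<^sup>L (lborel \<Otimes>\<^sub>M \<mu>) (\<lambda>(x, z). \<Phi> x z)"
proof -
  have "integral\<^sup>L (lborel \<Otimes>\<^sub>M \<mu>) (\<lambda>(x, z). \<Phi> (x + z) (- z)) = (\<integral>z. (\<integral>x. \<Phi> (x + z) (- z) \<partial>lborel) \<partial>\<mu>)"
    by (rule pair.integral_snd[OF i', symmetric])
  also have "\<dots> = (\<integral>z. (\<integral>x. \<Phi> x (- z) \<partial>lborel) \<partial>\<mu>)"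
  proof -
    have [measurable]: "(\<lambda>x. \<Phi> x (- z)) \<in> borel_measurable borel" for z by measurable
    show ?thesis
      using integral_lborel_translate[of "\<lambda>x. \<Phi> x (- z)" z for z] by simp
  qed
  also have "\<dots> = (\<integral>z. (\<integral>x. \<Phi> x z \<partial>lborel) \<partial>\<mu>)"
    by (rule integral_reflect[of "\<lambda>z. \<integral>x. \<Phi> x z \<partial>lborel"]) measurable
  also have "\<dots> = integral\<^sup>L (lborel \<Otimes>\<^sub>M \<mu>) (\<lambda>(x, z). \<Phi> x z)"
    by (rule pair.integral_snd[OF i])
  finally show ?thesis .
qed

lemma integral_truncated_square:
  "integrable \<mu> (\<lambda>z. indicator (ball 0 \<delta>) z * (norm z)\<^sup>2)"
  "(\<integral>z. indicator (ball 0 \<delta>) z * (norm z)\<^sup>2 \<partial>\<mu>) = 4 * \<sigma>"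
proof -
  show "integrable \<mu> (\<lambda>z. indicator (ball 0 \<delta>) z * (norm z)\<^sup>2)"
  proof (rule integrable_small[where B = "\<delta>\<^sup>2"])
    show "\<bar>indicator (ball 0 \<delta>) z * (norm z)\<^sup>2\<bar> \<le> \<delta>\<^sup>2" if "norm z < \<delta>" for z :: plane
      using that by (auto split: split_indicator intro: power_mono)
  qed measurable
  have "(\<integral>z. indicator (ball 0 \<delta>) z * (norm z)\<^sup>2 \<partial>\<mu>) = (\<integral>z. (norm z)\<^sup>2 \<partial>\<mu>)"
  proof (rule integral_cong_AE)
    show "AE z in \<mu>. indicator (ball 0 \<delta>) z * (norm z)\<^sup>2 = (norm z)\<^sup>2"
      using support by eventually_elim (auto simp: dist_norm)
  qed measurable
  then show "(\<integral>z. indicator (ball 0 \<delta>) z * (norm z)\<^sup>2 \<partial>\<mu>) = 4 * \<sigma>" by (simp add: second_moment)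
qed

lemma integral_region_difference:
  fixes f :: "plane \<Rightarrow> real"
  assumes f: "continuous_on UNIV f"
  shows "(\<integral>x. (indicator \<Omega> x - indicator \<Omega> (x + z)) * f x \<partial>lborel)
       = (\<integral>x. indicator \<Omega> x * (f x - f (x - z)) \<partial>lborel)"
    and "integrable lborel (\<lambda>x. (indicator \<Omega> x - indicator \<Omega> (x + z)) * f x)"
proof -
  have [measurable]: "f \<in> borel_measurable borel" using f by (rule borel_measurable_continuous_onI)
  obtain r where "r > 0" "\<And>x. x \<in> \<Omega> \<Longrightarrow> norm x \<le> r"
    using bounded_region unfolding bounded_pos by blast
  then have r: "\<Omega> \<subseteq> cball 0 r" "r \<ge> 0" by auto
  define S where "S = cball (0::plane) (r + norm z)"
  have S: "compact S" by (simp add: S_def)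
  obtain B where B: "\<And>x. x \<in> S \<Longrightarrow> \<bar>f x\<bar> \<le> B"
    using compact_imp_bounded[OF compact_continuous_image[OF continuous_on_subset[OF f] S]]
    by (auto simp: bounded_iff)
  have B0: "B \<ge> 0" using B[of 0] r by (simp add: S_def)
  have sub: "x \<in> S" "x - z \<in> S" if "x \<in> \<Omega>" for x
    using that r norm_triangle_ineq4[of x z] by (auto simp: S_def subset_iff intro: order_trans add_mono)
  have i: "integrable lborel (\<lambda>x. indicator \<Omega> (x + w) * f x)" if "w = 0 \<or> w = z" for w
  proof (rule integrable_bounded_support[where A = S and B = B])
    have "x \<in> S" if "x + w \<in> \<Omega>" for x
      using sub[OF that] \<open>w = 0 \<or> w = z\<close> by auto
    then show "\<bar>indicator \<Omega> (x + w) * f x\<bar> \<le> B" "x \<notin> S \<Longrightarrow> indicator \<Omega> (x + w) * f x = 0" for x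
      using B B0 by (auto split: split_indicator)
  qed (use emeasure_compact_finite[OF S] in \<open>auto simp: S_def\<close>)
  note i0 = i[of 0, simplified] and iz = i[of z, simplified]
  have it: "integrable lborel (\<lambda>x. indicator \<Omega> x * f (x - z))"
  proof (rule integrable_bounded_support[where A = S and B = B])
    show "\<bar>indicator \<Omega> x * f (x - z)\<bar> \<le> B" "x \<notin> S \<Longrightarrow> indicator \<Omega> x * f (x - z) = 0" for x
      using B[OF sub(2)] B0 sub by (auto split: split_indicator)
  qed (use emeasure_compact_finite[OF S] in \<open>auto simp: S_def\<close>)
  show "integrable lborel (\<lambda>x. (indicator \<Omega> x - indicator \<Omega> (x + z)) * f x)"
    using Bochner_Integration.integrable_diff[OF i0 iz] by (simp add: left_diff_distrib)
  have "(\<integral>x. (indicator \<Omega> x - indicator \<Omega> (x + z)) * f x \<partial>lborel)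
      = (\<integral>x. indicator \<Omega> x * f x \<partial>lborel) - (\<integral>x. indicator \<Omega> (x + z) * f x \<partial>lborel)"
    using Bochner_Integration.integral_diff[OF i0 iz] by (simp add: left_diff_distrib)
  also have "(\<integral>x. indicator \<Omega> (x + z) * f x \<partial>lborel) = (\<integral>x. indicator \<Omega> x * f (x - z) \<partial>lborel)"
    using integral_lborel_translate[of "\<lambda>x. indicator \<Omega> x * f (x - z)" z] by simp
  also have "(\<integral>x. indicator \<Omega> x * f x \<partial>lborel) - (\<integral>x. indicator \<Omega> x * f (x - z) \<partial>lborel)
      = (\<integral>x. indicator \<Omega> x * (f x - f (x - z)) \<partial>lborel)"
    using Bochner_Integration.integral_diff[OF i0 it] by (simp add: right_diff_distrib)
  finally show "(\<integral>x. (indicator \<Omega> x - indicator \<Omega> (x + z)) * f x \<partial>lborel)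
       = (\<integral>x. indicator \<Omega> x * (f x - f (x - z)) \<partial>lborel)" .
qed

lemma integral_region_eq:
  fixes f :: "plane \<Rightarrow> real"
  assumes f: "continuous_on UNIV f"
  shows "integrable lborel (\<lambda>x. indicator \<Omega> x * f x)"
    and "(\<integral>x. indicator \<Omega> x * f x \<partial>lborel) = integral \<Omega> f"
proof -
  have "integrable lborel (\<lambda>x. indicator (closure \<Omega>) x *\<^sub>R f x)"
    by (rule borel_integrable_compact)
       (use bounded_region continuous_on_subset[OF f] in \<open>auto simp: compact_closure\<close>)
  then have "set_integrable lborel (closure \<Omega>) f" by (simp add: set_integrable_def)
  then have s: "set_integrable lborel \<Omega> f"
    by (rule set_integrable_subset) (auto simp: closure_subset)
  then show "integrable lborel (\<lambda>x. indicator \<Omega> x * f x)" by (simp add: set_integrable_def)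
  show "(\<integral>x. indicator \<Omega> x * f x \<partial>lborel) = integral \<Omega> f"
    using set_borel_integral_eq_integral(2)[OF s] by (simp add: set_lebesgue_integral_def)
qed

text \<open>The integral of \<open>\<Phi>\<close> is half the integral of its symmetrization. By hypothesis the latter is close to the
  integral of \<open>(indicator \<Omega> x - indicator \<Omega> (x + z)) * (F x \<bullet> z)\<close>, with an error of order \<open>(norm z)\<^sup>2\<close> on the
  tube of width \<open>\<delta>\<close>. As the tube has area \<open>O(\<delta>)\<close> and the second moment of \<open>\<mu>\<close> does not depend on \<open>\<delta>\<close>, that
  error contributes \<open>O(\<delta>)\<close>.

  For fixed \<open>z\<close>, the integral over \<open>x\<close> is, up to third order in \<open>z\<close>, the quadratic form of the
  integrated Jacobian matrix of \<open>F\<close> over \<open>\<Omega>\<close> (by \<open>translation_estimate\<close>). Integrating it against \<open>\<mu>\<close> leaves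
  \<open>2 \<sigma>\<close> times the trace, and the integral of the divergence is a boundary integral by \<open>gauss_green\<close>.\<close>

theorem double_integral_estimate:
  fixes \<Phi> :: "plane \<Rightarrow> plane \<Rightarrow> real" and F :: "plane \<Rightarrow> plane"
  assumes \<delta>: "0 < \<delta>" "\<delta> \<le> 1"
    and C: "\<And>r. 0 < r \<Longrightarrow> r \<le> 1 \<Longrightarrow> measure lborel (tube r) \<le> C * r"
    and F: "\<And>i. has_C1_gradient UNIV (\<lambda>x. F x $ i) (G i)"
    and M: "\<And>i x. infdist x \<Omega> \<le> 1 \<Longrightarrow> norm (G i x) \<le> M"
    and m [measurable]: "(\<lambda>(x, z). \<Phi> x z) \<in> borel_measurable (borel \<Otimes>\<^sub>M borel)"
    and B: "\<And>x z. \<bar>\<Phi> x z\<bar> \<le> B" and R: "\<And>x z. \<Phi> x z \<noteq> 0 \<Longrightarrow> norm x \<le> R \<and> norm z < \<delta>"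
    and K: "K \<ge> 0"
    and close: "\<And>x z. norm z < \<delta> \<Longrightarrow>
      \<bar>\<Phi> x z + \<Phi> (x + z) (- z) - (indicator \<Omega> x - indicator \<Omega> (x + z)) * (F x \<bullet> z)\<bar>
        \<le> K * (indicator (tube \<delta>) x * (norm z)\<^sup>2)"
  shows "\<bar>(\<integral>x. (\<integral>z. \<Phi> x z \<partial>\<mu>) \<partial>lborel) - \<sigma> * (orient * integral {0..1} (\<lambda>t. F (c t) \<bullet> rot (c' t)))\<bar>
           \<le> (2 * K * C + 4 * M * C) * \<sigma> * \<delta>"
proof -
  let ?P = "lborel \<Otimes>\<^sub>M \<mu>"
  have Fc: "continuous_on UNIV (\<lambda>x. F x $ i)" for i using F[of i] by (rule has_C1_gradient_continuous)
  have Gc: "continuous_on UNIV (G i)" for i using F[of i] by (simp add: has_C1_gradient_def)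
  have [measurable]: "(\<lambda>x. F x $ i) \<in> borel_measurable borel" for i
    using Fc by (rule borel_measurable_continuous_onI)
  let ?\<Theta> = "\<lambda>x z. indicator (ball 0 \<delta>) z * ((indicator \<Omega> x - indicator \<Omega> (x + z)) * (F x \<bullet> z))"
  let ?q = "\<lambda>z::plane. indicator (ball 0 \<delta>) z * (norm z)\<^sup>2"
  have iP: "integrable ?P (\<lambda>(x, z). \<Phi> x z)"
    by (rule integrable_pair[where B = B and R = R]) (use B R m in auto)
  have iP': "integrable ?P (\<lambda>(x, z). \<Phi> (x + z) (- z))"
  proof (rule integrable_pair[where B = B and R = "R + \<delta>"])
    show "norm x \<le> R + \<delta>" if "\<Phi> (x + z) (- z) \<noteq> 0" for x z
      using R[OF that] norm_triangle_sub[of x "x + z"] by simp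
  qed (use B in measurable)
  have tub: "x \<in> tube \<delta>" if "indicator \<Omega> (x + z) \<noteq> (indicator \<Omega> x :: real)" "norm z < \<delta>" for x z
    using shift_in_tube[OF that(1)] that(2) by (auto simp: tube_def)
  obtain R' where R': "\<And>x. x \<in> tube \<delta> \<Longrightarrow> norm x \<le> R'"
    using bounded_tube[of \<delta>] by (auto simp: bounded_iff)
  have FN: "continuous_on UNIV F"
  proof -
    have eq: "F = (\<lambda>x. vector [F x $ 1, F x $ 2])" by (intro ext) (simp add: plane_eq_iff)
    show ?thesis by (subst eq) (rule continuous_on_vector2[OF Fc[of 1] Fc[of 2]])
  qed
  obtain B' where B': "\<And>x. x \<in> tube \<delta> \<Longrightarrow> norm (F x) \<le> B'"
    using compact_imp_bounded[OF compact_continuous_image[OF continuous_on_subset[OF FN] compact_tube[of \<delta>]]]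
    by (auto simp: bounded_iff)
  have i\<Theta>: "integrable ?P (\<lambda>(x, z). ?\<Theta> x z)"
  proof (rule integrable_pair[where B = "\<bar>B'\<bar> * \<delta>" and R = R'])
    show "(\<lambda>(x, z). ?\<Theta> x z) \<in> borel_measurable (borel \<Otimes>\<^sub>M borel)"
    proof -
      have [measurable]: "F \<in> borel_measurable borel" using FN by (rule borel_measurable_continuous_onI)
      show ?thesis by measurable
    qed
    show "norm x \<le> R'" if "?\<Theta> x z \<noteq> 0" for x z
      by (rule R', rule tub[of x z]) (use that in \<open>auto simp: indicator_def split: if_splits\<close>)
    show "\<bar>?\<Theta> x z\<bar> \<le> \<bar>B'\<bar> * \<delta>" for x z
    proof (cases "?\<Theta> x z = 0")
      case True
      then show ?thesis using \<delta> by (simp only:) simp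
    next
      case False
      then have z: "norm z < \<delta>" and t: "x \<in> tube \<delta>"
        using tub[of x z] by (auto simp: indicator_def split: if_splits)
      have "\<bar>F x \<bullet> z\<bar> \<le> norm (F x) * norm z" by (rule Cauchy_Schwarz_ineq2)
      also have "\<dots> \<le> \<bar>B'\<bar> * \<delta>" using B'[OF t] z by (intro mult_mono) auto
      finally show ?thesis by (auto simp: abs_mult split: split_indicator)
    qed
  qed
  let ?J = "\<lambda>\<Psi>. integral\<^sup>L ?P (\<lambda>(x, z). \<Psi> x z)"
  \<comment> \<open>The two integrands differ to second order in \<open>z\<close> only on the tube, whose area supplies the factor \<open>\<delta>\<close>\<close>
  have step1: "\<bar>2 * ?J \<Phi> - ?J ?\<Theta>\<bar> \<le> 4 * K * C * \<sigma> * \<delta>"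
  proof -
    let ?b = "\<lambda>x z. K * (indicator (tube \<delta>) x * ?q z)"
    have ib: "integrable ?P (\<lambda>(x, z). ?b x z)"
    proof (rule integrable_pair[where B = "K * \<delta>\<^sup>2" and R = R'])
      show "\<bar>?b x z\<bar> \<le> K * \<delta>\<^sup>2" for x z
        using K by (auto split: split_indicator simp: abs_mult intro!: mult_left_mono power_mono)
      show "norm x \<le> R'" if "?b x z \<noteq> 0" for x z
        using that R'[of x] by (auto split: split_indicator_asm)
    qed measurable
    let ?d = "\<lambda>x z. \<Phi> x z + \<Phi> (x + z) (- z) - ?\<Theta> x z"
    have id: "integrable ?P (\<lambda>(x, z). ?d x z)"
      using Bochner_Integration.integrable_diff[OF Bochner_Integration.integrable_add[OF iP iP'] i\<Theta>]
      by (simp add: case_prod_unfold)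
    have dle: "\<bar>?d x z\<bar> \<le> ?b x z" for x z
    proof (cases "norm z < \<delta>")
      case True then show ?thesis using close[OF True, of x] by simp
    next
      case False
      then have "\<Phi> x z = 0" "\<Phi> (x + z) (- z) = 0" using R[of x z] R[of "x + z" "- z"] by auto
      then show ?thesis using False K by simp
    qed
    have "2 * ?J \<Phi> - ?J ?\<Theta> = ?J \<Phi> + ?J (\<lambda>x z. \<Phi> (x + z) (- z)) - ?J ?\<Theta>"
      using integral_pair_reflect[OF m iP iP'] by simp
    also have "\<dots> = ?J ?d"
      using Bochner_Integration.integral_diff[OF Bochner_Integration.integrable_add[OF iP iP'] i\<Theta>]
        Bochner_Integration.integral_add[OF iP iP']
      by (simp add: case_prod_unfold)
    finally have "\<bar>2 * ?J \<Phi> - ?J ?\<Theta>\<bar> = \<bar>?J ?d\<bar>" by simp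
    also have "\<dots> \<le> (\<integral>p. \<bar>case p of (x, z) \<Rightarrow> ?d x z\<bar> \<partial>?P)" by (rule integral_abs_bound)
    also have "\<dots> \<le> ?J ?b"
      by (rule integral_mono[OF integrable_abs[OF id] ib]) (use dle in \<open>auto split: prod.split\<close>)
    also have "\<dots> = (\<integral>z. (\<integral>x. ?b x z \<partial>lborel) \<partial>\<mu>)" by (rule pair.integral_snd[OF ib, symmetric])
    also have "\<dots> = (\<integral>z. K * measure lborel (tube \<delta>) * ?q z \<partial>\<mu>)"
      using emeasure_tube[of \<delta>] by (simp add: mult.assoc)
    also have "\<dots> = K * measure lborel (tube \<delta>) * (4 * \<sigma>)"
      by (simp only: integral_mult_right_zero integral_truncated_square)
    also have "\<dots> \<le> K * (C * \<delta>) * (4 * \<sigma>)"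
    proof -
      have "0 \<le> 4 * \<sigma>" unfolding integral_truncated_square(2)[symmetric] by (rule integral_nonneg_AE) auto
      then show ?thesis using C[OF \<delta>] K by (intro mult_right_mono mult_left_mono) auto
    qed
    finally show ?thesis by (simp add: algebra_simps)
  qed
  let ?D = "\<lambda>i j. \<integral>x. indicator \<Omega> x * G i x $ j \<partial>lborel"
  let ?h = "\<lambda>z. \<integral>x. ?\<Theta> x z \<partial>lborel"
  let ?h' = "\<lambda>z. (z $ 1 * z $ 1) * ?D 1 1 + (z $ 1 * z $ 2) * (?D 1 2 + ?D 2 1) + (z $ 2 * z $ 2) * ?D 2 2"
  \<comment> \<open>Third order in \<open>z\<close>, of which one factor is bounded by \<open>\<delta>\<close> and the other two by the second moment\<close>
  have hh': "\<bar>?h z - ?h' z\<bar> \<le> 2 * M * C * \<delta> * ?q z" if z: "norm z < \<delta>" for z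
  proof -
    let ?I = "\<lambda>i. \<integral>x. (indicator \<Omega> x - indicator \<Omega> (x + z)) * F x $ i \<partial>lborel"
    let ?E = "\<lambda>i. \<integral>x. indicator \<Omega> x * (G i x \<bullet> z) \<partial>lborel"
    have h: "?h z = z $ 1 * ?I 1 + z $ 2 * ?I 2"
    proof -
      have "?h z = (\<integral>x. z $ 1 * ((indicator \<Omega> x - indicator \<Omega> (x + z)) * F x $ 1)
                 + z $ 2 * ((indicator \<Omega> x - indicator \<Omega> (x + z)) * F x $ 2) \<partial>lborel)"
        using z by (intro Bochner_Integration.integral_cong) (auto simp: inner_plane algebra_simps)
      also have "\<dots> = z $ 1 * ?I 1 + z $ 2 * ?I 2"
        using integral_region_difference(2)[OF Fc, of z 1] integral_region_difference(2)[OF Fc, of z 2]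
        by (subst Bochner_Integration.integral_add) auto
      finally show ?thesis .
    qed
    have E: "?E i = z $ 1 * ?D i 1 + z $ 2 * ?D i 2" for i
    proof -
      have "integrable lborel (\<lambda>x. indicator \<Omega> x * G i x $ j)" for j
        by (rule integral_region_eq) (intro continuous_intros Gc)
      note this[of 1] this[of 2]
      moreover have "?E i = (\<integral>x. z $ 1 * (indicator \<Omega> x * G i x $ 1) + z $ 2 * (indicator \<Omega> x * G i x $ 2) \<partial>lborel)"
        by (intro Bochner_Integration.integral_cong) (auto simp: inner_plane algebra_simps)
      ultimately show ?thesis
        by (subst (asm) Bochner_Integration.integral_add) auto
    qed
    have est: "\<bar>?I i - ?E i\<bar> \<le> M * C * (norm z)\<^sup>2" for i
      unfolding integral_region_difference(1)[OF Fc]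
      by (rule translation_estimate[OF F M C]) (use z \<delta> in auto)
    have "?h z - ?h' z = z $ 1 * (?I 1 - ?E 1) + z $ 2 * (?I 2 - ?E 2)"
      unfolding h E by (simp add: algebra_simps)
    then have "\<bar>?h z - ?h' z\<bar> = \<bar>z $ 1 * (?I 1 - ?E 1) + z $ 2 * (?I 2 - ?E 2)\<bar>" by (rule arg_cong)
    also have "\<dots> \<le> \<bar>z $ 1\<bar> * \<bar>?I 1 - ?E 1\<bar> + \<bar>z $ 2\<bar> * \<bar>?I 2 - ?E 2\<bar>"
      by (rule order_trans[OF abs_triangle_ineq]) (simp add: abs_mult)
    also have "\<dots> \<le> \<delta> * (M * C * (norm z)\<^sup>2) + \<delta> * (M * C * (norm z)\<^sup>2)"
    proof -
      have "\<bar>z $ i\<bar> \<le> \<delta>" for i using component_le_norm_cart[of z i] z by linarith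
      then show ?thesis using \<delta>(1) by (intro add_mono mult_mono est) simp_all
    qed
    also have "\<dots> = 2 * M * C * \<delta> * ?q z" using z by simp
    finally show ?thesis .
  qed
  have ih: "integrable \<mu> ?h" using pair.integrable_snd[OF i\<Theta>] by simp
  have ih': "integrable \<mu> ?h'"
    by (intro Bochner_Integration.integrable_add integrable_mult_left integrable_monomial)
  have "?J ?\<Theta> = (\<integral>z. ?h z \<partial>\<mu>)" by (rule pair.integral_snd[OF i\<Theta>, symmetric])
  moreover have inth': "(\<integral>z. ?h' z \<partial>\<mu>) = 2 * \<sigma> * (?D 1 1 + ?D 2 2)"
  proof -
    note im = integrable_mult_left[OF integrable_monomial]
    have "(\<integral>z. ?h' z \<partial>\<mu>) = (\<integral>z. z $ 1 * z $ 1 \<partial>\<mu>) * ?D 1 1 + (\<integral>z. z $ 1 * z $ 2 \<partial>\<mu>) * (?D 1 2 + ?D 2 1)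
        + (\<integral>z. z $ 2 * z $ 2 \<partial>\<mu>) * ?D 2 2"
      by (simp only: Bochner_Integration.integral_add[OF Bochner_Integration.integrable_add[OF im im] im]
        Bochner_Integration.integral_add[OF im im] integral_mult_left_zero)
    then show ?thesis by (simp add: moments algebra_simps)
  qed
  moreover have "\<bar>(\<integral>z. ?h z \<partial>\<mu>) - (\<integral>z. ?h' z \<partial>\<mu>)\<bar> \<le> 2 * M * C * \<delta> * (4 * \<sigma>)"
  proof -
    have "\<bar>(\<integral>z. ?h z \<partial>\<mu>) - (\<integral>z. ?h' z \<partial>\<mu>)\<bar> = \<bar>\<integral>z. ?h z - ?h' z \<partial>\<mu>\<bar>"
      by (simp only: Bochner_Integration.integral_diff[OF ih ih'])
    also have "\<dots> \<le> (\<integral>z. \<bar>?h z - ?h' z\<bar> \<partial>\<mu>)" by (rule integral_abs_bound)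
    also have "\<dots> \<le> (\<integral>z. 2 * M * C * \<delta> * ?q z \<partial>\<mu>)"
    proof (rule integral_mono_AE)
      show "AE z in \<mu>. \<bar>?h z - ?h' z\<bar> \<le> 2 * M * C * \<delta> * ?q z"
        using support by eventually_elim (rule hh')
    qed (intro integrable_abs Bochner_Integration.integrable_diff ih ih' integrable_mult_right integral_truncated_square)+
    also have "\<dots> = 2 * M * C * \<delta> * (4 * \<sigma>)"
      by (simp only: integral_mult_right_zero integral_truncated_square)
    finally show ?thesis .
  qed
  moreover have "?D 1 1 + ?D 2 2 = orient * integral {0..1} (\<lambda>t. F (c t) \<bullet> rot (c' t))"
  proof -
    have D: "?D i i = orient * integral {0..1} (\<lambda>t. F (c t) $ i * (axis i 1 \<bullet> rot (c' t)))" for i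
    proof -
      have "?D i i = integral \<Omega> (\<lambda>x. G i x $ i)"
        by (rule integral_region_eq) (intro continuous_intros Gc)
      also have "\<dots> = integral \<Omega> (\<lambda>x. G i x \<bullet> axis i 1)" by (simp add: inner_axis)
      also have "\<dots> = orient * integral {0..1} (\<lambda>t. F (c t) $ i * (axis i 1 \<bullet> rot (c' t)))"
        by (rule gauss_green) (use F[of i] in \<open>auto simp: has_C1_gradient_def\<close>)
      finally show ?thesis .
    qed
    have ii: "(\<lambda>t. F (c t) $ i * (axis i 1 \<bullet> rot (c' t))) integrable_on {0..1}" for i
      by (intro integrable_continuous_interval continuous_intros continuous_on_compose2[OF Fc curve_continuous]
            boundary_cont) auto
    have "integral {0..1} (\<lambda>t. F (c t) \<bullet> rot (c' t))
       = integral {0..1} (\<lambda>t. F (c t) $ 1 * (axis 1 1 \<bullet> rot (c' t)) + F (c t) $ 2 * (axis 2 1 \<bullet> rot (c' t)))"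
      by (simp add: inner_plane inner_axis' axis_def)
    also have "\<dots> = integral {0..1} (\<lambda>t. F (c t) $ 1 * (axis 1 1 \<bullet> rot (c' t))) + integral {0..1} (\<lambda>t. F (c t) $ 2 * (axis 2 1 \<bullet> rot (c' t)))"
      by (rule Henstock_Kurzweil_Integration.integral_add[OF ii ii])
    finally show ?thesis by (simp add: D algebra_simps)
  qed
  moreover have "(\<integral>x. (\<integral>z. \<Phi> x z \<partial>\<mu>) \<partial>lborel) = ?J \<Phi>"
    by (rule pair.integral_fst[OF iP])
  ultimately show ?thesis using step1 by (simp add: algebra_simps abs_le_iff)
qed

end

section \<open>The nonlocal Neumann operators\<close>

lemma integral_lebesgue_eq_lborel_AE:
  fixes f h :: "'a::euclidean_space \<Rightarrow> real"
  assumes f: "f \<in> borel_measurable borel" and AE: "AE x in lebesgue. h x = f x"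
  shows "integral\<^sup>L lebesgue h = integral\<^sup>L lborel f"
proof -
  have fl: "f \<in> borel_measurable lebesgue" by (rule measurable_completion) (use f in simp)
  have "AE x in lebesgue. f x = h x" using AE by eventually_elim simp
  from borel_measurable_AE[OF fl this] have "integral\<^sup>L lebesgue h = integral\<^sup>L lebesgue f"
    using fl AE by (rule integral_cong_AE)
  also have "\<dots> = integral\<^sup>L lborel f" by (rule integral_completion) (use f in simp)
  finally show ?thesis .
qed

lemma nonlocal_operator_eq:
  assumes k [measurable]: "k \<in> borel_measurable borel" and k0: "\<And>r. k r \<ge> 0" and k\<delta>: "\<And>r. r \<ge> \<delta> \<Longrightarrow> k r = 0"
    and AEk: "AE y in lebesgue. kernel g \<delta> x y = k (norm (y - x))"
    and H: "AE y in lebesgue. y \<in> H \<longleftrightarrow> y \<in> H'" and [measurable]: "H' \<in> sets borel" "U \<in> borel_measurable borel"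
    and u: "\<And>y. y \<in> H' \<Longrightarrow> norm (y - x) < \<delta> \<Longrightarrow> u y = U y" "u x = U x"
  shows "(LINT y:H|lebesgue. (u x - u y) * kernel g \<delta> x y)
    = (\<integral>z. indicator (ball 0 \<delta>) z * (indicator H' (x + z) * (U x - U (x + z))) \<partial>density lborel (\<lambda>z. ennreal (k (norm z))))"
proof -
  let ?f = "\<lambda>y. k (norm (y - x)) * (indicator (ball 0 \<delta>) (y - x) * (indicator H' y * (U x - U y)))"
  have "(LINT y:H|lebesgue. (u x - u y) * kernel g \<delta> x y) = integral\<^sup>L lborel ?f"
    unfolding set_lebesgue_integral_def
  proof (rule integral_lebesgue_eq_lborel_AE)
    show "AE y in lebesgue. indicator H y *\<^sub>R ((u x - u y) * kernel g \<delta> x y) = ?f y"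
      using AEk H
    proof eventually_elim
      case (elim y)
      then show ?case using u(1)[of y] u(2) k\<delta>[of "norm (y - x)"]
        by (cases "norm (y - x) < \<delta>"; cases "y \<in> H'") auto
    qed
  qed measurable
  also have "\<dots> = (\<integral>z. ?f (z + x) \<partial>lborel)"
    by (rule integral_lborel_translate[symmetric]) measurable
  also have "\<dots> = (\<integral>z. indicator (ball 0 \<delta>) z * (indicator H' (x + z) * (U x - U (x + z))) \<partial>density lborel (\<lambda>z. ennreal (k (norm z))))"
    by (subst integral_density) (auto simp: k0 add.commute)
  finally show ?thesis .
qed

context convex_C1_region
begin

lemma inner_layer_borel [measurable]: "inner_layer \<Omega> \<delta> \<in> sets borel"
  and outer_region_borel [measurable]: "outer_region \<Omega> \<delta> \<in> sets borel"
  by (auto simp: inner_layer_def outer_region_def)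

lemma inner_layer_subset: "inner_layer \<Omega> \<delta> \<subseteq> \<Omega>"
  by (auto simp: inner_layer_def)

text \<open>Membership in the layers is determined by single pairs of points: a pair at distance less than \<open>\<delta>\<close> that
  straddles the boundary puts its inner point into the inner layer and its outer point into the outer region.
  For such pairs the domains of integration impose no condition beyond \<open>x \<in> \<Omega>\<close> and \<open>x + z \<notin> \<Omega>\<close>, or conversely.\<close>

lemma inner_layerI:
  assumes "x \<in> \<Omega>" "y \<notin> \<Omega>" "dist x y < \<delta>"
  shows "x \<in> inner_layer \<Omega> \<delta>"
proof -
  have "x \<notin> closure (inner_region \<Omega> \<delta>)"
  proof
    assume "x \<in> closure (inner_region \<Omega> \<delta>)"
    then obtain w where w: "w \<in> inner_region \<Omega> \<delta>" "dist w x < \<delta> - dist x y"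
      using assms(3) by (meson closure_approachable diff_gt_0_iff_gt)
    then have "dist w y < \<delta>" using dist_triangle[of w y x] by linarith
    then show False using w(1) assms(2) by (auto simp: inner_region_def)
  qed
  then show ?thesis using assms(1) by (simp add: inner_layer_def)
qed

lemma outer_regionI:
  assumes "y \<in> \<Omega>" "dist x y < \<delta>"
  shows "x \<in> outer_region \<Omega> \<delta>"
proof -
  have "x \<notin> closure {x. ball x \<delta> \<inter> \<Omega> = {}}"
  proof
    assume "x \<in> closure {x. ball x \<delta> \<inter> \<Omega> = {}}"
    then obtain w where w: "ball w \<delta> \<inter> \<Omega> = {}" "dist w x < \<delta> - dist x y"
      using assms(2) by (metis (mono_tags, lifting) closure_approachable diff_gt_0_iff_gt mem_Collect_eq)
    then have "dist w y < \<delta>" using dist_triangle[of w y x] by linarith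
    then show False using w(1) assms(1) by auto
  qed
  then show ?thesis by (simp add: outer_region_def)
qed

lemma inner_layer_tube: "inner_layer \<Omega> \<delta> \<subseteq> tube \<delta>"
proof
  fix x assume x: "x \<in> inner_layer \<Omega> \<delta>"
  then have "x \<in> \<Omega>" "x \<notin> inner_region \<Omega> \<delta>"
    using closure_subset by (auto simp: inner_layer_def)
  then obtain y where "y \<in> ball x \<delta>" "y \<notin> \<Omega>" unfolding inner_region_def by blast
  then have "y \<notin> \<Omega>" "dist x y < \<delta>" by auto
  then show "x \<in> tube \<delta>" using crossing_near_frontier(1)[OF \<open>x \<in> \<Omega>\<close>] by (force simp: tube_def)
qed

lemma outer_region_tube: "outer_region \<Omega> \<delta> - \<Omega> \<subseteq> tube \<delta>"
proof
  fix x assume x: "x \<in> outer_region \<Omega> \<delta> - \<Omega>"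
  then have "ball x \<delta> \<inter> \<Omega> \<noteq> {}"
    using closure_subset[of "{x. ball x \<delta> \<inter> \<Omega> = {}}"] by (auto simp: outer_region_def)
  then obtain y where "y \<in> \<Omega>" "dist y x < \<delta>" by (auto simp: dist_commute)
  then show "x \<in> tube \<delta>" using crossing_near_frontier(2)[of y x] x by (force simp: tube_def)
qed

text \<open>The boundary of a convex set is null, so closures and boundaries can be ignored under integrals.\<close>

lemma AE_outer_layer: "AE x in lebesgue. x \<in> outer_layer \<Omega> \<delta> \<longleftrightarrow> x \<in> outer_region \<Omega> \<delta> - \<Omega>"
proof -
  have "frontier \<Omega> \<in> null_sets lebesgue"
    using negligible_convex_frontier[OF convex_region] by (simp add: negligible_iff_null_sets)
  then have "AE x in lebesgue. x \<notin> frontier \<Omega>" by (rule AE_not_in)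
  then show ?thesis
  proof eventually_elim
    case (elim x)
    then show ?case using closure_subset[of \<Omega>] open_region
      by (auto simp: outer_layer_def frontier_def interior_open)
  qed
qed

end

context layer_problem
begin

text \<open>The common form of the three operators paired with \<open>V\<close>: \<open>G\<close> is the layer where the operator is
  evaluated, \<open>H\<close> the set over which it integrates, and \<open>s\<close> its sign. The truncation by \<open>ball 0 \<delta>\<close>
  is invisible to \<open>\<mu>\<close> and keeps all the points where the integrand lives close to the boundary.\<close>

definition layer_integrand ::
  "real \<Rightarrow> plane set \<Rightarrow> plane set \<Rightarrow> (plane \<Rightarrow> real) \<Rightarrow> (plane \<Rightarrow> real) \<Rightarrow> plane \<Rightarrow> plane \<Rightarrow> real" where
  "layer_integrand s G H U V x z =
     indicator (ball 0 \<delta>) z * (indicator G x * (indicator H (x + z) * (s * V x * (U x - U (x + z)))))"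

lemma layer_integrand_measurable:
  assumes [measurable]: "G \<in> sets borel" "H \<in> sets borel" "U \<in> borel_measurable borel" "V \<in> borel_measurable borel"
  shows "(\<lambda>(x, z). layer_integrand s G H U V x z) \<in> borel_measurable (borel \<Otimes>\<^sub>M borel)"
  unfolding layer_integrand_def by measurable

lemma inner_on_eq_double_integral:
  assumes [measurable]: "G' \<in> sets borel" "H' \<in> sets borel" "U \<in> borel_measurable borel" "V \<in> borel_measurable borel"
    and G: "AE x in lebesgue. x \<in> G \<longleftrightarrow> x \<in> G'"
    and v: "\<And>x. x \<in> G' \<Longrightarrow> v x = V x"
    and w: "\<And>x. x \<in> G' \<Longrightarrow> w x = s * (\<integral>z. indicator (ball 0 \<delta>) z * (indicator H' (x + z) * (U x - U (x + z))) \<partial>\<mu>)"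
  shows "inner_on G w v = (\<integral>x. (\<integral>z. layer_integrand s G' H' U V x z \<partial>\<mu>) \<partial>lborel)"
  unfolding inner_on_def set_lebesgue_integral_def
proof (rule integral_lebesgue_eq_lborel_AE)
  have "(\<lambda>(x, z). layer_integrand s G' H' U V x z) \<in> borel_measurable (borel \<Otimes>\<^sub>M \<mu>)"
    using layer_integrand_measurable[of G' H' U V s]
    by (simp cong: measurable_cong_sets sets_pair_measure_cong add: sets_eq)
  then show "(\<lambda>x. \<integral>z. layer_integrand s G' H' U V x z \<partial>\<mu>) \<in> borel_measurable borel"
    by (rule borel_measurable_lebesgue_integral)
  show "AE x in lebesgue. indicator G x *\<^sub>R (w x * v x) = (\<integral>z. layer_integrand s G' H' U V x z \<partial>\<mu>)"
    using G
  proof eventually_elim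
    case (elim x)
    have "layer_integrand s G' H' U V x z = (indicator G' x * (s * V x)) *
        (indicator (ball 0 \<delta>) z * (indicator H' (x + z) * (U x - U (x + z))))" for z
      by (simp add: layer_integrand_def mult_ac)
    then have "(\<integral>z. layer_integrand s G' H' U V x z \<partial>\<mu>) = (indicator G' x * (s * V x)) *
        (\<integral>z. indicator (ball 0 \<delta>) z * (indicator H' (x + z) * (U x - U (x + z))) \<partial>\<mu>)"
      by (simp only: integral_mult_right_zero)
    then show ?case using elim v[of x] w[of x] by (cases "x \<in> G'") auto
  qed
qed

text \<open>Here \<open>a\<close>, \<open>b\<close> are the values of \<open>v\<close> at the two points of a pair, \<open>e\<close> the increment of \<open>u\<close>, \<open>t\<close> its linear part, and
  \<open>d\<close> the distance.\<close>

lemma product_errors: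
  fixes L d t a b e :: real
  assumes L: "L \<ge> 0" and a: "\<bar>a\<bar> \<le> L" and b: "\<bar>b - a\<bar> \<le> L * d" and d: "d \<ge> 0"
    and e: "\<bar>e\<bar> \<le> L * d" "\<bar>e - t\<bar> \<le> L * d\<^sup>2"
  shows "\<bar>a * e - a * t\<bar> \<le> L\<^sup>2 * d\<^sup>2" "\<bar>b * e - a * t\<bar> \<le> 2 * L\<^sup>2 * d\<^sup>2" "\<bar>(a - b) * - e\<bar> \<le> L\<^sup>2 * d\<^sup>2"
proof -
  have "\<bar>a * (e - t)\<bar> \<le> L * (L * d\<^sup>2)" unfolding abs_mult using a e L by (intro mult_mono) auto
  then show 1: "\<bar>a * e - a * t\<bar> \<le> L\<^sup>2 * d\<^sup>2" by (simp add: right_diff_distrib power2_eq_square mult_ac)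
  have "\<bar>(b - a) * e\<bar> \<le> (L * d) * (L * d)" unfolding abs_mult using b e L d by (intro mult_mono) auto
  then have 2: "\<bar>(b - a) * e\<bar> \<le> L\<^sup>2 * d\<^sup>2" by (simp add: power2_eq_square mult_ac)
  have "b * e - a * t = (b - a) * e + (a * e - a * t)" by (simp add: algebra_simps)
  then show "\<bar>b * e - a * t\<bar> \<le> 2 * L\<^sup>2 * d\<^sup>2" using 1 2 by linarith
  show "\<bar>(a - b) * - e\<bar> \<le> L\<^sup>2 * d\<^sup>2" using 2 by (simp add: left_diff_distrib)
qed

text \<open>A pair that straddles the boundary contributes, after symmetrization, the increment of \<open>U\<close> from the inner
  to the outer point times the value of \<open>V\<close> at one of the two points; which one depends on the operator, but
  the difference is of second order. A pair of outer points matters only for the third operator: its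
  symmetrization is the product of two increments.\<close>

lemma layer_integrand_symmetrized:
  fixes U V :: "plane \<Rightarrow> real" and p F :: "plane \<Rightarrow> plane"
  assumes L: "L \<ge> 0" and z: "norm z < \<delta>"
    and U1: "\<And>x w. x \<in> tube \<delta> \<Longrightarrow> norm w \<le> \<delta> \<Longrightarrow> \<bar>U (x + w) - U x\<bar> \<le> L * norm w"
    and U2: "\<And>x w. x \<in> tube \<delta> \<Longrightarrow> norm w \<le> \<delta> \<Longrightarrow> \<bar>U (x + w) - U x - p x \<bullet> w\<bar> \<le> L * (norm w)\<^sup>2"
    and V0: "\<And>x. x \<in> tube \<delta> \<Longrightarrow> \<bar>V x\<bar> \<le> L"
    and V1: "\<And>x w. x \<in> tube \<delta> \<Longrightarrow> norm w \<le> \<delta> \<Longrightarrow> \<bar>V (x + w) - V x\<bar> \<le> L * norm w"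
    and F: "\<And>x. x \<in> tube \<delta> \<Longrightarrow> F x = V x *\<^sub>R p x"
    and type: "(s, G, H) \<in> {(-1, inner_layer \<Omega> \<delta>, outer_region \<Omega> \<delta> - \<Omega>),
       (1, outer_region \<Omega> \<delta> - \<Omega>, inner_layer \<Omega> \<delta>), (1, outer_region \<Omega> \<delta> - \<Omega>, outer_region \<Omega> \<delta>)}"
  shows "\<bar>layer_integrand s G H U V x z + layer_integrand s G H U V (x + z) (- z)
      - (indicator \<Omega> x - indicator \<Omega> (x + z)) * (F x \<bullet> z)\<bar> \<le> 2 * L\<^sup>2 * (indicator (tube \<delta>) x * (norm z)\<^sup>2)"
proof -
  define y where "y = x + z"
  have yz: "y + - z = x" by (simp add: y_def)
  have d: "dist x y = norm z" by (simp add: y_def dist_norm)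
  have \<Phi>: "layer_integrand s G H U V x z = indicator G x * (indicator H y * (s * V x * (U x - U y)))"
    "layer_integrand s G H U V (x + z) (- z) = indicator G y * (indicator H x * (s * V y * (U y - U x)))"
    using z by (simp_all add: layer_integrand_def y_def)
  have err: "\<bar>V x * (U y - U x) - V x * (p x \<bullet> z)\<bar> \<le> L\<^sup>2 * (norm z)\<^sup>2"
     "\<bar>V y * (U y - U x) - V x * (p x \<bullet> z)\<bar> \<le> 2 * L\<^sup>2 * (norm z)\<^sup>2"
     "\<bar>(V x - V y) * (U x - U y)\<bar> \<le> L\<^sup>2 * (norm z)\<^sup>2" if x: "x \<in> tube \<delta>"
    using product_errors[of L "V x" "V y" "norm z" "U y - U x" "p x \<bullet> z"] L V0[OF x]
      V1[OF x, of z] U1[OF x, of z] U2[OF x, of z] z by (simp_all add: y_def)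
  have L2: "L\<^sup>2 * (norm z)\<^sup>2 \<ge> 0" by simp
  have Fz: "F x \<bullet> z = V x * (p x \<bullet> z)" if "x \<in> tube \<delta>" using F[OF that] by simp
  consider (in_in) "x \<in> \<Omega>" "y \<in> \<Omega>" | (in_out) "x \<in> \<Omega>" "y \<notin> \<Omega>" | (out_in) "x \<notin> \<Omega>" "y \<in> \<Omega>" | (out_out) "x \<notin> \<Omega>" "y \<notin> \<Omega>"
    by blast
  then show ?thesis
  proof cases
    case in_in
    have "layer_integrand s G H U V x z = 0" "layer_integrand s G H U V (x + z) (- z) = 0"
      unfolding \<Phi> using type in_in by auto
    then show ?thesis using in_in by (simp add: y_def)
  next
    case in_out
    have x: "x \<in> tube \<delta>" using crossing_near_frontier(1)[OF in_out] d z by (simp add: tube_def)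
    have mem: "x \<in> inner_layer \<Omega> \<delta>" "y \<in> outer_region \<Omega> \<delta>" "x \<in> outer_region \<Omega> \<delta>" "y \<notin> inner_layer \<Omega> \<delta>"
      using inner_layerI[OF in_out] outer_regionI[of x y] outer_regionI[of x x] in_out d z inner_layer_subset[of \<delta>, THEN subsetD, of y] norm_ge_zero[of z]
      by (auto simp: dist_commute simp del: norm_ge_zero)
    have "layer_integrand s G H U V x z + layer_integrand s G H U V (x + z) (- z) \<in> {V x * (U y - U x), V y * (U y - U x)}"
      unfolding \<Phi> using type in_out mem by (auto simp: algebra_simps)
    then show ?thesis using err[OF x] L2 x in_out Fz[OF x] by (auto simp: y_def)
  next
    case out_in
    have x: "x \<in> tube \<delta>" using crossing_near_frontier(2)[OF out_in(2,1)] d z by (simp add: tube_def dist_commute)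
    have mem: "y \<in> inner_layer \<Omega> \<delta>" "x \<in> outer_region \<Omega> \<delta>" "y \<in> outer_region \<Omega> \<delta>" "x \<notin> inner_layer \<Omega> \<delta>"
      using inner_layerI[OF out_in(2,1)] outer_regionI[of y x] outer_regionI[of y y] out_in d z inner_layer_subset[of \<delta>, THEN subsetD, of x] norm_ge_zero[of z]
      by (auto simp: dist_commute simp del: norm_ge_zero)
    have "layer_integrand s G H U V x z + layer_integrand s G H U V (x + z) (- z) \<in> {- (V x * (U y - U x)), - (V y * (U y - U x))}"
      unfolding \<Phi> using type out_in mem by (auto simp: algebra_simps)
    then show ?thesis using err[OF x] L2 x out_in Fz[OF x] by (auto simp: y_def)
  next
    case out_out
    have t: "x \<in> tube \<delta>" if "x \<in> outer_region \<Omega> \<delta>" using outer_region_tube that out_out by auto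
    have "layer_integrand s G H U V x z + layer_integrand s G H U V (x + z) (- z) = 0 \<or>
      x \<in> outer_region \<Omega> \<delta> \<and> layer_integrand s G H U V x z + layer_integrand s G H U V (x + z) (- z) = (V x - V y) * (U x - U y)"
      unfolding \<Phi> using type out_out inner_layer_subset by (auto simp: algebra_simps indicator_def)
    then show ?thesis using err(3) t L2 out_out by (auto simp: y_def)
  qed
qed

text \<open>The functions \<open>U\<close>, \<open>V\<close> are Borel measurable versions of \<open>u\<close>, \<open>v\<close>, which are arbitrary away from the
  boundary. The constants \<open>C\<close>, \<open>L\<close>, \<open>M\<close> can be
  chosen independently of the horizon, which turns the bound into \<open>O(\<delta>)\<close>.\<close>

lemma neumann_pairing_estimate:
  fixes U V :: "plane \<Rightarrow> real" and p F :: "plane \<Rightarrow> plane"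
  assumes \<delta>: "0 < \<delta>" "\<delta> \<le> 1"
    and C: "\<And>r. 0 < r \<Longrightarrow> r \<le> 1 \<Longrightarrow> measure lborel (tube r) \<le> C * r"
    and F1: "\<And>i. has_C1_gradient UNIV (\<lambda>x. F x $ i) (G i)"
    and M: "\<And>i x. infdist x \<Omega> \<le> 1 \<Longrightarrow> norm (G i x) \<le> M"
    and k [measurable]: "k \<in> borel_measurable borel" and k0: "\<And>r. k r \<ge> 0" and k\<delta>: "\<And>r. r \<ge> \<delta> \<Longrightarrow> k r = 0"
    and AEk: "\<And>x. AE y in lebesgue. kernel g \<delta> x y = k (norm (y - x))"
    and \<mu>: "\<mu> = density lborel (\<lambda>z. ennreal (k (norm z)))"
    and UV [measurable]: "U \<in> borel_measurable borel" "V \<in> borel_measurable borel"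
    and uU: "\<And>x w. x \<in> tube \<delta> \<Longrightarrow> norm w \<le> \<delta> \<Longrightarrow> u (x + w) = U (x + w)"
    and vV: "\<And>x. x \<in> tube \<delta> \<Longrightarrow> v x = V x"
    and L: "L \<ge> 0"
    and U1: "\<And>x w. x \<in> tube \<delta> \<Longrightarrow> norm w \<le> \<delta> \<Longrightarrow> \<bar>U (x + w) - U x\<bar> \<le> L * norm w"
    and U2: "\<And>x w. x \<in> tube \<delta> \<Longrightarrow> norm w \<le> \<delta> \<Longrightarrow> \<bar>U (x + w) - U x - p x \<bullet> w\<bar> \<le> L * (norm w)\<^sup>2"
    and V0: "\<And>x. x \<in> tube \<delta> \<Longrightarrow> \<bar>V x\<bar> \<le> L"
    and V1: "\<And>x w. x \<in> tube \<delta> \<Longrightarrow> norm w \<le> \<delta> \<Longrightarrow> \<bar>V (x + w) - V x\<bar> \<le> L * norm w"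
    and F: "\<And>x. x \<in> tube \<delta> \<Longrightarrow> F x = V x *\<^sub>R p x"
  shows "\<bar>inner_on (neumann_layer N \<Omega> \<delta>) (neumann N g \<Omega> \<delta> u) v
      - \<sigma> * (orient * integral {0..1} (\<lambda>t. F (c t) \<bullet> rot (c' t)))\<bar> \<le> (4 * L\<^sup>2 * C + 4 * M * C) * \<sigma> * \<delta>"
proof -
  define T where "T = {(-1::real, inner_layer \<Omega> \<delta>, outer_region \<Omega> \<delta> - \<Omega>),
       (1, outer_region \<Omega> \<delta> - \<Omega>, inner_layer \<Omega> \<delta>), (1, outer_region \<Omega> \<delta> - \<Omega>, outer_region \<Omega> \<delta>)}"
  have op: "(LINT y:H|lebesgue. (u x - u y) * kernel g \<delta> x y)
      = (\<integral>z. indicator (ball 0 \<delta>) z * (indicator H' (x + z) * (U x - U (x + z))) \<partial>\<mu>)"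
    if "AE y in lebesgue. y \<in> H \<longleftrightarrow> y \<in> H'" "H' \<in> sets borel" "x \<in> tube \<delta>" for x H H'
    unfolding \<mu>
  proof (rule nonlocal_operator_eq[OF k k0 k\<delta> AEk that(1,2) UV(1)])
    show "u y = U y" if "norm (y - x) < \<delta>" for y
      using uU[OF \<open>x \<in> tube \<delta>\<close>, of "y - x"] that by simp
    show "u x = U x" using uU[OF \<open>x \<in> tube \<delta>\<close>, of 0] \<delta> by simp
  qed
  obtain s H G' where T: "(s, G', H) \<in> T"
    and eq: "inner_on (neumann_layer N \<Omega> \<delta>) (neumann N g \<Omega> \<delta> u) v
       = (\<integral>x. (\<integral>z. layer_integrand s G' H U V x z \<partial>\<mu>) \<partial>lborel)"
  proof (cases N)
    case N_minus
    show thesis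
    proof (rule that[of "-1" "inner_layer \<Omega> \<delta>" "outer_region \<Omega> \<delta> - \<Omega>"])
      show "inner_on (neumann_layer N \<Omega> \<delta>) (neumann N g \<Omega> \<delta> u) v
       = (\<integral>x. (\<integral>z. layer_integrand (-1) (inner_layer \<Omega> \<delta>) (outer_region \<Omega> \<delta> - \<Omega>) U V x z \<partial>\<mu>) \<partial>lborel)"
        by (rule inner_on_eq_double_integral)
           (use inner_layer_tube[of \<delta>, THEN subsetD] op[OF AE_outer_layer] vV in \<open>auto simp: N_minus\<close>)
    qed (simp add: T_def)
  next
    case N_plus
    show thesis
    proof (rule that[of 1 "outer_region \<Omega> \<delta> - \<Omega>" "inner_layer \<Omega> \<delta>"])
      show "inner_on (neumann_layer N \<Omega> \<delta>) (neumann N g \<Omega> \<delta> u) v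
       = (\<integral>x. (\<integral>z. layer_integrand 1 (outer_region \<Omega> \<delta> - \<Omega>) (inner_layer \<Omega> \<delta>) U V x z \<partial>\<mu>) \<partial>lborel)"
        by (rule inner_on_eq_double_integral)
           (use outer_region_tube[of \<delta>, THEN subsetD] op[of "inner_layer \<Omega> \<delta>" "inner_layer \<Omega> \<delta>"] AE_outer_layer vV in \<open>auto simp: N_plus\<close>)
    qed (simp add: T_def)
  next
    case N_star
    show thesis
    proof (rule that[of 1 "outer_region \<Omega> \<delta> - \<Omega>" "outer_region \<Omega> \<delta>"])
      show "inner_on (neumann_layer N \<Omega> \<delta>) (neumann N g \<Omega> \<delta> u) v
       = (\<integral>x. (\<integral>z. layer_integrand 1 (outer_region \<Omega> \<delta> - \<Omega>) (outer_region \<Omega> \<delta>) U V x z \<partial>\<mu>) \<partial>lborel)"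
        by (rule inner_on_eq_double_integral)
           (use outer_region_tube[of \<delta>, THEN subsetD] op[of "outer_region \<Omega> \<delta>" "outer_region \<Omega> \<delta>"] AE_outer_layer vV in \<open>auto simp: N_star\<close>)
    qed (simp add: T_def)
  qed
  have G': "G' \<in> sets borel" "H \<in> sets borel" "G' \<subseteq> tube \<delta>" "\<bar>s\<bar> = 1"
    using T inner_layer_tube outer_region_tube by (auto simp: T_def)
  obtain R where R: "\<And>x. x \<in> tube \<delta> \<Longrightarrow> norm x \<le> R"
    using bounded_tube[of \<delta>] unfolding bounded_iff by blast
  have "\<bar>(\<integral>x. (\<integral>z. layer_integrand s G' H U V x z \<partial>\<mu>) \<partial>lborel)
      - \<sigma> * (orient * integral {0..1} (\<lambda>t. F (c t) \<bullet> rot (c' t)))\<bar> \<le> (2 * (2 * L\<^sup>2) * C + 4 * M * C) * \<sigma> * \<delta>"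
  proof (rule double_integral_estimate[OF \<delta> C F1 M])
    show "(\<lambda>(x, z). layer_integrand s G' H U V x z) \<in> borel_measurable (borel \<Otimes>\<^sub>M borel)"
      using G' UV by (intro layer_integrand_measurable)
    show "\<bar>layer_integrand s G' H U V x z\<bar> \<le> L * (L * \<delta>)" for x z
    proof (cases "x \<in> G' \<and> norm z < \<delta>")
      case True
      then have x: "x \<in> tube \<delta>" using G' by auto
      have "L * norm z \<le> L * \<delta>" using True L by (intro mult_left_mono) auto
      then have "\<bar>U x - U (x + z)\<bar> \<le> L * \<delta>" using U1[OF x, of z] True by (simp add: abs_minus_commute)
      then have "\<bar>V x * (U x - U (x + z))\<bar> \<le> L * (L * \<delta>)"
        unfolding abs_mult using V0[OF x] L by (intro mult_mono) auto
      then show ?thesis using G'(4) L \<delta> by (auto simp: layer_integrand_def abs_mult split: split_indicator)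
    next
      case False
      then show ?thesis using L \<delta> by (auto simp: layer_integrand_def)
    qed
    show "norm x \<le> R \<and> norm z < \<delta>" if "layer_integrand s G' H U V x z \<noteq> 0" for x z
      using that G' R[of x] by (auto simp: layer_integrand_def split: split_indicator_asm)
    show "\<bar>layer_integrand s G' H U V x z + layer_integrand s G' H U V (x + z) (- z)
        - (indicator \<Omega> x - indicator \<Omega> (x + z)) * (F x \<bullet> z)\<bar> \<le> 2 * L\<^sup>2 * (indicator (tube \<delta>) x * (norm z)\<^sup>2)"
      if "norm z < \<delta>" for x z
      by (rule layer_integrand_symmetrized[OF L that U1 U2 V0 V1 F T[unfolded T_def]])
  qed (use L in auto)
  then show ?thesis unfolding eq by simp
qed

end

lemma boundary_pairing_eq:
  assumes "convex_C1_region \<Omega> c c' x0"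
    and p: "\<And>x. x \<in> frontier \<Omega> \<Longrightarrow> (u has_derivative (\<lambda>h. p x \<bullet> h)) (at x)"
    and F: "\<And>x. x \<in> frontier \<Omega> \<Longrightarrow> F x = v x *\<^sub>R p x"
  shows "boundary_pairing c (\<lambda>q. \<sigma> * normal_derivative \<Omega> c u q) v
    = \<sigma> * (convex_C1_region.orient c c' x0 * integral {0..1} (\<lambda>t. F (c t) \<bullet> rot (c' t)))"
proof -
  interpret convex_C1_region \<Omega> c c' x0 by fact
  have pt: "(\<sigma> * normal_derivative \<Omega> c u (c t) * v (c t)) * norm (vector_derivative c (at t within {0..1}))
      = (\<sigma> * orient) * (F (c t) \<bullet> rot (c' t))" if t: "t \<in> {0..1}" for t
  proof -
    have ct: "c t \<in> frontier \<Omega>" using boundary t by auto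
    have "frechet_derivative u (at (c t)) = (\<lambda>h. p (c t) \<bullet> h)"
      using frechet_derivative_at[OF p[OF ct]] by simp
    then have "normal_derivative \<Omega> c u (c t) = (orient / norm (c' t)) * (p (c t) \<bullet> rot (c' t))"
      by (simp add: normal_derivative_def outward_normal_eq[OF t])
    moreover have "vector_derivative c (at t within {0..1}) = c' t"
      using vector_derivative_within_unit_interval[OF boundary_deriv[OF t] t] .
    ultimately show ?thesis using boundary_regular[OF t] by (simp add: F[OF ct])
  qed
  have "boundary_pairing c (\<lambda>q. \<sigma> * normal_derivative \<Omega> c u q) v
      = integral {0..1} (\<lambda>t. (\<sigma> * orient) * (F (c t) \<bullet> rot (c' t)))"
    unfolding boundary_pairing_def arc_length_integral_def
    by (rule Henstock_Kurzweil_Integration.integral_cong) (rule pt)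
  then show ?thesis by simp
qed

text \<open>Bounds the gradients on the points that \<open>translation_estimate\<close> can reach.\<close>

lemma bounded_near_region:
  fixes G :: "plane \<Rightarrow> plane"
  assumes "bounded S" "S \<noteq> {}" "continuous_on UNIV G"
  obtains M where "\<And>x. infdist x S \<le> 1 \<Longrightarrow> norm (G x) \<le> M"
proof -
  obtain r where r: "\<And>x. x \<in> S \<Longrightarrow> norm x \<le> r" using assms(1) unfolding bounded_iff by blast
  have near: "x \<in> cball 0 (r + 2)" if "infdist x S \<le> 1" for x
  proof -
    have "(INF a\<in>S. dist x a) < 2" using that assms(2) by (simp add: infdist_def)
    then obtain a where "a \<in> S" "dist x a < 2"
      using cInf_lessD[of "dist x ` S" 2] assms(2) by auto
    then show ?thesis using r[of a] norm_triangle_sub[of x a] by (simp add: dist_norm)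
  qed
  have "compact (G ` cball 0 (r + 2))"
    by (intro compact_continuous_image continuous_on_subset[OF assms(3)]) auto
  then have "bounded (G ` cball 0 (r + 2))" by (rule compact_imp_bounded)
  then obtain M where M: "\<forall>y\<in>G ` cball 0 (r + 2). norm y \<le> M" unfolding bounded_iff ..
  show thesis by (rule that[of M]) (use M near in blast)
qed

theorem theorem2p3:
  fixes g :: "real \<Rightarrow> real \<Rightarrow> real" and \<sigma> \<delta>\<^sub>0 :: real
    and \<Omega> :: "plane set" and c :: "real \<Rightarrow> plane"
    and u v :: "plane \<Rightarrow> real" and N :: neumann_type
  assumes kernel: "nonlocal_kernel g \<sigma>"
    and region: "open \<Omega>" "bounded \<Omega>" "convex \<Omega>"
    and curve: "closed_C2_curve c" "path_image c = frontier \<Omega>"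
    and layer: "\<delta>\<^sub>0 > 0"
    and u: "C2_on {x. infdist x (frontier \<Omega>) < \<delta>\<^sub>0} u"
    and v: "C1_on {x. infdist x (frontier \<Omega>) < \<delta>\<^sub>0} v"
    and S_N: "\<forall>\<^sub>F \<delta> in at_right 0. u \<in> S_N N g \<Omega> \<delta>"
  shows "(\<lambda>\<delta>. inner_on (neumann_layer N \<Omega> \<delta>) (neumann N g \<Omega> \<delta> u) v
              - boundary_pairing c (\<lambda>p. \<sigma> * normal_derivative \<Omega> c u p) v)
         \<in> O[at_right 0](\<lambda>\<delta>. \<delta>)"
proof -
  obtain c' c'' where c: "simple_path c" "pathfinish c = pathstart c"
    "\<And>t. t \<in> {0..1} \<Longrightarrow> (c has_vector_derivative c' t) (at t within {0..1})"
    "\<And>t. t \<in> {0..1} \<Longrightarrow> (c' has_vector_derivative c'' t) (at t within {0..1})"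
    "\<And>t. t \<in> {0..1} \<Longrightarrow> c' t \<noteq> 0" "c' 0 = c' 1"
    using curve(1) unfolding closed_C2_curve_def by blast
  have c'_cont: "continuous_on {0..1} c'"
    by (rule continuous_on_vector_derivative) (rule c(4))
  have "c 0 \<in> frontier \<Omega>" unfolding curve(2)[symmetric] path_image_def by simp
  then have "\<Omega> \<noteq> {}" by auto
  then obtain x0 where x0: "x0 \<in> \<Omega>" by blast
  have reg: "convex_C1_region \<Omega> c c' x0"
    by unfold_locales
      (use region x0 c c'_cont curve(2) in \<open>auto simp: path_image_def pathfinish_def pathstart_def\<close>)
  interpret convex_C1_region \<Omega> c c' x0 by (rule reg)
  obtain C where C: "\<And>r. 0 < r \<Longrightarrow> r \<le> 1 \<Longrightarrow> measure lborel (tube r) \<le> C * r"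
    using measure_tube by blast
  define \<eta> where "\<eta> = \<delta>\<^sub>0 / 4"
  have \<eta>: "\<eta> > 0" "\<delta>\<^sub>0 = 4 * \<eta>" using layer by (simp_all add: \<eta>_def)
  let ?K = "frontier \<Omega>"
  let ?W = "{x. infdist x ?K < 4 * \<eta>}"
  note K = compact_frontier_region frontier_nonempty
  obtain p H where p: "has_C1_gradient ?W u p" "\<And>i. has_C1_gradient ?W (\<lambda>x. p x $ i) (H i)"
    using u unfolding \<eta>(2) by (rule C2_on_gradient) (rule that)
  obtain Gv where Gv: "has_C1_gradient ?W v Gv" using v unfolding \<eta>(2) by (rule C1_on_gradient) (rule that)
  obtain Lu where Lu: "Lu \<ge> 0" "\<And>x. infdist x ?K \<le> 2 * \<eta> \<Longrightarrow> \<bar>u x\<bar> \<le> Lu"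
    "\<And>x w. infdist x ?K \<le> \<eta> \<Longrightarrow> norm w \<le> \<eta> \<Longrightarrow> \<bar>u (x + w) - u x\<bar> \<le> Lu * norm w"
    by (rule C1_lipschitz_near[OF K \<eta>(1) p(1)]) (rule that)
  obtain Lv where Lv: "Lv \<ge> 0" "\<And>x. infdist x ?K \<le> 2 * \<eta> \<Longrightarrow> \<bar>v x\<bar> \<le> Lv"
    "\<And>x w. infdist x ?K \<le> \<eta> \<Longrightarrow> norm w \<le> \<eta> \<Longrightarrow> \<bar>v (x + w) - v x\<bar> \<le> Lv * norm w"
    by (rule C1_lipschitz_near[OF K \<eta>(1) Gv]) (rule that)
  obtain Lt where Lt: "Lt \<ge> 0" "\<And>x w. infdist x ?K \<le> \<eta> \<Longrightarrow> norm w \<le> \<eta> \<Longrightarrow> \<bar>u (x + w) - u x - p x \<bullet> w\<bar> \<le> Lt * (norm w)\<^sup>2"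
    by (rule C2_taylor_near[OF K \<eta>(1) p]) (rule that)
  define L where "L = Lu + Lv + Lt"
  have L: "L \<ge> 0" "Lu \<le> L" "Lv \<le> L" "Lt \<le> L" using Lu(1) Lv(1) Lt(1) by (auto simp: L_def)
  have W: "open ?W"
    by (intro open_Collect_less continuous_on_infdist continuous_on_id continuous_on_const)
  obtain \<phi> X where \<phi>: "has_C1_gradient UNIV \<phi> X"
    "\<And>x q. q \<in> ?K \<Longrightarrow> dist x q \<le> \<eta> / 2 \<Longrightarrow> \<phi> x = 1"
    "\<And>x. \<forall>q\<in>?K. dist x q \<ge> 2 * \<eta> \<Longrightarrow> \<phi> x = 0"
    by (rule C1_cutoff[OF K(1) \<eta>(1)]) (rule that)
  have \<phi>W: "has_C1_gradient ?W \<phi> X"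
    using \<phi>(1) by (auto simp: has_C1_gradient_def intro: continuous_on_subset)
  \<comment> \<open>A field that agrees with \<open>v \<nabla>u\<close> near the boundary and is defined on the whole plane, so that the divergence theorem applies to it on \<open>\<Omega>\<close>\<close>
  define F where "F x = (if x \<in> ?W then (\<phi> x * v x) *\<^sub>R p x else 0)" for x
  have "\<exists>G'. has_C1_gradient UNIV (\<lambda>x. F x $ i) G'" for i
  proof -
    obtain G' where "has_C1_gradient UNIV (\<lambda>x. if x \<in> ?W then (\<phi> x * v x) * p x $ i else 0) G'"
    proof (rule has_C1_gradient_extend_by_0[OF has_C1_gradient_mult[OF has_C1_gradient_mult[OF \<phi>W Gv] p(2)[of i]] W])
      show "closed (tube (2 * \<eta>))" by (rule closed_tube)
      show "tube (2 * \<eta>) \<subseteq> ?W" using \<eta>(1) by (auto simp: tube_def)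
      fix x assume x: "x \<in> ?W - tube (2 * \<eta>)"
      have "dist x q \<ge> 2 * \<eta>" if "q \<in> ?K" for q
        using infdist_le[OF that, of x] x by (simp add: tube_def)
      then show "\<phi> x * v x * p x $ i = 0" using \<phi>(3) by simp
    qed (rule that)
    moreover have "(\<lambda>x. if x \<in> ?W then (\<phi> x * v x) * p x $ i else 0) = (\<lambda>x. F x $ i)"
      by (auto simp: F_def)
    ultimately show ?thesis by auto
  qed
  then obtain G where G: "\<And>i. has_C1_gradient UNIV (\<lambda>x. F x $ i) (G i)" by metis
  have F: "F x = v x *\<^sub>R p x" if x: "x \<in> tube (\<eta> / 2)" for x
  proof -
    obtain q where "q \<in> ?K" "dist x q \<le> \<eta> / 2" using x by (rule tube_near)
    then have "\<phi> x = 1" by (rule \<phi>(2))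
    then show ?thesis using x \<eta>(1) by (simp add: F_def tube_def)
  qed
  have "\<exists>M. \<forall>x. infdist x \<Omega> \<le> 1 \<longrightarrow> norm (G i x) \<le> M" for i
  proof -
    have "continuous_on UNIV (G i)" using G[of i] by (simp add: has_C1_gradient_def)
    from bounded_near_region[OF region(2) \<open>\<Omega> \<noteq> {}\<close> this] show ?thesis by metis
  qed
  then obtain M' where M': "\<And>i x. infdist x \<Omega> \<le> 1 \<Longrightarrow> norm (G i x) \<le> M' i" by metis
  define M where "M = max (M' 1) (M' 2)"
  have M: "norm (G i x) \<le> M" if "infdist x \<Omega> \<le> 1" for i x
    using M'[OF that, of i] exhaust_2[of i] by (auto simp: M_def)
  \<comment> \<open>Off the layer the given functions need not even be measurable\<close>
  define U where "U x = indicator ?W x *\<^sub>R u x" for x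
  define V where "V x = indicator ?W x *\<^sub>R v x" for x
  have [measurable]: "U \<in> borel_measurable borel" "V \<in> borel_measurable borel"
    unfolding U_def[abs_def] V_def[abs_def]
    by (rule borel_measurable_continuous_on_indicator[OF borel_open[OF W]];
        rule has_C1_gradient_continuous, rule p Gv)+
  have pair: "boundary_pairing c (\<lambda>q. \<sigma> * normal_derivative \<Omega> c u q) v
    = \<sigma> * (orient * integral {0..1} (\<lambda>t. F (c t) \<bullet> rot (c' t)))"
  proof (rule boundary_pairing_eq[OF reg])
    fix x assume "x \<in> ?K"
    then have x: "infdist x ?K = 0" by simp
    then show "(u has_derivative (\<lambda>h. p x \<bullet> h)) (at x)" using p(1) \<eta>(1) by (simp add: has_C1_gradient_def)
    show "F x = v x *\<^sub>R p x" by (rule F) (use x \<eta>(1) in \<open>simp add: tube_def\<close>)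
  qed
  let ?B = "(4 * L\<^sup>2 * C + 4 * M * C) * \<sigma>"
  have est: "\<bar>inner_on (neumann_layer N \<Omega> \<delta>) (neumann N g \<Omega> \<delta> u) v
      - boundary_pairing c (\<lambda>q. \<sigma> * normal_derivative \<Omega> c u q) v\<bar> \<le> ?B * \<delta>"
    if \<delta>: "0 < \<delta>" "\<delta> \<le> 1" "\<delta> \<le> \<eta> / 2" for \<delta>
  proof -
    obtain k where k: "k \<in> borel_measurable borel" "\<And>r. k r \<ge> 0" "\<And>r. r \<ge> \<delta> \<Longrightarrow> k r = 0"
      "\<And>x. AE y in lebesgue. kernel g \<delta> x y = k (norm (y - x))"
      "isotropic_measure (density lborel (\<lambda>z. ennreal (k (norm z)))) \<delta> \<sigma>"
      by (rule kernel_measure[OF kernel \<delta>(1)]) (rule that)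
    interpret layer_problem \<Omega> c c' x0 "density lborel (\<lambda>z. ennreal (k (norm z)))" \<delta> \<sigma>
      by (intro layer_problem.intro reg k(5))
    have W': "x + w \<in> ?W" if "x \<in> tube \<delta>" "norm w \<le> \<delta>" for x w
      using infdist_add_le[of x w ?K] that \<delta> \<eta>(1) by (simp add: tube_def)
    have UV: "U (x + w) = u (x + w)" "V (x + w) = v (x + w)" if "x \<in> tube \<delta>" "norm w \<le> \<delta>" for x w
      using W'[OF that] by (simp_all add: U_def V_def)
    have UV0: "U x = u x" "V x = v x" if "x \<in> tube \<delta>" for x
      using UV[OF that, of 0] \<delta> by simp_all
    have near: "infdist x ?K \<le> \<eta>" "infdist x ?K \<le> 2 * \<eta>" "norm w \<le> \<eta>" if "x \<in> tube \<delta>" "norm w \<le> \<delta>" for x w :: plane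
      using that \<delta> \<eta>(1) by (auto simp: tube_def)
    show ?thesis unfolding pair
    proof (rule neumann_pairing_estimate[OF \<delta>(1,2) C G M k(1-4) refl])
      fix x w :: plane assume x: "x \<in> tube \<delta>" and w: "norm w \<le> \<delta>"
      show "u (x + w) = U (x + w)" using UV[OF x w] by simp
      have "\<bar>u (x + w) - u x\<bar> \<le> L * norm w" "\<bar>u (x + w) - u x - p x \<bullet> w\<bar> \<le> L * (norm w)\<^sup>2"
         "\<bar>v (x + w) - v x\<bar> \<le> L * norm w"
        using Lu(3)[OF near(1,3)[OF x w]] Lt(2)[OF near(1,3)[OF x w]] Lv(3)[OF near(1,3)[OF x w]]
          mult_right_mono[OF L(2), of "norm w"] mult_right_mono[OF L(3), of "norm w"] mult_right_mono[OF L(4), of "(norm w)\<^sup>2"]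
        by auto
      then show "\<bar>U (x + w) - U x\<bar> \<le> L * norm w" "\<bar>U (x + w) - U x - p x \<bullet> w\<bar> \<le> L * (norm w)\<^sup>2"
         "\<bar>V (x + w) - V x\<bar> \<le> L * norm w"
        using UV[OF x w] UV0[OF x] by simp_all
    next
      fix x assume x: "x \<in> tube \<delta>"
      show "v x = V x" using UV0[OF x] by simp
      have "infdist x ?K \<le> 2 * \<eta>" using x \<delta> \<eta>(1) by (simp add: tube_def)
      then show "\<bar>V x\<bar> \<le> L" using Lv(2)[of x] L(3) UV0[OF x] by simp
      have "x \<in> tube (\<eta> / 2)" using x \<delta>(3) by (simp add: tube_def)
      then show "F x = V x *\<^sub>R p x" using F[of x] UV0[OF x] by simp
    qed (use L(1) in auto)
  qed
  show ?thesis
  proof (rule bigoI)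
    have "\<forall>\<^sub>F \<delta> in at_right 0. 0 < \<delta> \<and> \<delta> < min 1 (\<eta> / 2)"
      using \<eta>(1) by (intro eventually_at_rightI[of 0 "min 1 (\<eta> / 2)"]) auto
    then show "\<forall>\<^sub>F \<delta> in at_right 0. norm (inner_on (neumann_layer N \<Omega> \<delta>) (neumann N g \<Omega> \<delta> u) v
              - boundary_pairing c (\<lambda>p. \<sigma> * normal_derivative \<Omega> c u p) v) \<le> ?B * norm \<delta>"
      by eventually_elim (use est in auto)
  qed
qed

end
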